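(* Let $\Phi:T\times\mathbb{R}^n\rightrightarrows\mathbb{R}^m$ be a set-valued normal integrand on a complete finite measure space $(T,\mathcal{A},\mu)$, and let $\bar x\in\operatorname{dom}E_\Phi$. Suppose that there exist $\rho>0$ and $\kappa\in L^1(T,\mathbb{R}_+)$ such that $\Phi_t(x)$ is convex for all $x\in\mathbb{B}_\rho(\bar x)$ and a.e. $t\in T_{na}$, and $\Phi_t(x)\subset\kappa(t)\mathbb{B}$ for all $x\in\mathbb{B}_\rho(\bar x)$ and a.e. $t\in T$. Suppose that $\Phi$ is integrably locally Lipschitzian around $\bar x$. Then for every $\bar y\in E_\Phi(\bar x)$ $$D^*E_\Phi(\bar x,\bar y)(y^* )\subset\int_T D^*\Phi_t(\bar x,\Phi_t(\bar x))(y^* )\,d\mu\quad\text{whenever } y^*\in\mathbb{R}^m,$$ where $D^*\Phi_t(\bar x,\Phi_t(\bar x))(y^* ):=\bigcup_{y\in\Phi_t(\bar x)}D^*\Phi_t(\bar x,y)(y^* )$.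
   Context: $\mathbb{R}_+:=\{\alpha\in\mathbb{R}:\alpha>0\}$; $L^p(T,\cdot)$ are the usual Lebesgue spaces; $\mathbb{B}_r(\cdot)$ is the closed ball, $\mathbb{B}$ the closed unit ball. $T=T_{pa}\cup T_{na}$ is the disjoint measurable decomposition of $T$ such that $\mu(\cdot\cap T_{pa})$ is purely atomic and $\mu(\cdot\cap T_{na})$ is nonatomic. For $\Phi:T\times\mathbb{R}^n\rightrightarrows\mathbb{R}^m$ write $\Phi_t:=\Phi(t,\cdot)$. $\Phi$ is a set-valued normal integrand if $\operatorname{gph}\Phi_t$ is closed for all $t\in T$ and $\operatorname{gph}\Phi\in\mathcal{A}\otimes\mathcal{B}(\mathbb{R}^n\times\mathbb{R}^m)$. The (Aumann) integral of $F:T\rightrightarrows\mathbb{R}^d$ is $\int_TF(t)d\mu=\{\int_T\mathsf{v}\,d\mu:\mathsf{v}\in L^1(T,\mathbb{R}^d),\ \mathsf{v}(t)\in F(t)\text{ a.e.}\}$. $E_\Phi(x):=\int_T\Phi_t(x)d\mu$. Integrably locally Lipschitzian around $\bar x$: there exist $\eta>0$, $\ell\in L^1(T,\mathbb{R}_+)$ and $\hat T\in\mathcal{A}$ with $\mu(T\setminus\hat T)=0$ such that $\Phi_t(x)\subset\Phi_t(x')+\ell(t)\|x-x'\|\mathbb{B}$ for all $t\in\hat T$ and $x,x'\in\mathbb{B}_\eta(\bar x)$. Regular normal cone: $\hat N(\bar z;\Omega)=\{z^*:\limsup_{z\to\bar z,z\in\Omega}\langle z^*,z-\bar z\rangle/\|z-\bar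 z\|\le0\}$ for $\bar z\in\Omega$, $\emptyset$ otherwise. Limiting normal cone: $N(\bar z;\Omega)=\{z^*:\exists z_k\to\bar z,\ z_k^*\to z^*,\ z_k^*\in\hat N(z_k;\Omega)\}$. Limiting coderivative at $(x,y)\in\operatorname{gph}G$: $D^*G(x,y)(y^* )=\{x^*:(x^*,-y^* )\in N((x,y);\operatorname{gph}G)\}$. *)

theory Defs
  imports "HOL-Analysis.Analysis"
begin

definition is_atom :: "'t measure \<Rightarrow> 't set \<Rightarrow> bool" where
  "is_atom M A \<longleftrightarrow> A \<in> sets M \<and> emeasure M A > 0 \<and>
     (\<forall>B\<in>sets M. B \<subseteq> A \<longrightarrow> emeasure M B = 0 \<or> emeasure M (A - B) = 0)"

definition nonatomic :: "'t measure \<Rightarrow> bool" where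
  "nonatomic M \<longleftrightarrow> \<not> (\<exists>A. is_atom M A)"

definition purely_atomic :: "'t measure \<Rightarrow> bool" where
  "purely_atomic M \<longleftrightarrow>
     (\<forall>B\<in>sets M. emeasure M B > 0 \<longrightarrow> (\<exists>A. is_atom M A \<and> A \<subseteq> B))"

text \<open>The measure \<open>density M (indicator S)\<close> is \<open>X \<mapsto> \<mu>(X \<inter> S)\<close> on the sigma-algebra of \<open>M\<close>.\<close>

definition atomic_decomposition :: "'t measure \<Rightarrow> 't set \<Rightarrow> 't set \<Rightarrow> bool" where
  "atomic_decomposition M Tpa Tna \<longleftrightarrow>
     Tpa \<in> sets M \<and> Tna \<in> sets M \<and> Tpa \<inter> Tna = {} \<and> Tpa \<union> Tna = space M \<and>
     purely_atomic (density M (indicator Tpa)) \<and> nonatomic (density M (indicator Tna))"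

definition gph :: "('a \<Rightarrow> 'b set) \<Rightarrow> ('a \<times> 'b) set" where
  "gph G = {(x, y). y \<in> G x}"

definition sv_dom :: "('a \<Rightarrow> 'b set) \<Rightarrow> 'a set" where
  "sv_dom G = {x. G x \<noteq> {}}"

definition sv_normal_integrand ::
  "'t measure \<Rightarrow> ('t \<Rightarrow> 'a::euclidean_space \<Rightarrow> 'b::euclidean_space set) \<Rightarrow> bool" where
  "sv_normal_integrand M \<Phi> \<longleftrightarrow>
     (\<forall>t\<in>space M. closed (gph (\<Phi> t))) \<and>
     {(t, x, y). t \<in> space M \<and> y \<in> \<Phi> t x} \<in> sets (M \<Otimes>\<^sub>M (borel :: ('a \<times> 'b) measure))"

definition aumann_integral ::
  "'t measure \<Rightarrow> ('t \<Rightarrow> 'b::euclidean_space set) \<Rightarrow> 'b set" where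
  "aumann_integral M F =
     {integral\<^sup>L M v | v. integrable M v \<and> (AE t in M. v t \<in> F t)}"

definition expected_integral ::
  "'t measure \<Rightarrow> ('t \<Rightarrow> 'a \<Rightarrow> 'b::euclidean_space set) \<Rightarrow> 'a \<Rightarrow> 'b set" where
  "expected_integral M \<Phi> x = aumann_integral M (\<lambda>t. \<Phi> t x)"

text \<open>The sum of sets below is the Minkowski sum, and the image is a scaled closed unit ball.\<close>

definition integrably_locally_Lipschitzian ::
  "'t measure \<Rightarrow> ('t \<Rightarrow> 'a::euclidean_space \<Rightarrow> 'b::euclidean_space set) \<Rightarrow> 'a \<Rightarrow> bool" where
  "integrably_locally_Lipschitzian M \<Phi> xbar \<longleftrightarrow>
     (\<exists>\<eta>>0. \<exists>l :: 't \<Rightarrow> real. \<exists>That\<in>sets M.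
        integrable M l \<and> (\<forall>t\<in>space M. l t > 0) \<and> emeasure M (space M - That) = 0 \<and>
        (\<forall>t\<in>That. \<forall>x\<in>cball xbar \<eta>. \<forall>x'\<in>cball xbar \<eta>.
           \<Phi> t x \<subseteq> \<Phi> t x' + (*\<^sub>R) (l t * norm (x - x')) ` cball 0 1))"

text \<open>The filter \<open>at z within \<Omega>\<close> excludes \<open>z\<close> itself; at an isolated point of \<open>\<Omega>\<close> the upper limit
  is \<open>-\<infinity>\<close>, so every vector is a regular normal there.\<close>

definition regular_normal_cone :: "'a::real_inner set \<Rightarrow> 'a \<Rightarrow> 'a set" where
  "regular_normal_cone \<Omega> z =
     (if z \<in> \<Omega>
      then {zs. Limsup (at z within \<Omega>) (\<lambda>w. ereal ((zs \<bullet> (w - z)) / norm (w - z))) \<le> 0}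
      else {})"

definition limiting_normal_cone :: "'a::real_inner set \<Rightarrow> 'a \<Rightarrow> 'a set" where
  "limiting_normal_cone \<Omega> z =
     {zs. \<exists>w ws. w \<longlonglongrightarrow> z \<and> ws \<longlonglongrightarrow> zs \<and> (\<forall>k::nat. ws k \<in> regular_normal_cone \<Omega> (w k))}"

text \<open>The coderivative is only meant for \<open>(x, y) \<in> gph G\<close>.\<close>

definition coderivative ::
  "('a::real_inner \<Rightarrow> 'b::real_inner set) \<Rightarrow> 'a \<Rightarrow> 'b \<Rightarrow> 'b \<Rightarrow> 'a set" where
  "coderivative G x y ys = {xs. (xs, - ys) \<in> limiting_normal_cone (gph G) (x, y)}"

end

theory Submission
  imports Defs "HOL-Library.Diagonal_Subsequence"
begin

text \<open>Write \<open>E\<close> for the expected integral. A regular normal \<open>(xs, - ys)\<close> to the graph of \<open>E\<close> at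
  \<open>(x, y)\<close>, where \<open>y\<close> is the integral of a selection \<open>v\<close> of \<open>\<Phi> t x\<close>, bounds \<open>E\<close> from below only
  near \<open>(x, y)\<close>. Adding to the linear form \<open>ys\<close> a smooth pointwise penalty that keeps the selections
  close to \<open>v\<close> on average turns this into an approximate global inequality. Minimising the penalised
  cost with the decoupling term \<open>N |u - x'|\<^sup>2\<close> pointwise over the graphs of the \<open>\<Phi> t\<close>, and then its
  integral over \<open>x'\<close>, yields measurable exact regular normals to these graphs: the stationarity
  condition in \<open>x'\<close> is precisely the equation for the integral of their first components. These
  components are integrably bounded by the Lipschitz modulus, so a finite-dimensional Fatou lemma
  provides a selection of their pointwise cluster points with integral \<open>xs\<close>. On the nonatomic part
  this lemma rests on Lyapunov's convexity theorem; on atoms measurable functions are constant.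
  Measurable selections come from the projection theorem for complete finite measures.\<close>

section \<open>Measurable projections and selections\<close>

text \<open>The obstacle is that the regular normal inequality for \<open>E\<close> sees only the
  integral of a selection, while pointwise minimisation also admits selections that are far from
  \<open>v\<close> on a set of small measure. Three linked scales deal with this: \<open>e\<close>
  is the tolerance in the definition of a regular normal, \<open>d\<close> the radius for
  \<open>x'\<close>, and \<open>a = d / e\<close> the width below which the penalty is flat. Within
  \<open>a\<close> of \<open>v\<close> the local inequality can be used after integration; beyond
  \<open>a\<close> the penalty outgrows the linear form \<open>ys\<close>. The loss is of order
  \<open>d * defect (norm ys) e\<close>, and division by \<open>d\<close> leaves a quantity that
  vanishes with \<open>e\<close>, although \<open>l\<close> is only integrable and its square need
  not be. Compactness of the graphs over a ball provides exact minimisers, so neither a variational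
  principle nor a fuzzy sum rule enters: normals are read off from the quadratic growth of a smooth
  cost. In the Fatou lemma the set of integrals of cluster selections is not known to be closed;
  weak separation is still enough, because the case of equality lowers the dimension.\<close>

definition suslin_scheme :: "'t measure \<Rightarrow> ((nat \<Rightarrow> nat) \<Rightarrow> nat \<Rightarrow> ('t \<times> 'a::euclidean_space) set) \<Rightarrow> bool" where
  "suslin_scheme M S \<longleftrightarrow> (\<forall>\<sigma> n. \<exists>A\<in>sets M. \<exists>C. compact C \<and> S \<sigma> n = A \<times> C) \<and>
     (\<forall>\<sigma> \<tau> n. (\<forall>i\<le>n. \<sigma> i = \<tau> i) \<longrightarrow> S \<sigma> n = S \<tau> n)"

text \<open>The result of the Suslin operation on rectangles with measurable base and compact fibre.
  Compact fibres are what later allows nested sections to be intersected.\<close>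

definition suslin :: "'t measure \<Rightarrow> ('t \<times> 'a::euclidean_space) set \<Rightarrow> bool" where
  "suslin M G \<longleftrightarrow> (\<exists>S. suslin_scheme M S \<and> G = (\<Union>\<sigma>. \<Inter>n. S \<sigma> n))"

lemma suslin_schemeD:
  assumes "suslin_scheme M S"
  shows "\<exists>A\<in>sets M. \<exists>C. compact C \<and> S \<sigma> n = A \<times> C" "\<forall>i\<le>n. \<sigma> i = \<tau> i \<Longrightarrow> S \<sigma> n = S \<tau> n"
  using assms unfolding suslin_scheme_def by blast+

lemma suslinI:
  fixes S :: "(nat \<Rightarrow> nat) \<Rightarrow> nat \<Rightarrow> ('t \<times> 'a::euclidean_space) set"
  assumes "G = (\<Union>\<sigma>. \<Inter>n. S \<sigma> n)" and "\<And>\<sigma> \<tau> n. \<forall>i\<le>n. \<sigma> i = \<tau> i \<Longrightarrow> S \<sigma> n = S \<tau> n"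
    and "\<And>\<sigma> n. \<exists>A\<in>sets M. \<exists>C. compact C \<and> S \<sigma> n = A \<times> C"
  shows "suslin M G"
  unfolding suslin_def suslin_scheme_def
  by (rule exI[of _ S], intro conjI allI impI) (fact assms(3), erule assms(2), fact assms(1))

section \<open>Closure properties of Suslin sets and the product sigma-algebra\<close>

lemma suslin_times_compact:
  assumes "A \<in> sets M" "compact C"
  shows "suslin M (A \<times> C)"
  by (rule suslinI[where S = "\<lambda>\<sigma> n. A \<times> C"]) (use assms in auto)

lemma suslin_UN:
  fixes G :: "nat \<Rightarrow> ('t \<times> 'a::euclidean_space) set"
  assumes "\<And>i. suslin M (G i)"
  shows "suslin M (\<Union>i. G i)"
proof -
  have "\<forall>i. \<exists>S. suslin_scheme M S \<and> G i = (\<Union>\<sigma>. \<Inter>n. S \<sigma> n)" using assms by (simp add: suslin_def)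
  then obtain S where S: "\<forall>i. suslin_scheme M (S i) \<and> G i = (\<Union>\<sigma>. \<Inter>n. S i \<sigma> n)"
    by (rule choice[THEN exE])
  then have S0: "\<And>i. suslin_scheme M (S i)" and S3: "\<And>i. G i = (\<Union>\<sigma>. \<Inter>n. S i \<sigma> n)" by blast+
  note S1 = suslin_schemeD(1)[OF S0] and S2 = suslin_schemeD(2)[OF S0]
  \<comment> \<open>Level \<open>0\<close> of a scheme may read only \<open>\<sigma> 0\<close>, so
    this one entry has to carry both the index of the chosen set and the first entry of the sequence
    for that set.\<close>
  define R where "R \<sigma> n = S (fst (prod_decode (\<sigma> 0))) (\<sigma>(0 := snd (prod_decode (\<sigma> 0)))) n" for \<sigma> n
  have "(\<Union>i. G i) = (\<Union>\<sigma>. \<Inter>n. R \<sigma> n)"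
  proof (intro equalityI subsetI)
    fix x assume "x \<in> (\<Union>i. G i)"
    then obtain i \<sigma> where x: "\<And>n. x \<in> S i \<sigma> n" unfolding S3 by blast
    define \<tau> where "\<tau> = \<sigma>(0 := prod_encode (i, \<sigma> 0))"
    have "R \<tau> n = S i \<sigma> n" for n by (simp add: R_def \<tau>_def)
    then show "x \<in> (\<Union>\<sigma>. \<Inter>n. R \<sigma> n)" using x by blast
  next
    fix x assume "x \<in> (\<Union>\<sigma>. \<Inter>n. R \<sigma> n)"
    then show "x \<in> (\<Union>i. G i)" unfolding S3 R_def by blast
  qed
  moreover have "R \<sigma> n = R \<tau> n" if "\<forall>i\<le>n. \<sigma> i = \<tau> i" for \<sigma> \<tau> n
    unfolding R_def using that by (auto intro!: S2)
  moreover have "\<exists>A\<in>sets M. \<exists>C. compact C \<and> R \<sigma> n = A \<times> C" for \<sigma> n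
    unfolding R_def by (rule S1)
  ultimately show ?thesis by (rule suslinI)
qed

text \<open>When countably many sequences are interleaved, this ensures that the entries up to the
  code of \<open>(i, n)\<close> include the entries \<open>0\<close> to \<open>n\<close> of row
  \<open>i\<close>, as the prefix condition of a scheme requires.\<close>

lemma prod_encode_mono_right: "j \<le> k \<Longrightarrow> prod_encode (i, j) \<le> prod_encode (i, k)"
  by (auto simp: prod_encode_def triangle_def intro!: div_le_mono add_mono mult_le_mono)

lemma suslin_INT:
  fixes G :: "nat \<Rightarrow> ('t \<times> 'a::euclidean_space) set"
  assumes "\<And>i. suslin M (G i)"
  shows "suslin M (\<Inter>i. G i)"
proof -
  have "\<forall>i. \<exists>S. suslin_scheme M S \<and> G i = (\<Union>\<sigma>. \<Inter>n. S \<sigma> n)" using assms by (simp add: suslin_def)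
  then obtain S where S: "\<forall>i. suslin_scheme M (S i) \<and> G i = (\<Union>\<sigma>. \<Inter>n. S i \<sigma> n)"
    by (rule choice[THEN exE])
  then have S0: "\<And>i. suslin_scheme M (S i)" and S3: "\<And>i. G i = (\<Union>\<sigma>. \<Inter>n. S i \<sigma> n)" by blast+
  note S1 = suslin_schemeD(1)[OF S0] and S2 = suslin_schemeD(2)[OF S0]
  \<comment> \<open>One sequence stores a witness for every \<open>G i\<close>, namely its row
    \<open>i\<close> under \<open>prod_encode\<close>; the level with code \<open>(i, j)\<close>
    tests level \<open>j\<close> of the scheme of \<open>G i\<close>.\<close>
  define R where "R \<sigma> n = S (fst (prod_decode n)) (\<lambda>j. \<sigma> (prod_encode (fst (prod_decode n), j))) (snd (prod_decode n))"
    for \<sigma> n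
  have R_enc: "R \<sigma> (prod_encode (i, j)) = S i (\<lambda>j. \<sigma> (prod_encode (i, j))) j" for \<sigma> i j
    by (simp add: R_def)
  have "(\<Inter>i. G i) = (\<Union>\<sigma>. \<Inter>n. R \<sigma> n)"
  proof (intro equalityI subsetI)
    fix x assume "x \<in> (\<Inter>i. G i)"
    then have "\<forall>i. \<exists>\<sigma>. \<forall>n. x \<in> S i \<sigma> n" unfolding S3 by simp
    then obtain s where s: "\<And>i n. x \<in> S i (s i) n" by metis
    define \<sigma> where "\<sigma> m = s (fst (prod_decode m)) (snd (prod_decode m))" for m
    have "R \<sigma> n = S (fst (prod_decode n)) (s (fst (prod_decode n))) (snd (prod_decode n))" for n
      by (simp add: R_def \<sigma>_def)
    then have "\<forall>n. x \<in> R \<sigma> n" using s by simp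
    then show "x \<in> (\<Union>\<sigma>. \<Inter>n. R \<sigma> n)" by auto
  next
    fix x assume "x \<in> (\<Union>\<sigma>. \<Inter>n. R \<sigma> n)"
    then obtain \<sigma> where \<sigma>: "\<And>n. x \<in> R \<sigma> n" by auto
    show "x \<in> (\<Inter>i. G i)" unfolding S3
    proof (intro INT_I UN_I)
      fix i n show "x \<in> S i (\<lambda>j. \<sigma> (prod_encode (i, j))) n"
        using \<sigma>[of "prod_encode (i, n)"] by (simp add: R_enc)
    qed auto
  qed
  moreover have "R \<sigma> n = R \<tau> n" if "\<forall>i\<le>n. \<sigma> i = \<tau> i" for \<sigma> \<tau> n
    unfolding R_def
  proof (rule S2, intro allI impI)
    fix j assume "j \<le> snd (prod_decode n)"
    then have "prod_encode (fst (prod_decode n), j) \<le> prod_encode (fst (prod_decode n), snd (prod_decode n))"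
      by (rule prod_encode_mono_right)
    then show "\<sigma> (prod_encode (fst (prod_decode n), j)) = \<tau> (prod_encode (fst (prod_decode n), j))"
      using that by simp
  qed
  moreover have "\<exists>A\<in>sets M. \<exists>C. compact C \<and> R \<sigma> n = A \<times> C" for \<sigma> n
    unfolding R_def by (rule S1)
  ultimately show ?thesis by (rule suslinI)
qed

lemma suslin_Un: "suslin M G \<Longrightarrow> suslin M H \<Longrightarrow> suslin M (G \<union> H)"
proof -
  assume *: "suslin M G" "suslin M H"
  have "suslin M (\<Union>i::nat. if i = 0 then G else H)"
    by (rule suslin_UN) (use * in auto)
  moreover have "(\<Union>i::nat. if i = 0 then G else H) = G \<union> H"
    by (auto split: if_splits)
  ultimately show ?thesis by simp
qed

lemma suslin_times_closed:
  assumes "A \<in> sets M" "closed (C::'a::euclidean_space set)"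
  shows "suslin M (A \<times> C)"
proof -
  have "(\<Union>n. cball (0::'a) (real n)) = UNIV"
    using real_arch_simple by (auto simp: set_eq_iff)
  then have "A \<times> C = (\<Union>n. A \<times> (C \<inter> cball 0 (real n)))" by blast
  moreover have "suslin M (\<Union>n. A \<times> (C \<inter> cball 0 (real n)))"
    using assms by (intro suslin_UN suslin_times_compact closed_Int_compact) auto
  ultimately show ?thesis by simp
qed

lemma suslin_times_open:
  assumes "A \<in> sets M" "open (U::'a::euclidean_space set)"
  shows "suslin M (A \<times> U)"
proof -
  obtain C where "\<And>n::nat. compact (C n)" "(\<Union>n. C n) = U"
    using open_Union_compact_subsets[OF assms(2)] by metis
  then have "A \<times> U = (\<Union>n. A \<times> C n)" "\<And>n. compact (C n)" by auto
  then show ?thesis using assms by (auto intro!: suslin_UN suslin_times_compact)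
qed

text \<open>Suslin sets are not closed under complements in general, so the induction over the
  generated sigma-algebra carries each set together with its complement.\<close>

lemma suslin_sets_pair:
  fixes G :: "('t \<times> 'a::euclidean_space) set"
  assumes "G \<in> sets (M \<Otimes>\<^sub>M borel)"
  shows "suslin M G"
proof -
  let ?P = "\<lambda>G. suslin M G \<and> suslin M (space M \<times> UNIV - G)"
  have UN: "?P (\<Union>i::nat. G i)" if "\<And>i. ?P (G i)" for G
  proof
    show "suslin M (\<Union>i. G i)" using that by (intro suslin_UN) auto
    have eq: "space M \<times> UNIV - (\<Union>i. G i) = (\<Inter>i. space M \<times> UNIV - G i)" by blast
    show "suslin M (space M \<times> UNIV - (\<Union>i. G i))"
      unfolding eq using that by (intro suslin_INT) auto
  qed
  have dbl: "suslin M (space M \<times> UNIV - (space M \<times> UNIV - H))" if "suslin M H" "H \<subseteq> space M \<times> UNIV" for H :: "('t \<times> 'a) set"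
    using that by (simp add: double_diff)
  have full: "suslin M (space M \<times> (UNIV::'a set))" by (rule suslin_times_closed) auto
  have rect: "?P (A \<times> B)" if A: "A \<in> sets M" and B: "B \<in> sets borel" for A and B :: "'a set"
  proof -
    have "B \<in> sigma_sets UNIV (Collect closed)" using B by (simp add: borel_eq_closed)
    then show ?thesis
    proof induction
      case (Basic B)
      have eq: "space M \<times> UNIV - A \<times> B = (space M - A) \<times> UNIV \<union> A \<times> (- B)"
        using sets.sets_into_space[OF A] by auto
      show ?case unfolding eq using Basic A
        by (intro conjI suslin_Un suslin_times_open suslin_times_closed[of A M B]) auto
    next
      case Empty
      then show ?case using full suslin_times_compact[OF A, of "{}::'a set"] by auto
    next
      case (Compl B)
      have 1: "A \<times> (UNIV - B) = (space M \<times> UNIV - A \<times> B) \<inter> A \<times> UNIV"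
        using sets.sets_into_space[OF A] by auto
      have 2: "space M \<times> UNIV - A \<times> (UNIV - B) = (space M - A) \<times> UNIV \<union> A \<times> B"
        using sets.sets_into_space[OF A] by auto
      have Int: "suslin M (G \<inter> H)" if "suslin M G" "suslin M H" for G H :: "('t \<times> 'a) set"
      proof -
        have "suslin M (\<Inter>i::nat. if i = 0 then G else H)"
          by (rule suslin_INT) (use that in auto)
        moreover have "(\<Inter>i::nat. if i = 0 then G else H) = G \<inter> H"
          by (auto split: if_splits)
        ultimately show ?thesis by simp
      qed
      have "suslin M (A \<times> (UNIV - B))" unfolding 1 using Compl A
        by (intro Int suslin_times_closed) auto
      moreover have "suslin M (space M \<times> UNIV - A \<times> (UNIV - B))" unfolding 2 using Compl A
        by (intro suslin_Un) (auto intro: suslin_times_closed[of "space M - A" M UNIV])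
      ultimately show ?case by blast
    next
      case (Union B)
      have "A \<times> (\<Union>i. B i) = (\<Union>i. A \<times> B i)" by blast
      then show ?case using UN[of "\<lambda>i. A \<times> B i"] Union by auto
    qed
  qed
  have "G \<in> sigma_sets (space M \<times> UNIV) {a \<times> b |a b. a \<in> sets M \<and> b \<in> sets (borel::'a measure)}"
    using assms by (simp add: sets_pair_measure)
  then have "?P G \<and> G \<subseteq> space M \<times> UNIV"
  proof induction
    case (Basic G)
    then show ?case using rect sets.sets_into_space by fastforce
  next
    case Empty
    then show ?case using full suslin_times_compact[of "{}" M "{}::'a set"] by auto
  next
    case (Compl G)
    then show ?case using dbl by auto
  next
    case (Union G)
    then show ?case using UN[of G] by auto
  qed
  then show ?thesis by blast
qed

text \<open>Koenig's lemma for a finitely branching tree: a product of finite discrete spaces is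
  compact, and convergence in it means that each entry is eventually constant.\<close>

lemma koenig_bounded:
  fixes b :: "nat \<Rightarrow> nat" and s :: "nat \<Rightarrow> nat \<Rightarrow> nat"
  assumes "\<And>k i. i \<le> k \<Longrightarrow> s k i \<le> b i"
  shows "\<exists>\<sigma>. \<forall>n. \<exists>k\<ge>n. \<forall>i\<le>n. s k i = \<sigma> i"
proof -
  \<comment> \<open>The bound on \<open>s k i\<close> is available only for
    \<open>i \<le> k\<close>. Truncation puts every \<open>r k\<close> into the compact product and
    changes none of these entries.\<close>
  define r where "r k i = min (s k i) (b i)" for k i
  have "compactin (product_topology (\<lambda>i. euclidean) UNIV) (PiE UNIV (\<lambda>i. {..b i}))"
    by (subst compactin_PiE) (auto simp: finite_imp_compact)
  then have "compact (PiE UNIV (\<lambda>i. {..b i}))"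
    by (simp add: euclidean_product_topology)
  then have "seq_compact (PiE UNIV (\<lambda>i. {..b i}))"
    by (rule compact_imp_seq_compact)
  moreover have "\<forall>k. r k \<in> PiE UNIV (\<lambda>i. {..b i})" by (auto simp: r_def)
  ultimately obtain \<sigma> f where f: "strict_mono f" and lim: "(r \<circ> f) \<longlonglongrightarrow> \<sigma>"
    by (meson seq_compactE)
  have ev: "eventually (\<lambda>k. r (f k) i = \<sigma> i) sequentially" for i
  proof -
    have "(\<lambda>k. r (f k) i) \<longlonglongrightarrow> \<sigma> i"
      using continuous_on_tendsto_compose[OF continuous_on_product_coordinates lim, of i]
      by (simp add: o_def)
    then show ?thesis by (simp add: tendsto_discrete)
  qed
  have "\<exists>k\<ge>n. \<forall>i\<le>n. s k i = \<sigma> i" for n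
  proof -
    have "eventually (\<lambda>k. \<forall>i\<in>{..n}. r (f k) i = \<sigma> i) sequentially"
      using ev by (intro eventually_ball_finite) auto
    then obtain N where "\<And>k. k \<ge> N \<Longrightarrow> \<forall>i\<le>n. r (f k) i = \<sigma> i"
      unfolding eventually_sequentially by auto
    then have k: "max n N \<ge> n" "\<forall>i\<le>n. r (f (max n N)) i = \<sigma> i" by auto
    define k where "k = max n N"
    note k = k[folded k_def]
    have "f k \<ge> n" using k(1) seq_suble[OF f, of k] by linarith
    then show ?thesis using k(2) assms by (intro exI[of _ "f k"]) (force simp: r_def)
  qed
  then show ?thesis by blast
qed

text \<open>Choquet's capacitability argument. Outer measure is continuous along increasing
  sequences of arbitrary sets, so the entries of \<open>\<sigma>\<close> can be bounded one after
  the other while the projection keeps outer measure above \<open>e\<close>. The tree that remains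
  is finitely branching: its finite levels have measurable projections, and compactness brings the
  intersection of these projections back into the projection of \<open>G\<close>.\<close>

lemma (in finite_measure) projection_inner_approx:
  fixes G :: "('a \<times> 'b::euclidean_space) set"
  assumes "suslin M G" and GM: "G \<subseteq> space M \<times> UNIV" and e: "e < outer_measure_of M (fst ` G)"
  shows "\<exists>B\<in>sets M. B \<subseteq> fst ` G \<and> e \<le> emeasure M B"
proof -
  obtain S where S: "suslin_scheme M S" and S3: "G = (\<Union>\<sigma>. \<Inter>n. S \<sigma> n)"
    using assms(1) unfolding suslin_def by blast
  note S1 = suslin_schemeD(1)[OF S] and S2 = suslin_schemeD(2)[OF S]
  define U where "U k b = {\<sigma>. \<forall>i\<le>k. \<sigma> i \<le> b i}" for k :: nat and b :: "nat \<Rightarrow> nat"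
  define Z where "Z \<sigma> = (\<Inter>n. S \<sigma> n)" for \<sigma>
  have GZ: "G = (\<Union>\<sigma>. Z \<sigma>)" unfolding S3 Z_def ..
  define X where "X k b = fst ` (\<Union>\<sigma>\<in>U k b. Z \<sigma>)" for k b
  have "X k b \<subseteq> fst ` G" for k b unfolding X_def GZ by (intro image_mono) blast
  then have XM: "X k b \<subseteq> space M" for k b using GM by fastforce
  have "\<exists>f. \<forall>k. e < outer_measure_of M (X k (f k)) \<and> (\<forall>i\<le>k. f (Suc k) i = f k i)"
  proof (rule dependent_nat_choice)
    have "U 0 (\<lambda>_. m) \<subseteq> U 0 (\<lambda>_. Suc m)" for m by (auto simp: U_def)
    then have "incseq (\<lambda>m. X 0 (\<lambda>_. m))"
      unfolding X_def by (intro incseq_SucI image_mono UN_mono) auto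
    moreover have "(\<Union>m. X 0 (\<lambda>_. m)) = fst ` G"
    proof -
      have "(\<Union>m. U 0 (\<lambda>_. m)) = UNIV" by (auto simp: U_def)
      then show ?thesis unfolding X_def GZ by blast
    qed
    ultimately have "(SUP m. outer_measure_of M (X 0 (\<lambda>_. m))) = outer_measure_of M (fst ` G)"
      using SUP_outer_measure_of_incseq[of "\<lambda>m. X 0 (\<lambda>_. m)" M] XM by simp
    then show "\<exists>b. e < outer_measure_of M (X 0 b)"
      using e by (metis (no_types, lifting) less_SUP_iff)
  next
    fix b k assume b: "e < outer_measure_of M (X k b)"
    have "U (Suc k) (b(Suc k := m)) \<subseteq> U (Suc k) (b(Suc k := Suc m))" for m
      by (auto simp: U_def le_Suc_eq)
    then have "incseq (\<lambda>m. X (Suc k) (b(Suc k := m)))"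
      unfolding X_def by (intro incseq_SucI image_mono UN_mono) auto
    moreover have "(\<Union>m. X (Suc k) (b(Suc k := m))) = X k b"
    proof -
      have "(\<Union>m. U (Suc k) (b(Suc k := m))) = U k b" by (auto simp: U_def le_Suc_eq)
      then show ?thesis unfolding X_def by blast
    qed
    ultimately have "(SUP m. outer_measure_of M (X (Suc k) (b(Suc k := m)))) = outer_measure_of M (X k b)"
      using SUP_outer_measure_of_incseq[of "\<lambda>m. X (Suc k) (b(Suc k := m))" M] XM by simp
    then obtain m where "e < outer_measure_of M (X (Suc k) (b(Suc k := m)))"
      using b by (metis (no_types, lifting) less_SUP_iff)
    then show "\<exists>b'. e < outer_measure_of M (X (Suc k) b') \<and> (\<forall>i\<le>k. b' i = b i)"
      by (intro exI[of _ "b(Suc k := m)"]) auto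
  qed
  then obtain f :: "nat \<Rightarrow> nat \<Rightarrow> nat" where f: "\<And>k. e < outer_measure_of M (X k (f k))"
    and fS: "\<And>k i. i \<le> k \<Longrightarrow> f (Suc k) i = f k i" by blast
  \<comment> \<open>Entry \<open>i\<close> of the bounds is frozen from stage \<open>i\<close> on,
    so the diagonal agrees with \<open>f k\<close> on all indices up to \<open>k\<close>.\<close>
  define b where "b i = f i i" for i
  have fb: "f k i = b i" if "i \<le> k" for k i
    using that by (induction k rule: dec_induct) (auto simp: b_def fS)
  have U_trunc: "U k (f k) = U k b" for k using fb by (auto simp: U_def)
  \<comment> \<open>The levels up to \<open>k\<close> read only the entries up to \<open>k\<close>.
    Replacing the others by \<open>0\<close> leaves finitely many representatives of the infinite
    set \<open>U k b\<close>.\<close>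
  define V where "V k = (\<lambda>\<sigma> i. if i \<le> k then \<sigma> i else 0) ` U k b" for k :: nat
  have finV: "finite (V k)" for k
  proof (rule finite_subset)
    show "V k \<subseteq> {\<sigma>. \<forall>i. (i \<in> {..k} \<longrightarrow> \<sigma> i \<in> {..\<Sum>i\<le>k. b i}) \<and> (i \<notin> {..k} \<longrightarrow> \<sigma> i = 0)}"
    proof (clarsimp simp: V_def U_def)
      fix \<sigma> :: "nat \<Rightarrow> nat" and i assume "\<forall>i\<le>k. \<sigma> i \<le> b i" "i \<le> k"
      then have "\<sigma> i \<le> b i" by blast
      also have "b i \<le> (\<Sum>i\<le>k. b i)" using \<open>i \<le> k\<close> by (intro member_le_sum) auto
      finally show "\<sigma> i \<le> (\<Sum>i\<le>k. b i)" .
    qed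
    show "finite {\<sigma>. \<forall>i. (i \<in> {..k} \<longrightarrow> \<sigma> i \<in> {..\<Sum>i\<le>k. b i}) \<and> (i \<notin> {..k} \<longrightarrow> \<sigma> i = (0::nat))}"
      by (rule finite_set_of_finite_funs) auto
  qed
  have VS: "(\<Union>\<tau>\<in>V k. \<Inter>n\<le>k. S \<tau> n) = (\<Union>\<sigma>\<in>U k b. \<Inter>n\<le>k. S \<sigma> n)" for k
  proof -
    have "S (\<lambda>i. if i \<le> k then \<sigma> i else 0) n = S \<sigma> n" if "n \<le> k" for \<sigma> n
      using that by (intro S2) auto
    then show ?thesis unfolding V_def by simp
  qed
  have rect: "\<exists>A\<in>sets M. \<exists>C. compact C \<and> (\<Inter>n\<le>k. S \<sigma> n) = A \<times> C" for k \<sigma>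
  proof (induction k)
    case 0
    then show ?case using S1[of \<sigma> 0] by simp
  next
    case (Suc k)
    obtain A C A' C' where "A \<in> sets M" "compact C" "(\<Inter>n\<le>k. S \<sigma> n) = A \<times> C"
      "A' \<in> sets M" "compact C'" "S \<sigma> (Suc k) = A' \<times> C'" using Suc S1[of \<sigma> "Suc k"] by blast
    then have "(\<Inter>n\<le>Suc k. S \<sigma> n) = (A' \<inter> A) \<times> (C' \<inter> C)" "A' \<inter> A \<in> sets M" "compact (C' \<inter> C)"
      by (auto simp: atMost_Suc intro: compact_Int)
    then show ?case by blast
  qed
  have "\<forall>k \<sigma>. \<exists>q. fst q \<in> sets M \<and> compact (snd q) \<and> (\<Inter>n\<le>k. S \<sigma> n) = fst q \<times> snd q"
  proof (intro allI)
    fix k \<sigma>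
    obtain A C where "A \<in> sets M" "compact C" "(\<Inter>n\<le>k. S \<sigma> n) = A \<times> C" using rect[where k=k and \<sigma>=\<sigma>] by blast
    then show "\<exists>q. fst q \<in> sets M \<and> compact (snd q) \<and> (\<Inter>n\<le>k. S \<sigma> n) = fst q \<times> snd q"
      by (intro exI[of _ "(A, C)"]) auto
  qed
  then obtain q where q: "\<And>k \<sigma>. fst (q k \<sigma>) \<in> sets M \<and> compact (snd (q k \<sigma>)) \<and>
      (\<Inter>n\<le>k. S \<sigma> n) = fst (q k \<sigma>) \<times> snd (q k \<sigma>)"
    unfolding choice_iff by blast
  define A where "A k \<sigma> = fst (q k \<sigma>)" for k \<sigma>
  define C where "C k \<sigma> = snd (q k \<sigma>)" for k \<sigma>
  have A: "\<And>k \<sigma>. A k \<sigma> \<in> sets M" and C: "\<And>k \<sigma>. compact (C k \<sigma>)"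
    and AC: "\<And>k \<sigma>. (\<Inter>n\<le>k. S \<sigma> n) = A k \<sigma> \<times> C k \<sigma>"
    using q by (simp_all only: A_def C_def)
  define H where "H k = (\<Union>\<tau>\<in>V k. \<Inter>n\<le>k. S \<tau> n)" for k
  have XH: "X k b \<subseteq> fst ` H k" for k unfolding H_def VS X_def Z_def by (intro image_mono UN_mono) auto
  have Hdec: "H (Suc k) \<subseteq> H k" for k
    unfolding H_def VS by (rule UN_mono) (auto simp: U_def)
  have fH: "fst ` H k \<in> sets M" for k
  proof -
    have "fst ` H k = (\<Union>\<tau>\<in>V k. if C k \<tau> = {} then {} else A k \<tau>)"
      unfolding H_def AC by (force split: if_splits)
    then show ?thesis using A finV by (auto intro!: sets.finite_UN)
  qed
  have Hsec: "compact {y. (t, y) \<in> H k}" for t k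
  proof -
    have "{y. (t, y) \<in> H k} = (\<Union>\<tau>\<in>V k. if t \<in> A k \<tau> then C k \<tau> else {})"
      unfolding H_def AC by (auto split: if_splits)
    then show ?thesis using C finV by (auto intro!: compact_UN)
  qed
  define B where "B = (\<Inter>k. fst ` H k)"
  have "B \<in> sets M" unfolding B_def using fH by auto
  moreover have "e \<le> emeasure M B"
  proof -
    have "emeasure M B = (INF k. emeasure M (fst ` H k))" unfolding B_def
      by (rule INF_emeasure_decseq[symmetric]) (use fH Hdec in \<open>auto intro!: decseq_SucI image_mono\<close>)
    moreover have "e \<le> emeasure M (fst ` H k)" for k
    proof -
      have "e < outer_measure_of M (X k b)"
        using f[of k] U_trunc by (simp add: X_def)
      also have "\<dots> \<le> outer_measure_of M (fst ` H k)" by (rule outer_measure_of_mono[OF XH])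
      also have "\<dots> = emeasure M (fst ` H k)" by (rule outer_measure_of_eq[OF fH])
      finally show ?thesis by simp
    qed
    ultimately show ?thesis by (simp add: le_INF_iff)
  qed
  moreover have "B \<subseteq> fst ` G"
  proof
    fix t assume t: "t \<in> B"
    \<comment> \<open>Membership of \<open>t\<close> in every projection gives a different point and
      a different branch at each level. Nested compact sections provide a common \<open>y\<close>,
      Koenig's lemma a common branch.\<close>
    have "(\<Inter>k. {y. (t, y) \<in> H k}) \<noteq> {}"
    proof (rule compact_nest)
      show "{y. (t, y) \<in> H n} \<noteq> {}" for n using t unfolding B_def by force
      show "{y. (t, y) \<in> H n} \<subseteq> {y. (t, y) \<in> H m}" if "m \<le> n" for m n
        using lift_Suc_antimono_le[of H m n] Hdec that by blast
    qed (rule Hsec)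
    then obtain y where "\<And>k. (t, y) \<in> H k" by blast
    then have "\<forall>k. \<exists>\<sigma>\<in>U k b. \<forall>n\<le>k. (t, y) \<in> S \<sigma> n" unfolding H_def VS by blast
    then obtain s where s: "\<And>k. s k \<in> U k b" "\<And>k n. n \<le> k \<Longrightarrow> (t, y) \<in> S (s k) n" by metis
    then have "\<And>k i. i \<le> k \<Longrightarrow> s k i \<le> b i" by (auto simp: U_def)
    from koenig_bounded[of s b, OF this] obtain \<sigma> where \<sigma>: "\<And>n. \<exists>k\<ge>n. \<forall>i\<le>n. s k i = \<sigma> i" by blast
    have "(t, y) \<in> S \<sigma> n" for n
      using \<sigma>[of n] s(2) S2 by metis
    then show "t \<in> fst ` G" unfolding S3 by force
  qed
  ultimately show ?thesis by blast
qed

text \<open>The projection lies between a measurable hull \<open>E\<close> of the same outer measure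
  and inner measurable sets of almost that measure; in a complete measure space such a set is
  measurable.\<close>

lemma sets_projection:
  fixes G :: "('t \<times> 'b::euclidean_space) set"
  assumes "finite_measure M" "complete_measure M" and G: "G \<in> sets (M \<Otimes>\<^sub>M borel)"
  shows "fst ` G \<in> sets M"
proof -
  interpret finite_measure M by fact
  interpret complete_measure M by fact
  have GM: "G \<subseteq> space M \<times> UNIV" using sets.sets_into_space[OF G] by (simp add: space_pair_measure)
  then have XM: "fst ` G \<subseteq> space M" by auto
  obtain E where E: "E \<in> sets M" "fst ` G \<subseteq> E" "outer_measure_of M (fst ` G) = emeasure M E"
    using outer_measure_of_attain[OF XM] by blast
  have "fst ` G \<in> fmeasurable M"
  proof (subst fmeasurable_inner_outer, intro allI impI)
    fix e :: real assume "e > 0"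
    have "\<exists>B\<in>sets M. B \<subseteq> fst ` G \<and> measure M E - e / 2 \<le> measure M B"
    proof (cases "measure M E - e / 2 < 0")
      case False
      then have "ennreal (measure M E - e / 2) < outer_measure_of M (fst ` G)"
        using \<open>e > 0\<close> E(3) by (simp add: emeasure_eq_measure ennreal_less_iff)
      from projection_inner_approx[OF suslin_sets_pair[OF G] GM this]
      show ?thesis using False by (auto simp: emeasure_eq_measure)
    qed (use measure_nonneg[of M "{}"] in auto)
    then obtain B where B: "B \<in> sets M" "B \<subseteq> fst ` G" "measure M E - e / 2 \<le> measure M B" by blast
    moreover have "measure M B \<le> measure M E"
      using B E by (intro finite_measure_mono) auto
    ultimately show "\<exists>T\<in>fmeasurable M. \<exists>U\<in>fmeasurable M. T \<subseteq> fst ` G \<and> fst ` G \<subseteq> U \<and> \<bar>measure M T - measure M U\<bar> < e"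
      using E \<open>e > 0\<close> by (intro bexI[of _ B] bexI[of _ E]) (auto simp: fmeasurable_eq_sets)
  qed
  then show ?thesis by (rule fmeasurableD)
qed

text \<open>A point of a section fails to be minimal exactly if some rational separates its cost
  from a smaller cost in the same section. The existence of the smaller cost is a projection, hence
  a measurable condition on \<open>t\<close>, and countably many rationals suffice.\<close>

lemma measurable_argmin_sections:
  fixes G :: "('t \<times> 'b::euclidean_space) set"
  assumes M: "finite_measure M" "complete_measure M" and G[measurable]: "G \<in> sets (M \<Otimes>\<^sub>M borel)"
    and cpt: "\<And>t. compact {y. (t, y) \<in> G}"
    and c[measurable]: "c \<in> borel_measurable (M \<Otimes>\<^sub>M borel)"
    and cont: "\<And>t. continuous_on {y. (t, y) \<in> G} (\<lambda>y. c (t, y) :: real)"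
  obtains H where "H \<in> sets (M \<Otimes>\<^sub>M borel)" "H \<subseteq> G" "fst ` H = fst ` G" "\<And>t. compact {y. (t, y) \<in> H}"
    "\<And>t y y'. (t, y) \<in> H \<Longrightarrow> (t, y') \<in> G \<Longrightarrow> c (t, y) \<le> c (t, y')"
proof -
  have Gsp: "G \<subseteq> space M \<times> UNIV" using sets.sets_into_space[OF G] by (simp add: space_pair_measure)
  define T where "T q = fst ` {p \<in> space (M \<Otimes>\<^sub>M borel). p \<in> G \<and> c p < q}" for q
  have T[measurable]: "T q \<in> sets M" for q unfolding T_def by (rule sets_projection[OF M]) measurable
  define H where "H = G - (\<Union>q\<in>\<rat>. {p \<in> space (M \<Otimes>\<^sub>M borel). q < c p \<and> fst p \<in> T q})"
  have HG: "(t, y) \<in> H \<longleftrightarrow> (t, y) \<in> G \<and> (\<forall>y'. (t, y') \<in> G \<longrightarrow> c (t, y) \<le> c (t, y'))" for t y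
  proof (cases "(t, y) \<in> G")
    case True
    have "t \<in> T q \<longleftrightarrow> (\<exists>y'. (t, y') \<in> G \<and> c (t, y') < q)" for q
      using Gsp unfolding T_def by (force simp: space_pair_measure)
    then have "(t, y) \<in> H \<longleftrightarrow> \<not> (\<exists>q\<in>\<rat>. q < c (t, y) \<and> (\<exists>y'. (t, y') \<in> G \<and> c (t, y') < q))"
      using True Gsp unfolding H_def by (auto simp: space_pair_measure)
    also have "\<dots> \<longleftrightarrow> \<not> (\<exists>y'. (t, y') \<in> G \<and> c (t, y') < c (t, y))"
      using Rats_dense_in_real by (meson order_less_trans)
    finally show ?thesis using True by (auto simp: not_less)
  qed (simp add: H_def)
  have min: "\<exists>y. (t, y) \<in> H" if "t \<in> fst ` G" for t
  proof -
    have ne: "{y. (t, y) \<in> G} \<noteq> {}" using that by force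
    show ?thesis unfolding HG using continuous_attains_inf[OF cpt ne cont] by blast
  qed
  show ?thesis
  proof
    show "H \<in> sets (M \<Otimes>\<^sub>M borel)"
      unfolding H_def by (intro sets.Diff G sets.countable_UN'' countable_rat) measurable
    show "H \<subseteq> G" by (auto simp: H_def)
    show "fst ` H = fst ` G"
    proof
      show "fst ` G \<subseteq> fst ` H" using min by force
    qed (use \<open>H \<subseteq> G\<close> in auto)
    show "compact {y. (t, y) \<in> H}" for t
    proof (cases "{y. (t, y) \<in> H} = {}")
      case False
      then obtain y where y: "(t, y) \<in> H" by blast
      have "closed ({z. (t, z) \<in> G} \<inter> (\<lambda>z. c (t, z)) -` {..c (t, y)})"
        by (rule continuous_closed_preimage[OF cont]) (auto simp: cpt compact_imp_closed)
      then have "compact ({z. (t, z) \<in> G} \<inter> ({z. (t, z) \<in> G} \<inter> (\<lambda>z. c (t, z)) -` {..c (t, y)}))"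
        by (rule compact_Int_closed[OF cpt])
      moreover have "{z. (t, z) \<in> G} \<inter> ({z. (t, z) \<in> G} \<inter> (\<lambda>z. c (t, z)) -` {..c (t, y)}) = {z. (t, z) \<in> H}"
        using y unfolding HG by (auto intro: order_trans)
      ultimately show ?thesis by simp
    qed simp
    show "c (t, y) \<le> c (t, y')" if "(t, y) \<in> H" "(t, y') \<in> G" for t y y'
      using that unfolding HG by blast
  qed
qed

text \<open>The selection is the lexicographic minimum of each section.\<close>

lemma measurable_selection_compact:
  fixes G :: "('t \<times> 'b::euclidean_space) set"
  assumes M: "finite_measure M" "complete_measure M" and G: "G \<in> sets (M \<Otimes>\<^sub>M borel)"
    and cpt: "\<And>t. compact {y. (t, y) \<in> G}"
  obtains f where "f \<in> borel_measurable M" "\<And>t. t \<in> fst ` G \<Longrightarrow> (t, f t) \<in> G"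
proof -
  define agree where "agree B H \<longleftrightarrow> (\<forall>t y y'. (t, y) \<in> H \<longrightarrow> (t, y') \<in> H \<longrightarrow> (\<forall>b\<in>B. y \<bullet> b = y' \<bullet> b))"
    for B and H :: "('t \<times> 'b) set"
  have agreeD: "y \<bullet> b = y' \<bullet> b" if "agree B H" "(t, y) \<in> H" "(t, y') \<in> H" "b \<in> B" for B H t y y' b
    using that unfolding agree_def by blast
  have "\<exists>H. H \<in> sets (M \<Otimes>\<^sub>M borel) \<and> H \<subseteq> G \<and> fst ` H = fst ` G \<and> (\<forall>t. compact {y. (t, y) \<in> H}) \<and> agree B H"
    if "finite B" for B
    using that
  proof induction
    case empty
    then show ?case using G cpt by (intro exI[of _ G]) (auto simp: agree_def)
  next
    case (insert b B)
    then obtain H where H: "H \<in> sets (M \<Otimes>\<^sub>M borel)" "H \<subseteq> G" "fst ` H = fst ` G" "\<And>t. compact {y. (t, y) \<in> H}"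
      "agree B H" by auto
    have 1: "(\<lambda>p. snd p \<bullet> b) \<in> borel_measurable (M \<Otimes>\<^sub>M borel)" by measurable
    have 2: "continuous_on {y. (t, y) \<in> H} (\<lambda>y. snd (t, y) \<bullet> b)" for t by (auto intro!: continuous_intros)
    obtain K where K: "K \<in> sets (M \<Otimes>\<^sub>M borel)" "K \<subseteq> H" "fst ` K = fst ` H" "\<And>t. compact {y. (t, y) \<in> K}"
      "\<And>t y y'. (t, y) \<in> K \<Longrightarrow> (t, y') \<in> H \<Longrightarrow> snd (t, y) \<bullet> b \<le> snd (t, y') \<bullet> b"
      using measurable_argmin_sections[OF M H(1,4) 1 2] by metis
    have "y \<bullet> b = y' \<bullet> b" if "(t, y) \<in> K" "(t, y') \<in> K" for t y y'
      using K(5)[of t y y'] K(5)[of t y' y] that subsetD[OF K(2)] by (auto intro: antisym)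
    then have "agree (insert b B) K"
      using agreeD[OF H(5)] K(2) unfolding agree_def by blast
    moreover have "K \<subseteq> G" "fst ` K = fst ` G" using K H by simp_all
    ultimately show ?case using K(1,4) by (intro exI[of _ K]) simp
  qed
  from this[OF finite_Basis] obtain H where H: "H \<in> sets (M \<Otimes>\<^sub>M borel)" "H \<subseteq> G" "fst ` H = fst ` G"
     and agr: "agree Basis H" by blast
  note uni = agreeD[OF agr]
  note [measurable] = H(1)
  have un: "y = y'" if "(t, y) \<in> H" "(t, y') \<in> H" for t y y'
    using uni[OF that] by (rule euclidean_eqI)
  have Hsp: "H \<subseteq> space M \<times> UNIV" using sets.sets_into_space[OF H(1)] by (simp add: space_pair_measure)
  define f where "f t = (if t \<in> fst ` H then THE y. (t, y) \<in> H else 0)" for t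
  have f: "f t = y" if "(t, y) \<in> H" for t y
  proof -
    have "t \<in> fst ` H" using that by force
    then show ?thesis unfolding f_def using that un by (auto intro!: the_equality)
  qed
  show ?thesis
  proof
    show "f \<in> borel_measurable M"
    proof (rule measurableI)
      fix A :: "'b set" assume [measurable]: "A \<in> sets borel"
      let ?A = "{p \<in> space (M \<Otimes>\<^sub>M borel). p \<in> H \<and> snd p \<in> A}"
      have "?A \<in> sets (M \<Otimes>\<^sub>M borel)" by measurable
      then have [measurable]: "fst ` ?A \<in> sets M" by (rule sets_projection[OF M])
      have [measurable]: "fst ` H \<in> sets M" by (rule sets_projection[OF M H(1)])
      have "f -` A \<inter> space M = fst ` ?A \<union> (if 0 \<in> A then space M - fst ` H else {})"
      proof (intro set_eqI)
        fix t
        show "t \<in> f -` A \<inter> space M \<longleftrightarrow> t \<in> fst ` ?A \<union> (if 0 \<in> A then space M - fst ` H else {})"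
        proof (cases "t \<in> fst ` H")
          case True
          then obtain y where y: "(t, y) \<in> H" by force
          then have "t \<in> space M" using Hsp by auto
          have "t \<in> fst ` ?A \<longleftrightarrow> y \<in> A"
          proof
            assume "t \<in> fst ` ?A"
            then obtain y' where "(t, y') \<in> H" "y' \<in> A" by auto
            then show "y \<in> A" using un[OF y] by blast
          next
            assume "y \<in> A"
            then have "(t, y) \<in> ?A" using y \<open>t \<in> space M\<close> by (auto simp: space_pair_measure)
            then show "t \<in> fst ` ?A" by (rule image_eqI[rotated]) simp
          qed
          then show ?thesis using f[OF y] True \<open>t \<in> space M\<close> by auto
        next
          case False
          moreover have "t \<notin> fst ` ?A" using False by force
          moreover have "f t = 0" using False by (simp add: f_def)
          ultimately show ?thesis by auto
        qed
      qed
      also have "\<dots> \<in> sets M" by auto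
      finally show "f -` A \<inter> space M \<in> sets M" .
    qed auto
    show "(t, f t) \<in> G" if "t \<in> fst ` G" for t
    proof -
      have "t \<in> fst ` H" using that H(3) by simp
      then obtain y where "(t, y) \<in> H" by force
      then show ?thesis using f H(2) by auto
    qed
  qed
qed

text \<open>Emptying the sections over one measurable null set makes compactness and continuity hold
  for every \<open>t\<close>, as the previous results demand.\<close>

lemma measurable_argmin_AE:
  fixes G :: "('t \<times> 'b::euclidean_space) set"
  assumes M: "finite_measure M" "complete_measure M" and G[measurable]: "G \<in> sets (M \<Otimes>\<^sub>M borel)"
    and cpt: "AE t in M. compact {y. (t, y) \<in> G} \<and> {y. (t, y) \<in> G} \<noteq> {}"
    and c: "c \<in> borel_measurable (M \<Otimes>\<^sub>M borel)"
    and cont: "AE t in M. continuous_on {y. (t, y) \<in> G} (\<lambda>y. c (t, y) :: real)"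
  obtains f where "f \<in> borel_measurable M"
    "AE t in M. (t, f t) \<in> G \<and> (\<forall>y. (t, y) \<in> G \<longrightarrow> c (t, f t) \<le> c (t, y))"
proof -
  have "AE t in M. compact {y. (t, y) \<in> G} \<and> {y. (t, y) \<in> G} \<noteq> {} \<and> continuous_on {y. (t, y) \<in> G} (\<lambda>y. c (t, y))"
    using cpt cont by eventually_elim auto
  then obtain N where N: "N \<in> null_sets M"
    "\<And>t. t \<in> space M \<Longrightarrow> t \<notin> N \<Longrightarrow> compact {y. (t, y) \<in> G} \<and> {y. (t, y) \<in> G} \<noteq> {} \<and> continuous_on {y. (t, y) \<in> G} (\<lambda>y. c (t, y))"
    unfolding eventually_ae_filter by blast
  have [measurable]: "N \<in> sets M" using N(1) by auto
  have Gsp: "G \<subseteq> space M \<times> UNIV" using sets.sets_into_space[OF G] by (simp add: space_pair_measure)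
  define G' where "G' = {p \<in> space (M \<Otimes>\<^sub>M borel). p \<in> G \<and> fst p \<notin> N}"
  have G'G: "{y. (t, y) \<in> G'} = (if t \<in> space M \<and> t \<notin> N then {y. (t, y) \<in> G} else {})" for t
    using Gsp by (auto simp: G'_def space_pair_measure)
  have "G' \<in> sets (M \<Otimes>\<^sub>M borel)" unfolding G'_def by measurable
  moreover have "compact {y. (t, y) \<in> G'}" for t unfolding G'G using N(2) by auto
  moreover have "continuous_on {y. (t, y) \<in> G'} (\<lambda>y. c (t, y))" for t unfolding G'G using N(2) by auto
  ultimately obtain H where H: "H \<in> sets (M \<Otimes>\<^sub>M borel)" "H \<subseteq> G'" "fst ` H = fst ` G'" "\<And>t. compact {y. (t, y) \<in> H}"
    "\<And>t y y'. (t, y) \<in> H \<Longrightarrow> (t, y') \<in> G' \<Longrightarrow> c (t, y) \<le> c (t, y')"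
    using measurable_argmin_sections[OF M _ _ c, of G'] by metis
  obtain f where f: "f \<in> borel_measurable M" "\<And>t. t \<in> fst ` H \<Longrightarrow> (t, f t) \<in> H"
    using measurable_selection_compact[OF M H(1,4)] by metis
  show ?thesis
  proof
    show "f \<in> borel_measurable M" by fact
    show "AE t in M. (t, f t) \<in> G \<and> (\<forall>y. (t, y) \<in> G \<longrightarrow> c (t, f t) \<le> c (t, y))"
    proof (rule AE_I'[OF N(1)], rule subsetI, rule ccontr)
      fix t assume t: "t \<in> {t \<in> space M. \<not> ((t, f t) \<in> G \<and> (\<forall>y. (t, y) \<in> G \<longrightarrow> c (t, f t) \<le> c (t, y)))}" and "t \<notin> N"
      then have eq: "{y. (t, y) \<in> G'} = {y. (t, y) \<in> G}" and ne: "{y. (t, y) \<in> G'} \<noteq> {}"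
        using N(2)[of t] unfolding G'G by auto
      then have "t \<in> fst ` H" unfolding H(3) by force
      then have "(t, f t) \<in> H" by (rule f)
      moreover have "(t, f t) \<in> G" using calculation H(2) eq by auto
      moreover have "c (t, f t) \<le> c (t, y)" if "(t, y) \<in> G" for y
        using H(5)[OF calculation(1)] that eq by auto
      ultimately show False using t by auto
    qed
  qed
qed

section \<open>Convexity of integrals over nonatomic measures\<close>

lemma set_integrable_of_integrable:
  fixes h :: "'a \<Rightarrow> 'b::{banach, second_countable_topology}"
  assumes "integrable M h" "B \<in> sets M"
  shows "set_integrable M B h"
  unfolding set_integrable_def using integrable_mult_indicator[OF assms(2,1)] .

lemma set_integral_Diff:
  fixes h :: "'a \<Rightarrow> 'b::{banach, second_countable_topology}"
  assumes "integrable M h" "A \<in> sets M" "B \<in> sets M" "B \<subseteq> A"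
  shows "(LINT x:A - B|M. h x) = (LINT x:A|M. h x) - (LINT x:B|M. h x)"
proof -
  have "(LINT x:(A - B) \<union> B|M. h x) = (LINT x:A - B|M. h x) + (LINT x:B|M. h x)"
    using assms by (intro set_integral_Un set_integrable_of_integrable) auto
  moreover have "(A - B) \<union> B = A" using assms(4) by auto
  ultimately show ?thesis by simp
qed

text \<open>A set that is not an atom splits into two pieces of positive measure, one of which has
  at most half the measure; iteration gives geometric decay.\<close>

lemma (in finite_measure) small_subset_nonatomic:
  assumes na: "nonatomic M" and A: "A \<in> sets M" "measure M A > 0" and "e > 0"
  shows "\<exists>B\<in>sets M. B \<subseteq> A \<and> 0 < measure M B \<and> measure M B < e"
proof -
  have half: "\<exists>B\<in>sets M. B \<subseteq> A \<and> 0 < measure M B \<and> measure M B \<le> measure M A / 2"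
    if A: "A \<in> sets M" "measure M A > 0" for A
  proof -
    have "\<not> is_atom M A" using na by (auto simp: nonatomic_def)
    moreover have "emeasure M A > 0" using A by (simp add: emeasure_eq_measure)
    ultimately obtain B where B: "B \<in> sets M" "B \<subseteq> A" "emeasure M B \<noteq> 0" "emeasure M (A - B) \<noteq> 0"
      using A unfolding is_atom_def by blast
    have pos: "measure M B > 0" "measure M (A - B) > 0"
      using B(3,4) measure_nonneg[of M B] measure_nonneg[of M "A - B"]
      by (auto simp: emeasure_eq_measure order_less_le)
    have "measure M (A - B) = measure M A - measure M B"
      using A B by (intro finite_measure_Diff)
    then have "measure M B \<le> measure M A / 2 \<or> measure M (A - B) \<le> measure M A / 2" by linarith
    then show ?thesis
    proof
      assume "measure M B \<le> measure M A / 2"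
      then show ?thesis using B pos by blast
    next
      assume "measure M (A - B) \<le> measure M A / 2"
      then show ?thesis using A B pos by (intro bexI[of _ "A - B"]) auto
    qed
  qed
  have "\<exists>B\<in>sets M. B \<subseteq> A \<and> 0 < measure M B \<and> measure M B \<le> measure M A / 2 ^ n" for n :: nat
  proof (induction n)
    case 0
    then show ?case using A by auto
  next
    case (Suc n)
    then obtain B where B: "B \<in> sets M" "B \<subseteq> A" "0 < measure M B" "measure M B \<le> measure M A / 2 ^ n" by blast
    from half[OF B(1,3)] obtain C where C: "C \<in> sets M" "C \<subseteq> B" "0 < measure M C" "measure M C \<le> measure M B / 2"
      by blast
    have "measure M C \<le> measure M A / 2 ^ n / 2"
      by (rule order_trans[OF C(4)], rule divide_right_mono[OF B(4)]) simp
    then have "measure M C \<le> measure M A / 2 ^ Suc n" by simp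
    then show ?case using B C by blast
  qed
  note * = this
  obtain n where "measure M A / e < 2 ^ n" using real_arch_pow[of 2 "measure M A / e"] by auto
  then have "measure M A / 2 ^ n < e" using \<open>e > 0\<close> by (simp add: field_simps)
  then show ?thesis using *[of n] by (meson order_le_less_trans)
qed

text \<open>Greedy exhaustion: each step adds a set whose measure is at least half the supremum of
  what still fits below \<open>c\<close>. The measures converge, so the increments tend to zero. If
  the limit stayed below \<open>c\<close>, a small subset of the remainder would fit at every step
  and bound the increments from below.\<close>

lemma (in finite_measure) nonatomic_half_measure:
  assumes na: "nonatomic M" and A: "A \<in> sets M"
  shows "\<exists>B\<in>sets M. B \<subseteq> A \<and> measure M B = measure M A / 2"
proof -
  define c where "c = measure M A / 2"
  have c0: "c \<ge> 0" by (simp add: c_def)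
  let ?P = "\<lambda>C. C \<in> sets M \<and> C \<subseteq> A \<and> measure M C \<le> c"
  let ?Q = "\<lambda>C C'. C \<subseteq> C' \<and> (\<forall>B\<in>sets M. B \<subseteq> A - C \<longrightarrow> measure M B \<le> c - measure M C \<longrightarrow>
       measure M B \<le> 2 * (measure M C' - measure M C))"
  have "\<exists>f. \<forall>n::nat. ?P (f n) \<and> ?Q (f n) (f (Suc n))"
  proof (rule dependent_nat_choice)
    show "\<exists>C. ?P C" using c0 by (intro exI[of _ "{}"]) auto
  next
    fix C and n :: nat assume C: "?P C"
    define X where "X = {measure M B |B. B \<in> sets M \<and> B \<subseteq> A - C \<and> measure M B \<le> c - measure M C}"
    have X0: "0 \<in> X" using C unfolding X_def by (intro CollectI exI[of _ "{}"]) auto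
    have bdd: "bdd_above X" unfolding X_def by (rule bdd_aboveI[of _ "c - measure M C"]) auto
    have "\<exists>x\<in>X. Sup X / 2 \<le> x"
    proof (cases "Sup X > 0")
      case True
      then have "Sup X / 2 < Sup X" by simp
      then obtain x where "x \<in> X" "Sup X / 2 < x" using less_cSup_iff[of X "Sup X / 2"] X0 bdd by auto
      then show ?thesis by (auto intro: less_imp_le)
    qed (use X0 in \<open>auto intro!: bexI[of _ 0]\<close>)
    then obtain x where x: "x \<in> X" "Sup X / 2 \<le> x" by blast
    obtain B where B: "B \<in> sets M" "B \<subseteq> A - C" "measure M B \<le> c - measure M C" and Bx: "x = measure M B"
      using x(1) unfolding X_def by blast
    note B = B x(2)[unfolded Bx]
    have CB: "measure M (C \<union> B) = measure M C + measure M B"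
      using B C by (intro finite_measure_Union) auto
    have "measure M D \<le> 2 * (measure M (C \<union> B) - measure M C)"
      if D: "D \<in> sets M" "D \<subseteq> A - C" "measure M D \<le> c - measure M C" for D
    proof -
      have "measure M D \<le> Sup X" using D bdd by (intro cSup_upper) (auto simp: X_def)
      then show ?thesis using B(4) CB by simp
    qed
    then show "\<exists>C'. ?P C' \<and> ?Q C C'" using B C CB by (intro exI[of _ "C \<union> B"]) auto
  qed
  then obtain f where f0: "\<forall>n. ?P (f n) \<and> ?Q (f n) (f (Suc n))" by (rule exE)
  note f = conjunct1[OF spec[OF f0]] conjunct2[OF spec[OF f0]]
  have inc: "incseq f" by (rule incseq_SucI) (rule conjunct1[OF f(2)])
  define C where "C = (\<Union>n. f n)"
  have C: "C \<in> sets M" "C \<subseteq> A" using f(1) by (auto simp: C_def)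
  have lim: "(\<lambda>n. measure M (f n)) \<longlonglongrightarrow> measure M C" unfolding C_def
    using f(1) by (intro finite_Lim_measure_incseq inc) auto
  have le: "measure M C \<le> c" using f(1) by (intro LIMSEQ_le_const2[OF lim]) auto
  have "measure M C = c"
  proof (rule ccontr)
    assume "measure M C \<noteq> c"
    then have lt: "measure M C < c" using le by simp
    then have "measure M A > c" using measure_nonneg[of M C] unfolding c_def by linarith
    moreover have "measure M (A - C) = measure M A - measure M C"
      using A C by (intro finite_measure_Diff)
    ultimately have pos: "measure M (A - C) > 0" using lt by simp
    obtain B where B: "B \<in> sets M" "B \<subseteq> A - C" "0 < measure M B" "measure M B < c - measure M C"
      using small_subset_nonatomic[OF na _ pos, of "c - measure M C"] A C lt by auto
    have "measure M B \<le> 2 * (measure M (f (Suc n)) - measure M (f n))" for n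
    proof -
      have "measure M (f n) \<le> measure M C" using C by (intro finite_measure_mono) (auto simp: C_def)
      then have "measure M B \<le> c - measure M (f n)" using B(4) by simp
      moreover have "B \<subseteq> A - f n" using B(2) by (auto simp: C_def)
      ultimately show ?thesis using conjunct2[OF f(2)[of n]] B(1) by blast
    qed
    moreover have "(\<lambda>n. 2 * (measure M (f (Suc n)) - measure M (f n))) \<longlonglongrightarrow> 2 * (measure M C - measure M C)"
      by (intro tendsto_intros lim LIMSEQ_Suc[OF lim])
    ultimately have "measure M B \<le> 2 * (measure M C - measure M C)"
      by (intro LIMSEQ_le_const) auto
    then show False using B(3) by simp
  qed
  then show ?thesis using C unfolding c_def by blast
qed

text \<open>Halving is demanded inside every measurable \<open>A\<close>, so that it can be repeated
  on the gaps of a dyadic subdivision.\<close>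

definition halvable :: "'t measure \<Rightarrow> ('t \<Rightarrow> real) set \<Rightarrow> bool" where
  "halvable M H \<longleftrightarrow> (\<forall>A\<in>sets M. \<exists>B\<in>sets M. B \<subseteq> A \<and>
     (\<forall>h\<in>H. (LINT x:B|M. h x) = (LINT x:A|M. h x) / 2))"

text \<open>\<open>dyadic_chain hf A n j\<close> is the set with parameter \<open>j / 2 ^ n\<close>.
  An even index repeats a set of the previous level, an odd one adds half of the gap between its two
  neighbours there.\<close>

primrec dyadic_chain :: "('t set \<Rightarrow> 't set) \<Rightarrow> 't set \<Rightarrow> nat \<Rightarrow> nat \<Rightarrow> 't set" where
  "dyadic_chain hf A 0 j = (if j = 0 then {} else A)"
| "dyadic_chain hf A (Suc n) j =
     (if even j then dyadic_chain hf A n (j div 2)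
      else dyadic_chain hf A n (j div 2) \<union>
        hf (dyadic_chain hf A n (Suc (j div 2)) - dyadic_chain hf A n (j div 2)))"

definition integral_chain :: "'t measure \<Rightarrow> ('t \<Rightarrow> real) set \<Rightarrow> 't set \<Rightarrow> (real \<Rightarrow> 't set) \<Rightarrow> bool" where
  "integral_chain M H A S \<longleftrightarrow> (\<forall>l. S l \<in> sets M) \<and> (\<forall>l. S l \<subseteq> A) \<and> (\<forall>l m. l \<le> m \<longrightarrow> S l \<subseteq> S m) \<and>
     (\<forall>l h. 0 \<le> l \<longrightarrow> l \<le> 1 \<longrightarrow> h \<in> H \<longrightarrow> (LINT x:S l|M. h x) = l * (LINT x:A|M. h x))"

lemma integral_chainD:
  assumes "integral_chain M H A S"
  shows "S l \<in> sets M" "S l \<subseteq> A" "l \<le> m \<Longrightarrow> S l \<subseteq> S m"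
    "0 \<le> l \<Longrightarrow> l \<le> 1 \<Longrightarrow> h \<in> H \<Longrightarrow> (LINT x:S l|M. h x) = l * (LINT x:A|M. h x)"
  using assms unfolding integral_chain_def by blast+

lemma halvable_chain:
  assumes H: "halvable M H" and int: "\<And>h. h \<in> H \<Longrightarrow> integrable M h" and A: "A \<in> sets M"
  shows "\<exists>S. integral_chain M H A S"
proof -
  obtain hf where hf: "\<And>B. B \<in> sets M \<Longrightarrow> hf B \<in> sets M" "\<And>B. B \<in> sets M \<Longrightarrow> hf B \<subseteq> B"
     "\<And>B h. B \<in> sets M \<Longrightarrow> h \<in> H \<Longrightarrow> (LINT x:hf B|M. h x) = (LINT x:B|M. h x) / 2"
    using H unfolding halvable_def by metis
  define D where "D = dyadic_chain hf A"
  have D0: "D 0 j = (if j = 0 then {} else A)" for j by (simp add: D_def)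
  have Deven: "D (Suc n) (2 * j) = D n j" for n j by (simp add: D_def)
  have Dodd: "D (Suc n) (Suc (2 * j)) = D n j \<union> hf (D n (Suc j) - D n j)" for n j by (simp add: D_def)
  have ind: "(\<forall>j. D n j \<in> sets M \<and> D n j \<subseteq> A \<and> D n j \<subseteq> D n (Suc j)) \<and>
     (\<forall>j\<le>2 ^ n. \<forall>h\<in>H. (LINT x:D n j|M. h x) = real j / 2 ^ n * (LINT x:A|M. h x))" for n
  proof (induction n)
    case 0
    have "(LINT x:D 0 j|M. h x) = real j / 2 ^ 0 * (LINT x:A|M. h x)" if "j \<le> 2 ^ 0" for j h
      using that by (cases "j = 0") (auto simp: D0 set_lebesgue_integral_def le_Suc_eq)
    then show ?case using A by (auto simp: D0)
  next
    case (Suc n)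
    have IH: "D n j \<in> sets M" "D n j \<subseteq> A" "D n j \<subseteq> D n (Suc j)" for j using Suc.IH by auto
    have IH2: "(LINT x:D n j|M. h x) = real j / 2 ^ n * (LINT x:A|M. h x)" if "j \<le> 2 ^ n" "h \<in> H" for j h
      using Suc.IH that by blast
    have hD: "hf (D n (Suc j) - D n j) \<in> sets M" "hf (D n (Suc j) - D n j) \<subseteq> D n (Suc j) - D n j" for j
      using hf(1,2) IH(1) by auto
    have "D (Suc n) j \<in> sets M \<and> D (Suc n) j \<subseteq> A \<and> D (Suc n) j \<subseteq> D (Suc n) (Suc j)" for j
    proof (cases "even j")
      case True
      then obtain k where "j = 2 * k" by blast
      then show ?thesis using IH by (auto simp: Deven Dodd)
    next
      case False
      then obtain k where k: "j = Suc (2 * k)" using False by (auto elim!: oddE)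
      then have "Suc j = 2 * Suc k" by simp
      then have "D (Suc n) (Suc j) = D n (Suc k)" by (simp only: Deven)
      then show ?thesis using IH[of k] IH[of "Suc k"] hD[of k] unfolding k Dodd by (auto simp: Dodd)
    qed
    moreover have "(LINT x:D (Suc n) j|M. h x) = real j / 2 ^ Suc n * (LINT x:A|M. h x)"
      if j: "j \<le> 2 ^ Suc n" and h: "h \<in> H" for j h
    proof (cases "even j")
      case True
      then obtain k where "j = 2 * k" by blast
      then show ?thesis using IH2[of k h] j h by (simp add: Deven)
    next
      case False
      then obtain k where k: "j = Suc (2 * k)" using False by (auto elim!: oddE)
      have k2: "Suc k \<le> 2 ^ n" using j k by simp
      have "(LINT x:D (Suc n) j|M. h x) = (LINT x:D n k|M. h x) + (LINT x:hf (D n (Suc k) - D n k)|M. h x)"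
        unfolding k Dodd using hD[of k] IH int[OF h]
        by (intro set_integral_Un set_integrable_of_integrable) auto
      also have "(LINT x:hf (D n (Suc k) - D n k)|M. h x) = ((LINT x:D n (Suc k)|M. h x) - (LINT x:D n k|M. h x)) / 2"
        using IH h int[OF h] by (subst hf(3)) (auto simp: set_integral_Diff)
      finally show ?thesis using IH2[of k h] IH2[of "Suc k" h] k2 h k by (simp add: field_simps)
    qed
    ultimately show ?case by blast
  qed
  then have Ds: "D n j \<in> sets M" "D n j \<subseteq> A" "D n j \<subseteq> D n (Suc j)" for n j by auto
  have Dint: "(LINT x:D n j|M. h x) = real j / 2 ^ n * (LINT x:A|M. h x)" if "j \<le> 2 ^ n" "h \<in> H" for n j h
    using ind that by blast
  have Dmono: "D n i \<subseteq> D n j" if "i \<le> j" for n i j using that Ds(3) by (rule lift_Suc_mono_le[rotated])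
  \<comment> \<open>Rounding down makes the dyadic approximations increase with \<open>n\<close>, so
    integrals over them converge to the integral over their union.\<close>
  define S where "S l = (\<Union>n. D n (nat \<lfloor>2 ^ n * l\<rfloor>))" for l :: real
  have inc: "incseq (\<lambda>n. D n (nat \<lfloor>2 ^ n * l\<rfloor>))" for l :: real
  proof (rule incseq_SucI)
    fix n
    have "2 * nat \<lfloor>2 ^ n * l\<rfloor> \<le> nat \<lfloor>2 ^ Suc n * l\<rfloor>"
    proof (cases "0 \<le> 2 ^ n * l")
      case True
      have "2 * \<lfloor>2 ^ n * l\<rfloor> \<le> \<lfloor>2 * (2 ^ n * l)\<rfloor>" by linarith
      then show ?thesis using True by (simp add: mult.assoc nat_le_eq_zle[symmetric] nat_mult_distrib)
    next
      case False
      then have "\<lfloor>2 ^ n * l\<rfloor> \<le> 0" by linarith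
      then show ?thesis by simp
    qed
    then show "D n (nat \<lfloor>2 ^ n * l\<rfloor>) \<subseteq> D (Suc n) (nat \<lfloor>2 ^ Suc n * l\<rfloor>)"
      using Dmono[of "2 * nat \<lfloor>2 ^ n * l\<rfloor>" _ "Suc n"] by (simp only: Deven)
  qed
  have "integral_chain M H A S"
    unfolding integral_chain_def
  proof (intro conjI allI impI)
    show "S l \<in> sets M" for l using Ds by (auto simp: S_def)
    show "S l \<subseteq> A" for l unfolding S_def using Ds(2) by (intro UN_least)
    show "S l \<subseteq> S m" if "l \<le> m" for l m
      unfolding S_def using that by (intro UN_mono Dmono nat_mono floor_mono mult_left_mono) auto
    fix l :: real and h assume l: "0 \<le> l" "l \<le> 1" and h: "h \<in> H"
    have 1: "(\<lambda>n. LINT x:D n (nat \<lfloor>2 ^ n * l\<rfloor>)|M. h x) \<longlonglongrightarrow> (LINT x:S l|M. h x)"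
      unfolding S_def using Ds h by (intro set_integral_cont_up inc set_integrable_of_integrable int) auto
    have 2: "(LINT x:D n (nat \<lfloor>2 ^ n * l\<rfloor>)|M. h x) = real (nat \<lfloor>2 ^ n * l\<rfloor>) / 2 ^ n * (LINT x:A|M. h x)" for n
    proof (rule Dint[OF _ h])
      have "2 ^ n * l \<le> 2 ^ n * 1" using l by (intro mult_left_mono) auto
      from floor_mono[OF this] have "\<lfloor>2 ^ n * l\<rfloor> \<le> 2 ^ n" by simp
      then show "nat \<lfloor>2 ^ n * l\<rfloor> \<le> 2 ^ n" by (simp add: nat_le_iff)
    qed
    have "(\<lambda>n. real (nat \<lfloor>2 ^ n * l\<rfloor>) / 2 ^ n) \<longlonglongrightarrow> l"
    proof (rule tendsto_sandwich)
      show "\<forall>\<^sub>F n in sequentially. l - (1/2) ^ n \<le> real (nat \<lfloor>2 ^ n * l\<rfloor>) / 2 ^ n"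
      proof (rule always_eventually, rule allI)
        fix n :: nat
        have "2 ^ n * l - 1 \<le> real (nat \<lfloor>2 ^ n * l\<rfloor>)" using l by linarith
        then have "(2 ^ n * l - 1) / 2 ^ n \<le> real (nat \<lfloor>2 ^ n * l\<rfloor>) / 2 ^ n" by (intro divide_right_mono) auto
        then show "l - (1/2) ^ n \<le> real (nat \<lfloor>2 ^ n * l\<rfloor>) / 2 ^ n"
          by (simp add: diff_divide_distrib power_one_over)
      qed
      show "\<forall>\<^sub>F n in sequentially. real (nat \<lfloor>2 ^ n * l\<rfloor>) / 2 ^ n \<le> l"
      proof (rule always_eventually, rule allI)
        fix n :: nat
        have "0 \<le> 2 ^ n * l" using l by simp
        then have "real (nat \<lfloor>2 ^ n * l\<rfloor>) \<le> 2 ^ n * l" by linarith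
        then show "real (nat \<lfloor>2 ^ n * l\<rfloor>) / 2 ^ n \<le> l" by (simp add: field_simps)
      qed
      have "(\<lambda>n. l - (1/2) ^ n) \<longlonglongrightarrow> l - 0" by (intro tendsto_intros LIMSEQ_power_zero) auto
      then show "(\<lambda>n. l - (1/2) ^ n) \<longlonglongrightarrow> l" by simp
    qed auto
    then have "(\<lambda>n. LINT x:D n (nat \<lfloor>2 ^ n * l\<rfloor>)|M. h x) \<longlonglongrightarrow> l * (LINT x:A|M. h x)"
      unfolding 2 by (intro tendsto_intros)
    with 1 show "(LINT x:S l|M. h x) = l * (LINT x:A|M. h x)" by (rule LIMSEQ_unique)
  qed
  then show ?thesis by blast
qed

lemma (in finite_measure) integral_absolutely_continuous:
  fixes h :: "'a \<Rightarrow> real"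
  assumes h: "integrable M h" and e: "e > 0"
  shows "\<exists>d>0. \<forall>D\<in>sets M. measure M D < d \<longrightarrow> \<bar>LINT x:D|M. h x\<bar> < e"
proof -
  note [measurable] = borel_measurable_integrable[OF h]
  have "(\<lambda>n. \<integral>x. \<bar>h x\<bar> * indicator {x. \<bar>h x\<bar> > real n} x \<partial>M) \<longlonglongrightarrow> (LINT x|M. 0)"
  proof (rule integral_dominated_convergence)
    show "AE x in M. (\<lambda>n. \<bar>h x\<bar> * indicator {x. \<bar>h x\<bar> > real n} x) \<longlonglongrightarrow> 0"
    proof (rule AE_I2)
      fix x
      obtain N where "\<bar>h x\<bar> < real N" using reals_Archimedean2 by blast
      then have "\<forall>n\<ge>N. \<bar>h x\<bar> * indicator {x. \<bar>h x\<bar> > real n} x = 0" by (auto simp: indicator_def)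
      then show "(\<lambda>n. \<bar>h x\<bar> * indicator {x. \<bar>h x\<bar> > real n} x) \<longlonglongrightarrow> 0"
        by (intro tendsto_eventually) (auto simp: eventually_sequentially)
    qed
    show "AE x in M. norm (\<bar>h x\<bar> * indicator {x. \<bar>h x\<bar> > real n} x) \<le> \<bar>h x\<bar>" for n
      by (auto simp: indicator_def)
  qed (use h in auto)
  then have "(\<lambda>n. \<integral>x. \<bar>h x\<bar> * indicator {x. \<bar>h x\<bar> > real n} x \<partial>M) \<longlonglongrightarrow> 0" by simp
  from order_tendstoD(2)[OF this, of "e / 2"] e
  obtain n where n: "(LINT x|M. \<bar>h x\<bar> * indicator {x. \<bar>h x\<bar> > real n} x) < e / 2"
    by (auto simp: eventually_sequentially)
  have int1: "integrable M (\<lambda>x. \<bar>h x\<bar> * indicator {x. \<bar>h x\<bar> > real n} x)"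
    by (rule Bochner_Integration.integrable_bound[OF integrable_abs[OF h]]) (auto simp: indicator_def)
  have "\<bar>LINT x:D|M. h x\<bar> < e" if D: "D \<in> sets M" "measure M D < e / (2 * (real n + 1))" for D
  proof -
    note [measurable] = D(1)
    have intD: "integrable M (indicator D :: 'a \<Rightarrow> real)"
      using D by (intro integrable_real_indicator) (auto simp: emeasure_eq_measure)
    have "\<bar>LINT x:D|M. h x\<bar> \<le> (LINT x|M. \<bar>indicator D x * h x\<bar>)"
      unfolding set_lebesgue_integral_def real_scaleR_def by (rule integral_abs_bound)
    also have "\<dots> \<le> (LINT x|M. \<bar>h x\<bar> * indicator {x. \<bar>h x\<bar> > real n} x + real n * indicator D x)"
    proof (rule integral_mono)
      show "integrable M (\<lambda>x. \<bar>indicator D x * h x\<bar>)"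
        using integrable_mult_indicator[OF D(1) h] by (intro integrable_abs) simp
      show "integrable M (\<lambda>x. \<bar>h x\<bar> * indicator {x. \<bar>h x\<bar> > real n} x + real n * indicator D x)"
        by (intro Bochner_Integration.integrable_add int1 integrable_mult_right intD)
    qed (auto simp: indicator_def)
    also have "\<dots> = (LINT x|M. \<bar>h x\<bar> * indicator {x. \<bar>h x\<bar> > real n} x) + (LINT x|M. real n * indicator D x)"
      by (rule Bochner_Integration.integral_add) (use int1 intD in auto)
    also have "(LINT x|M. real n * indicator D x) = real n * measure M D" using D by simp
    also have "real n * measure M D \<le> (real n + 1) * measure M D" by (intro mult_right_mono) auto
    also have "(real n + 1) * measure M D \<le> e / 2" using D(2) by (simp add: field_simps)
    finally show ?thesis using n by simp
  qed
  then show ?thesis using e by (intro exI[of _ "e / (2 * (real n + 1))"]) auto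
qed

lemma (in finite_measure) set_integral_one: "B \<in> sets M \<Longrightarrow> (LINT x:B|M. (1::real)) = measure M B"
  by (simp add: set_lebesgue_integral_def)

text \<open>If \<open>B\<close> halves the integrals of \<open>H\<close>, then so does \<open>(B - S l) \<union> S' l\<close> for chains \<open>S\<close> in \<open>B\<close> and
  \<open>S'\<close> in its complement; it interpolates between \<open>B\<close> and the complement, so the intermediate value
  theorem provides a parameter \<open>l\<close> for which the additional integral is halved too.\<close>

lemma (in finite_measure) halvable_insert:
  assumes H: "halvable M H" and int: "\<And>h. h \<in> H \<Longrightarrow> integrable M h" and one: "(\<lambda>_. 1) \<in> H"
    and h: "integrable M h"
  shows "halvable M (insert h H)"
  unfolding halvable_def
proof
  fix A assume A: "A \<in> sets M"
  from H A have "\<exists>B\<in>sets M. B \<subseteq> A \<and> (\<forall>g\<in>H. (LINT x:B|M. g x) = (LINT x:A|M. g x) / 2)"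
    unfolding halvable_def by (rule bspec)
  then obtain B where B0: "B \<in> sets M" "B \<subseteq> A \<and> (\<forall>g\<in>H. (LINT x:B|M. g x) = (LINT x:A|M. g x) / 2)"
    by (rule bexE)
  note B = B0(1) conjunct1[OF B0(2)] bspec[OF conjunct2[OF B0(2)]]
  have AB: "(LINT x:A - B|M. g x) = (LINT x:A|M. g x) - (LINT x:B|M. g x)" if "integrable M g" for g :: "'a \<Rightarrow> real"
    by (rule set_integral_Diff[OF that A B(1,2)])
  have AB': "A - B \<in> sets M" using A B by auto
  \<comment> \<open>Since the constant function belongs to \<open>H\<close>, the measure of
    \<open>S l\<close> is proportional to \<open>l\<close>. Absolute continuity of the integral then
    gives continuity in \<open>l\<close> for the new function \<open>h\<close>, about whose values
    on the chain nothing else is known.\<close>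
  have cont: "continuous_on {0..1} (\<lambda>l. LINT x:S l|M. h x)" and S0: "(LINT x:S 0|M. h x) = 0"
     and S1: "(LINT x:S 1|M. h x) = (LINT x:C|M. h x)"
    if C: "C \<in> sets M" and ch: "integral_chain M H C S" for C S
  proof -
    note S = integral_chainD[OF ch]
    have meas: "measure M (S l) = l * measure M C" if "0 \<le> l" "l \<le> 1" for l
      using S(4)[OF that one] C S(1) by (simp add: set_integral_one)
    have null: "(LINT x:D|M. h x) = 0" if "D \<in> sets M" "measure M D = 0" for D
    proof -
      have "AE x in M. x \<notin> D" using that by (intro AE_not_in) (auto simp: emeasure_eq_measure null_sets_def)
      then have "AE x in M. indicator D x *\<^sub>R h x = 0" by eventually_elim auto
      then show ?thesis unfolding set_lebesgue_integral_def
        using integral_cong_AE[of "\<lambda>x. indicator D x *\<^sub>R h x" M "\<lambda>_. 0"] h that by simp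
    qed
    show "(LINT x:S 0|M. h x) = 0" using S(1) meas[of 0] by (intro null) auto
    have "measure M (C - S 1) = 0"
      using finite_measure_Diff[OF C S(1,2)] meas[of 1] by simp
    then have "(LINT x:C - S 1|M. h x) = 0" using C S(1) by (intro null) auto
    then show "(LINT x:S 1|M. h x) = (LINT x:C|M. h x)"
      using set_integral_Diff[OF h C S(1,2)] by simp
    show "continuous_on {0..1} (\<lambda>l. LINT x:S l|M. h x)"
      unfolding continuous_on_iff
    proof (intro ballI allI impI)
      fix l e :: real assume l: "l \<in> {0..1}" and e: "0 < e"
      obtain d where d: "d > 0" "\<And>D. D \<in> sets M \<Longrightarrow> measure M D < d \<Longrightarrow> \<bar>LINT x:D|M. h x\<bar> < e"
        using integral_absolutely_continuous[OF h e] by blast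
      have *: "\<bar>(LINT x:S m|M. h x) - (LINT x:S k|M. h x)\<bar> < e"
        if "k \<le> m" "k \<in> {0..1}" "m \<in> {0..1}" "m - k < d / (measure M C + 1)" for k m
      proof -
        have D: "S m - S k \<in> sets M" using S(1) by auto
        have "measure M (S m - S k) = (m - k) * measure M C"
          using finite_measure_Diff[OF S(1,1) S(3)[OF that(1)]] that meas by (simp add: algebra_simps)
        also have "\<dots> \<le> (m - k) * (measure M C + 1)" using that(1) by (intro mult_left_mono) auto
        also have "\<dots> < d" using that(4) measure_nonneg[of M C] by (subst (asm) pos_less_divide_eq) linarith+
        finally have "\<bar>LINT x:S m - S k|M. h x\<bar> < e" by (rule d(2)[OF D])
        then show ?thesis using set_integral_Diff[OF h S(1,1) S(3)[OF that(1)]] by simp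
      qed
      show "\<exists>d>0. \<forall>l'\<in>{0..1}. dist l' l < d \<longrightarrow> dist (LINT x:S l'|M. h x) (LINT x:S l|M. h x) < e"
      proof (intro exI conjI ballI impI)
        show "d / (measure M C + 1) > 0" using d(1) measure_nonneg[of M C]
          by (intro divide_pos_pos) linarith+
        fix l' assume l': "l' \<in> {0..1}" "dist l' l < d / (measure M C + 1)"
        show "dist (LINT x:S l'|M. h x) (LINT x:S l|M. h x) < e"
          using *[of l l'] *[of l' l] l l' by (cases "l \<le> l'") (auto simp: dist_real_def)
      qed
    qed
  qed
  obtain S where chS: "integral_chain M H B S" using halvable_chain[OF H int B(1)] by blast
  obtain S' where chS': "integral_chain M H (A - B) S'" using halvable_chain[OF H int AB'] by blast
  note S = integral_chainD[OF chS] and S' = integral_chainD[OF chS']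
  define R where "R l = (B - S l) \<union> S' l" for l
  have R: "R l \<in> sets M" "R l \<subseteq> A" for l
    using S(1) S'(1) S'(2)[of l] B(1,2) unfolding R_def by auto
  have Rint: "(LINT x:R l|M. g x) = (LINT x:B|M. g x) - (LINT x:S l|M. g x) + (LINT x:S' l|M. g x)"
    if "integrable M g" for g :: "'a \<Rightarrow> real" and l
  proof -
    have "(LINT x:R l|M. g x) = (LINT x:B - S l|M. g x) + (LINT x:S' l|M. g x)"
      unfolding R_def using S(1) S'(1) S'(2)[of l] B(1) that
      by (intro set_integral_Un set_integrable_of_integrable) auto
    then show ?thesis using set_integral_Diff[OF that B(1) S(1,2)] by simp
  qed
  let ?f = "\<lambda>l. LINT x:R l|M. h x"
  have cf: "continuous_on {0..1} ?f"
    unfolding Rint[OF h]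
    by (rule continuous_on_add[OF continuous_on_diff[OF continuous_on_const cont[OF B(1) chS]] cont[OF AB' chS']])
  have f0: "?f 0 = (LINT x:B|M. h x)" unfolding Rint[OF h] using S0[OF B(1) chS] S0[OF AB' chS'] by simp
  have f1: "?f 1 = (LINT x:A|M. h x) - (LINT x:B|M. h x)"
    unfolding Rint[OF h] using S1[OF B(1) chS] S1[OF AB' chS'] AB[OF h] by simp
  have "\<exists>l\<ge>0. l \<le> 1 \<and> ?f l = (LINT x:A|M. h x) / 2"
  proof (cases "?f 0 \<le> (LINT x:A|M. h x) / 2")
    case True
    then show ?thesis using f0 f1 by (intro IVT' cf) auto
  next
    case False
    then show ?thesis using f0 f1 by (intro IVT2' cf) auto
  qed
  then obtain l where l: "0 \<le> l" "l \<le> 1" "?f l = (LINT x:A|M. h x) / 2" by blast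
  have "(LINT x:R l|M. g x) = (LINT x:A|M. g x) / 2" if "g \<in> H" for g
    unfolding Rint[OF int[OF that]]
    using S(4)[OF l(1,2) that] S'(4)[OF l(1,2) that] B(3)[OF that] AB[OF int[OF that]] by (simp add: algebra_simps)
  then show "\<exists>B\<in>sets M. B \<subseteq> A \<and> (\<forall>g\<in>insert h H. (LINT x:B|M. g x) = (LINT x:A|M. g x) / 2)"
    using R l by (intro bexI[of _ "R l"]) auto
qed

text \<open>Halvability starts from the measure itself, where it expresses nonatomicity, and
  survives the addition of one coordinate of \<open>h\<close> at a time. A chain in the whole space
  then realises every fraction \<open>l\<close> of all coordinates at once.\<close>

theorem (in finite_measure) lyapunov_convexity:
  fixes h :: "'a \<Rightarrow> 'b::euclidean_space"
  assumes na: "nonatomic M" and h: "integrable M h" and l: "0 \<le> l" "l \<le> 1"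
  shows "\<exists>S\<in>sets M. (LINT x:S|M. h x) = l *\<^sub>R (LINT x|M. h x)"
proof -
  have "halvable M (insert (\<lambda>_. 1) ((\<lambda>b x. h x \<bullet> b) ` B))" if "finite B" for B
    using that
  proof induction
    case empty
    show ?case unfolding halvable_def
      using nonatomic_half_measure[OF na] by (fastforce simp: set_integral_one)
  next
    case (insert b B)
    then have "halvable M (insert (\<lambda>x. h x \<bullet> b) (insert (\<lambda>_. 1) ((\<lambda>b x. h x \<bullet> b) ` B)))"
      using h by - (rule halvable_insert[where H = "insert (\<lambda>_. 1) ((\<lambda>b x. h x \<bullet> b) ` B)"], auto)
    then show ?case by (simp add: insert_commute)
  qed
  from this[OF finite_Basis] have hv: "halvable M (insert (\<lambda>_. 1) ((\<lambda>b x. h x \<bullet> b) ` Basis))" .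
  have "\<And>g. g \<in> insert (\<lambda>_. 1) ((\<lambda>b x. h x \<bullet> b) ` Basis) \<Longrightarrow> integrable M g" using h by auto
  from halvable_chain[OF hv this sets.top] obtain S
    where S0: "integral_chain M (insert (\<lambda>_. 1) ((\<lambda>b x. h x \<bullet> b) ` Basis)) (space M) S" by blast
  note S = integral_chainD(1,4)[OF S0]
  have "(LINT x:S l|M. h x) = l *\<^sub>R (LINT x|M. h x)"
  proof (rule euclidean_eqI)
    fix b :: 'b assume b: "b \<in> Basis"
    have "integrable M (\<lambda>x. indicator (S l) x *\<^sub>R h x)" by (rule integrable_mult_indicator[OF S(1) h])
    then have "(LINT x:S l|M. h x) \<bullet> b = (LINT x:S l|M. h x \<bullet> b)"
      unfolding set_lebesgue_integral_def by (subst integral_inner_left[symmetric]) auto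
    also have "\<dots> = l * (LINT x:space M|M. h x \<bullet> b)" using S(2)[OF l, of "\<lambda>x. h x \<bullet> b"] b by auto
    also have "\<dots> = (l *\<^sub>R (LINT x|M. h x)) \<bullet> b"
      using h by (simp add: set_integral_space)
    finally show "(LINT x:S l|M. h x) \<bullet> b = (l *\<^sub>R (LINT x|M. h x)) \<bullet> b" .
  qed
  then show ?thesis using S(1) by blast
qed

section \<open>Integrals of cluster points\<close>

definition cluster_point :: "(nat \<Rightarrow> 'b::metric_space) \<Rightarrow> 'b \<Rightarrow> bool" where
  "cluster_point x z \<longleftrightarrow> (\<exists>r :: nat \<Rightarrow> nat. strict_mono r \<and> (\<lambda>k. x (r k)) \<longlonglongrightarrow> z)"

text \<open>Replaces the quantifier over subsequences by countable ones, so that the set of pairs of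
  \<open>t\<close> and a cluster point at \<open>t\<close> is measurable.\<close>

lemma cluster_point_iff: "cluster_point x z \<longleftrightarrow> (\<forall>m n :: nat. \<exists>k\<ge>n. dist (x k) z < 1 / Suc m)"
proof
  assume "cluster_point x z"
  then obtain r :: "nat \<Rightarrow> nat" where r: "strict_mono r" "(\<lambda>k. x (r k)) \<longlonglongrightarrow> z"
    unfolding cluster_point_def by blast
  show "\<forall>m n :: nat. \<exists>k\<ge>n. dist (x k) z < 1 / Suc m"
  proof (intro allI)
    fix m n :: nat
    obtain N where N: "\<And>k. k \<ge> N \<Longrightarrow> dist (x (r k)) z < 1 / Suc m"
      using metric_LIMSEQ_D[OF r(2), of "1 / Suc m"] by auto
    have "r (max N n) \<ge> n" using seq_suble[OF r(1), of "max N n"] by linarith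
    then show "\<exists>k\<ge>n. dist (x k) z < 1 / Suc m" using N[of "max N n"] by (intro exI[of _ "r (max N n)"]) auto
  qed
next
  assume *: "\<forall>m n :: nat. \<exists>k\<ge>n. dist (x k) z < 1 / Suc m"
  have "\<exists>r. \<forall>m. dist (x (r m)) z < 1 / Suc m \<and> r m < r (Suc m)"
  proof (rule dependent_nat_choice)
    show "\<exists>k. dist (x k) z < 1 / Suc 0" using *[rule_format, of 0 0] by blast
    show "\<exists>k'. dist (x k') z < 1 / Suc (Suc m) \<and> k < k'" for k m
      using *[rule_format, of "Suc k" "Suc m"] Suc_le_lessD by blast
  qed
  then obtain r where r: "\<And>m. dist (x (r m)) z < 1 / Suc m" "\<And>m. r m < r (Suc m)" by blast
  have "strict_mono r" using r(2) by (simp add: strict_mono_Suc_iff)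
  moreover have "(\<lambda>k. x (r k)) \<longlonglongrightarrow> z"
  proof (rule tendsto_dist_iff[THEN iffD2],
      rule tendsto_sandwich[where f = "\<lambda>_. 0" and h = "\<lambda>m. 1 / real (Suc m)"])
    show "(\<lambda>m. 1 / real (Suc m)) \<longlonglongrightarrow> 0" by (rule LIMSEQ_Suc) (rule lim_1_over_n)
    show "\<forall>\<^sub>F m in sequentially. dist (x (r m)) z \<le> 1 / real (Suc m)"
      using r(1) by (intro always_eventually allI less_imp_le)
  qed auto
  ultimately show "cluster_point x z" unfolding cluster_point_def by blast
qed

lemma cluster_point_subseq:
  assumes "strict_mono (r :: nat \<Rightarrow> nat)" "cluster_point (\<lambda>k. x (r k)) z"
  shows "cluster_point x z"
proof -
  obtain s :: "nat \<Rightarrow> nat" where "strict_mono s" "(\<lambda>k. x (r (s k))) \<longlonglongrightarrow> z"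
    using assms(2) unfolding cluster_point_def by blast
  then show ?thesis unfolding cluster_point_def
    using strict_mono_o[OF assms(1)] by (intro exI[of _ "r \<circ> s"]) auto
qed

lemma bounded_seq_cluster_point:
  fixes x :: "nat \<Rightarrow> 'b::euclidean_space"
  assumes "\<And>k. norm (x k) \<le> B"
  shows "\<exists>z. cluster_point x z"
proof -
  have "\<forall>k. x k \<in> cball 0 B" using assms by simp
  then obtain z r where "strict_mono r" "(x \<circ> r) \<longlonglongrightarrow> z"
    using compact_cball[of "0::'b" B] unfolding compact_eq_seq_compact_metric seq_compact_def by metis
  then show ?thesis unfolding cluster_point_def comp_def by blast
qed

lemma compact_cluster_points:
  fixes x :: "nat \<Rightarrow> 'b::euclidean_space"
  assumes "\<And>k. norm (x k) \<le> B"
  shows "compact {z. cluster_point x z}"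
proof -
  have "{z. cluster_point x z} = (\<Inter>n. closure (x ` {n..}))"
  proof (intro set_eqI iffI)
    fix z assume "z \<in> {z. cluster_point x z}"
    then have *: "\<exists>k\<ge>n. dist (x k) z < 1 / Suc m" for m n by (simp add: cluster_point_iff)
    have "z \<in> closure (x ` {n..})" for n
      unfolding closure_approachable
    proof (intro allI impI)
      fix e :: real assume "e > 0"
      then obtain m where "1 / Suc m < e" using nat_approx_posE by metis
      moreover obtain k where "k \<ge> n" "dist (x k) z < 1 / Suc m" using *[of n m] by blast
      ultimately show "\<exists>y\<in>x ` {n..}. dist y z < e" by (intro bexI[of _ "x k"]) auto
    qed
    then show "z \<in> (\<Inter>n. closure (x ` {n..}))" by blast
  next
    fix z assume *: "z \<in> (\<Inter>n. closure (x ` {n..}))"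
    have "\<exists>k\<ge>n. dist (x k) z < 1 / Suc m" for m n
    proof -
      have "z \<in> closure (x ` {n..})" using * by blast
      then have "\<exists>y\<in>x ` {n..}. dist y z < 1 / Suc m" unfolding closure_approachable by simp
      then show ?thesis by auto
    qed
    then show "z \<in> {z. cluster_point x z}" unfolding cluster_point_iff by blast
  qed
  then have "closed {z. cluster_point x z}" by auto
  moreover have "{z. cluster_point x z} \<subseteq> cball 0 B"
  proof
    fix z assume "z \<in> {z. cluster_point x z}"
    then obtain r :: "nat \<Rightarrow> nat" where "(\<lambda>k. x (r k)) \<longlonglongrightarrow> z" unfolding cluster_point_def by blast
    then have "norm z \<le> B" using assms by (intro LIMSEQ_le_const2[OF tendsto_norm]) auto
    then show "z \<in> cball 0 B" by simp
  qed
  ultimately show ?thesis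
    by (meson bounded_cball bounded_subset compact_eq_bounded_closed)
qed

text \<open>Otherwise \<open>p \<bullet> x k\<close> would exceed \<open>c + e\<close> for
  infinitely many \<open>k\<close>, and boundedness would yield a cluster point with the same
  excess.\<close>

lemma tendsto_positive_part_cluster:
  fixes x :: "nat \<Rightarrow> 'b::euclidean_space"
  assumes bd: "\<And>k. norm (x k) \<le> B" and le: "\<And>z. cluster_point x z \<Longrightarrow> p \<bullet> z \<le> c"
  shows "(\<lambda>k. max 0 (p \<bullet> x k - c)) \<longlonglongrightarrow> 0"
proof (rule ccontr)
  assume "\<not> ?thesis"
  then obtain e where e: "e > 0" "\<forall>N. \<exists>k\<ge>N. dist (max 0 (p \<bullet> x k - c)) 0 \<ge> e"
    unfolding lim_sequentially by (meson not_le)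
  define K where "K = {k. p \<bullet> x k - c \<ge> e}"
  have "infinite K" unfolding infinite_nat_iff_unbounded_le
  proof
    fix N
    obtain k where "k \<ge> N" "dist (max 0 (p \<bullet> x k - c)) 0 \<ge> e" using e(2) by blast
    then show "\<exists>k\<ge>N. k \<in> K" using e(1) by (intro exI[of _ k]) (auto simp: K_def dist_real_def)
  qed
  then have r: "strict_mono (enumerate K)" "\<And>k. enumerate K k \<in> K"
    by (auto simp: strict_mono_enumerate enumerate_in_set)
  obtain z where z: "cluster_point (\<lambda>k. x (enumerate K k)) z"
    using bounded_seq_cluster_point[of "\<lambda>k. x (enumerate K k)" B] bd by blast
  then have "p \<bullet> z \<le> c" using le cluster_point_subseq[OF r(1)] by blast
  moreover obtain s where s: "(\<lambda>k. x (enumerate K (s k))) \<longlonglongrightarrow> z" using z unfolding cluster_point_def by blast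
  have "e + c \<le> p \<bullet> z"
  proof (rule LIMSEQ_le_const[OF tendsto_inner[OF tendsto_const s]])
    show "\<exists>N. \<forall>n\<ge>N. e + c \<le> p \<bullet> x (enumerate K (s n))"
      using r(2) by (auto simp: K_def algebra_simps)
  qed
  ultimately show False using e(1) by simp
qed

text \<open>Within an atom every sublevel set of a coordinate is null or has null complement.
  Rational levels, coordinates and indices are countable, so a single null set can be removed.
  Choosing \<open>x0\<close> outside \<open>N0\<close> lets it inherit bounds that hold almost
  everywhere.\<close>

lemma atom_measurable_const:
  fixes f :: "nat \<Rightarrow> 't \<Rightarrow> 'b::euclidean_space"
  assumes A: "is_atom M A" and f[measurable]: "\<And>k. f k \<in> borel_measurable M" and N0: "N0 \<in> null_sets M"
  shows "\<exists>x0. x0 \<in> A - N0 \<and> (AE x in M. x \<in> A \<longrightarrow> (\<forall>k. f k x = f k x0))"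
proof -
  have As[measurable]: "A \<in> sets M" and Apos: "emeasure M A > 0"
    and At: "\<And>B. B \<in> sets M \<Longrightarrow> B \<subseteq> A \<Longrightarrow> emeasure M B = 0 \<or> emeasure M (A - B) = 0"
    using A unfolding is_atom_def by auto
  define B where "B = (\<lambda>(k, b, q). {x \<in> space M. x \<in> A \<and> f k x \<bullet> b \<le> q})"
  define I where "I = (UNIV :: nat set) \<times> (Basis :: 'b set) \<times> (\<rat> :: real set)"
  have [measurable]: "B i \<in> sets M" for i unfolding B_def by (cases i) simp
  have BA: "B i \<subseteq> A" for i by (auto simp: B_def split: prod.splits)
  define N where "N = N0 \<union> (\<Union>i\<in>I. if emeasure M (B i) = 0 then B i else A - B i)"
  have "countable I" unfolding I_def by (intro countable_SIGMA countable_rat) (auto intro: countable_finite)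
  then have "N \<in> null_sets M" unfolding N_def
    using At[OF _ BA] N0 by (intro null_sets.Un null_sets_UN') (auto simp: null_sets_def)
  have "\<not> A \<subseteq> N"
  proof
    assume "A \<subseteq> N"
    then have "emeasure M A \<le> emeasure M N" using \<open>N \<in> null_sets M\<close> by (intro emeasure_mono) auto
    then show False using Apos \<open>N \<in> null_sets M\<close> by (auto simp: null_sets_def)
  qed
  then obtain x0 where x0: "x0 \<in> A" "x0 \<notin> N" by blast
  have mem: "x \<in> B i \<longleftrightarrow> emeasure M (B i) \<noteq> 0" if "x \<in> A" "x \<notin> N" "i \<in> I" for x i
    using that unfolding N_def by (auto split: if_splits)
  have Asp: "A \<subseteq> space M" using As by (rule sets.sets_into_space)
  have le: "f k x \<bullet> b \<le> f k y \<bullet> b" if x: "x \<in> A" "x \<notin> N" and y: "y \<in> A" "y \<notin> N" and b: "b \<in> Basis" for x y k b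
  proof (rule ccontr)
    assume "\<not> f k x \<bullet> b \<le> f k y \<bullet> b"
    then obtain q where q: "q \<in> \<rat>" "f k y \<bullet> b < q" "q < f k x \<bullet> b" using Rats_dense_in_real by (meson not_le)
    have "(k, b, q) \<in> I" using b q by (auto simp: I_def)
    then have "x \<in> B (k, b, q) \<longleftrightarrow> y \<in> B (k, b, q)" using mem x y by blast
    then show False using q x y Asp by (auto simp: B_def)
  qed
  have eq: "f k x = f k x0" if "x \<in> A" "x \<notin> N" for x k
    by (rule euclidean_eqI) (use le[OF that x0] le[OF x0 that] in \<open>auto intro: antisym\<close>)
  have "AE x in M. x \<notin> N" using \<open>N \<in> null_sets M\<close> by (rule AE_not_in)
  then have "AE x in M. x \<in> A \<longrightarrow> (\<forall>k. f k x = f k x0)" by eventually_elim (use eq in blast)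
  moreover have "x0 \<in> A - N0" using x0 by (auto simp: N_def)
  ultimately show ?thesis by (intro exI[of _ x0] conjI)
qed

text \<open>A countable union of atoms attains the supremum of the measures of such unions; were its
  complement not null, a further atom could be added.\<close>

lemma (in finite_measure) purely_atomic_countable_cover:
  assumes pa: "purely_atomic M"
  obtains \<A> where "countable \<A>" "\<And>A. A \<in> \<A> \<Longrightarrow> is_atom M A" "AE x in M. x \<in> \<Union>\<A>"
proof -
  define \<U> where "\<U> = {\<Union>\<A> |\<A>. countable \<A> \<and> (\<forall>A\<in>\<A>. is_atom M A)}"
  have meas: "C \<in> sets M" if "C \<in> \<U>" for C
    using that unfolding \<U>_def is_atom_def by (auto intro!: sets.countable_Union)
  have bdd: "bdd_above (measure M ` \<U>)" by (rule bdd_aboveI[of _ "measure M (space M)"]) (auto intro: bounded_measure)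
  have empty: "{} \<in> \<U>" unfolding \<U>_def by (intro CollectI exI[of _ "{}"]) auto
  define s where "s = Sup (measure M ` \<U>)"
  have "\<exists>C\<in>\<U>. s - 1 / Suc n < measure M C" for n
  proof -
    have "s - 1 / Suc n < s" by simp
    then show ?thesis unfolding s_def using less_cSup_iff[OF _ bdd, of "s - 1 / Suc n"] empty
      by (auto simp: s_def)
  qed
  then obtain C where C: "\<And>n. C n \<in> \<U>" "\<And>n. s - 1 / Suc n < measure M (C n)" by metis
  then have "\<forall>n. \<exists>\<A>. C n = \<Union>\<A> \<and> countable \<A> \<and> (\<forall>A\<in>\<A>. is_atom M A)" unfolding \<U>_def by blast
  then obtain \<A> where \<A>: "\<And>n. C n = \<Union>(\<A> n)" "\<And>n. countable (\<A> n)" "\<And>n A. A \<in> \<A> n \<Longrightarrow> is_atom M A" by metis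
  define \<B> where "\<B> = (\<Union>n. \<A> n)"
  have \<B>: "countable \<B>" "\<And>A. A \<in> \<B> \<Longrightarrow> is_atom M A" unfolding \<B>_def using \<A>(2,3) by auto
  then have \<B>U: "\<Union>\<B> \<in> \<U>" unfolding \<U>_def by blast
  have ms[measurable]: "\<Union>\<B> \<in> sets M" using meas[OF \<B>U] .
  have "s \<le> measure M (\<Union>\<B>)"
  proof (rule field_le_epsilon)
    fix e :: real assume "e > 0"
    then obtain n where n: "1 / Suc n < e" using nat_approx_posE by metis
    have "C n \<subseteq> \<Union>\<B>" unfolding \<A>(1) \<B>_def by blast
    then have "measure M (C n) \<le> measure M (\<Union>\<B>)" by (intro finite_measure_mono) auto
    then show "s \<le> measure M (\<Union>\<B>) + e" using C(2)[of n] n by linarith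
  qed
  have "emeasure M (space M - \<Union>\<B>) = 0"
  proof (rule ccontr)
    assume "emeasure M (space M - \<Union>\<B>) \<noteq> 0"
    then have "emeasure M (space M - \<Union>\<B>) > 0" by (simp add: zero_less_iff_neq_zero)
    moreover have "space M - \<Union>\<B> \<in> sets M" by simp
    ultimately obtain A where A: "is_atom M A" "A \<subseteq> space M - \<Union>\<B>" using pa unfolding purely_atomic_def by blast
    have Apos: "measure M A > 0" and As: "A \<in> sets M" using A(1) by (auto simp: is_atom_def emeasure_eq_measure)
    have "A \<union> \<Union>\<B> \<in> \<U>" unfolding \<U>_def using \<B> A by (intro CollectI exI[of _ "insert A \<B>"]) auto
    then have "measure M (A \<union> \<Union>\<B>) \<le> s" unfolding s_def using bdd by (intro cSup_upper) auto
    moreover have "measure M (A \<union> \<Union>\<B>) = measure M A + measure M (\<Union>\<B>)"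
      using A(2) As by (intro finite_measure_Union) auto
    ultimately show False using Apos \<open>s \<le> measure M (\<Union>\<B>)\<close> by linarith
  qed
  then have "space M - \<Union>\<B> \<in> null_sets M" by (simp add: null_sets_def)
  then have "AE x in M. x \<notin> space M - \<Union>\<B>" by (rule AE_not_in)
  then have "AE x in M. x \<in> \<Union>\<B>" using AE_space by eventually_elim auto
  then show ?thesis using \<B> that by blast
qed

text \<open>Up to a null set the sequence is determined by its values at one point of each atom, so
  a diagonal argument over countably many bounded sequences suffices.\<close>

lemma (in finite_measure) purely_atomic_convergent_subseq:
  fixes f :: "nat \<Rightarrow> 'a \<Rightarrow> 'b::euclidean_space"
  assumes pa: "purely_atomic M" and f: "\<And>k. f k \<in> borel_measurable M"
    and bd: "\<And>k. AE x in M. norm (f k x) \<le> g x"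
  shows "\<exists>r :: nat \<Rightarrow> nat. strict_mono r \<and> (AE x in M. convergent (\<lambda>k. f (r k) x))"
proof -
  obtain \<A> where \<A>: "countable \<A>" "\<And>A. A \<in> \<A> \<Longrightarrow> is_atom M A" "AE x in M. x \<in> \<Union>\<A>"
    using purely_atomic_countable_cover[OF pa] by metis
  define Q where "Q x \<longleftrightarrow> (\<forall>k. norm (f k x) \<le> g x)" for x
  have "AE x in M. Q x" unfolding Q_def using bd by (simp add: AE_all_countable)
  then obtain N0 where N0: "N0 \<in> null_sets M" and Q: "\<And>x. x \<in> space M \<Longrightarrow> x \<notin> N0 \<Longrightarrow> Q x"
    unfolding eventually_ae_filter by blast
  have N0': "norm (f k x) \<le> g x" if "x \<in> space M" "x \<notin> N0" for x k
    using Q[OF that] unfolding Q_def by (rule spec)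
  have "\<forall>A\<in>\<A>. \<exists>x0. x0 \<in> A - N0 \<and> (AE x in M. x \<in> A \<longrightarrow> (\<forall>k. f k x = f k x0))"
    by (intro ballI atom_measurable_const \<A>(2) f N0)
  then obtain p where p0: "\<forall>A\<in>\<A>. p A \<in> A - N0 \<and> (AE x in M. x \<in> A \<longrightarrow> (\<forall>k. f k x = f k (p A)))"
    by (rule bchoice[THEN exE])
  have p: "p A \<in> A - N0" "AE x in M. x \<in> A \<longrightarrow> (\<forall>k. f k x = f k (p A))" if "A \<in> \<A>" for A
    using bspec[OF p0 that] by (rule conjunct1, rule conjunct2)
  have pb: "norm (f k (p A)) \<le> g (p A)" if "A \<in> \<A>" for A k
  proof -
    have "A \<subseteq> space M" using \<A>(2)[OF that] sets.sets_into_space by (auto simp: is_atom_def)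
    then show ?thesis using p(1)[OF that] N0' by blast
  qed
  let ?P = "\<lambda>n s. n \<in> to_nat_on \<A> ` \<A> \<longrightarrow> convergent (\<lambda>k. f (s k) (p (from_nat_into \<A> n)))"
  interpret subseqs ?P
  proof
    fix n and s :: "nat \<Rightarrow> nat" assume "strict_mono s"
    show "\<exists>r. strict_mono r \<and> ?P n (s \<circ> r)"
    proof (cases "n \<in> to_nat_on \<A> ` \<A>")
      case True
      then have A: "from_nat_into \<A> n \<in> \<A>" by (metis empty_iff from_nat_into image_empty)
      obtain z where "cluster_point (\<lambda>k. f (s k) (p (from_nat_into \<A> n))) z"
        using bounded_seq_cluster_point[of "\<lambda>k. f (s k) (p (from_nat_into \<A> n))"] pb[OF A] by blast
      then show ?thesis unfolding cluster_point_def by (auto simp: convergent_def)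
    qed (auto intro: strict_mono_id)
  qed
  have conv: "convergent (\<lambda>k. f (diagseq k) (p A))" if "A \<in> \<A>" for A
  proof -
    have "?P (to_nat_on \<A> A) (diagseq \<circ> ((+) (Suc (to_nat_on \<A> A))))"
    proof (rule diagseq_holds, intro impI)
      fix r s :: "nat \<Rightarrow> nat" and n assume r: "strict_mono r" and "?P n s" "n \<in> to_nat_on \<A> ` \<A>"
      then have "convergent (\<lambda>k. f (s k) (p (from_nat_into \<A> n)))" by blast
      from convergent_subseq_convergent[OF this r]
      show "convergent (\<lambda>k. f ((s \<circ> r) k) (p (from_nat_into \<A> n)))" by (simp add: o_def)
    qed
    then have "convergent (\<lambda>k. f (diagseq (k + Suc (to_nat_on \<A> A))) (p A))"
      using that \<A>(1) by (simp add: add.commute)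
    then show ?thesis by (subst (asm) convergent_ignore_initial_segment)
  qed
  have "AE x in M. \<forall>A\<in>\<A>. x \<in> A \<longrightarrow> (\<forall>k. f k x = f k (p A))"
    using p(2) \<A>(1) by (simp add: AE_ball_countable)
  then have "AE x in M. convergent (\<lambda>k. f (diagseq k) x)"
    using \<A>(3) by eventually_elim (use conv in auto)
  with subseq_diagseq show ?thesis by (intro exI[of _ diagseq] conjI)
qed

section \<open>Selections of cluster points and their integrals\<close>

lemma cluster_point_norm_le:
  fixes x :: "nat \<Rightarrow> 'b::real_normed_vector"
  assumes "\<And>k. norm (x k) \<le> B" "cluster_point x z"
  shows "norm z \<le> B"
proof -
  obtain r :: "nat \<Rightarrow> nat" where "(\<lambda>k. x (r k)) \<longlonglongrightarrow> z" using assms(2) unfolding cluster_point_def by blast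
  then show ?thesis using assms(1) by (intro LIMSEQ_le_const2[OF tendsto_norm]) auto
qed

lemma cluster_point_selection:
  fixes f :: "nat \<Rightarrow> 't \<Rightarrow> 'b::euclidean_space"
  assumes M: "finite_measure M" "complete_measure M" and f[measurable]: "\<And>k. f k \<in> borel_measurable M"
    and bd: "AE t in M. \<forall>k. norm (f k t) \<le> g t"
  shows "\<exists>F. F \<in> borel_measurable M \<and>
    (AE t in M. cluster_point (\<lambda>k. f k t) (F t) \<and> (\<forall>z. cluster_point (\<lambda>k. f k t) z \<longrightarrow> p \<bullet> z \<le> p \<bullet> F t))"
proof -
  define G where "G = {x \<in> space (M \<Otimes>\<^sub>M borel). \<forall>m n :: nat. \<exists>k. n \<le> k \<and> dist (f k (fst x)) (snd x) < 1 / Suc m}"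
  have G: "G \<in> sets (M \<Otimes>\<^sub>M borel)" unfolding G_def by measurable
  have Gt: "{z. (t, z) \<in> G} = {z. cluster_point (\<lambda>k. f k t) z}" if "t \<in> space M" for t
    using that by (simp add: G_def cluster_point_iff space_pair_measure)
  have 1: "AE t in M. compact {z. (t, z) \<in> G} \<and> {z. (t, z) \<in> G} \<noteq> {}"
    using bd AE_space
  proof eventually_elim
    case (elim t)
    then have b: "\<And>k. norm (f k t) \<le> g t" by blast
    then show ?case unfolding Gt[OF elim(2)]
      using compact_cluster_points[OF b] bounded_seq_cluster_point[OF b] by auto
  qed
  have 2: "(\<lambda>x. - (p \<bullet> snd x)) \<in> borel_measurable (M \<Otimes>\<^sub>M borel)" by measurable
  have 3: "AE t in M. continuous_on {z. (t, z) \<in> G} (\<lambda>z. - (p \<bullet> snd (t, z)))"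
    by (intro AE_I2) (auto intro!: continuous_intros)
  obtain F where F: "F \<in> borel_measurable M"
    "AE t in M. (t, F t) \<in> G \<and> (\<forall>z. (t, z) \<in> G \<longrightarrow> - (p \<bullet> snd (t, F t)) \<le> - (p \<bullet> snd (t, z)))"
    by (rule measurable_argmin_AE[OF M G 1 2 3])
  show ?thesis
  proof (intro exI conjI)
    show "AE t in M. cluster_point (\<lambda>k. f k t) (F t) \<and> (\<forall>z. cluster_point (\<lambda>k. f k t) z \<longrightarrow> p \<bullet> z \<le> p \<bullet> F t)"
      using F(2) AE_space
    proof eventually_elim
      case (elim t)
      have "(t, z) \<in> G \<longleftrightarrow> cluster_point (\<lambda>k. f k t) z" for z using Gt[OF elim(2)] by blast
      with elim(1) show ?case by simp
    qed
  qed (rule F(1))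
qed

text \<open>No cluster point exceeds \<open>F t\<close> in the direction \<open>p\<close>, so the
  positive part of the excess \<open>D k\<close> tends to zero pointwise and, by domination, in
  mean. In the case of equality the integral of \<open>D k\<close> tends to zero too; the absolute
  value being twice the positive part minus \<open>D k\<close>, convergence in mean and an almost
  everywhere convergent subsequence follow.\<close>

lemma integral_le_maximal_cluster:
  fixes f :: "nat \<Rightarrow> 't \<Rightarrow> 'b::euclidean_space"
  assumes f[measurable]: "\<And>k. f k \<in> borel_measurable M" and g: "integrable M g"
    and bd: "AE t in M. \<forall>k. norm (f k t) \<le> g t"
    and F[measurable]: "F \<in> borel_measurable M"
    and max: "AE t in M. cluster_point (\<lambda>k. f k t) (F t) \<and> (\<forall>z. cluster_point (\<lambda>k. f k t) z \<longrightarrow> p \<bullet> z \<le> p \<bullet> F t)"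
    and a: "(\<lambda>k. \<integral>t. f k t \<partial>M) \<longlonglongrightarrow> a"
  shows "p \<bullet> a \<le> (LINT t|M. p \<bullet> F t)"
    and "(LINT t|M. p \<bullet> F t) \<le> p \<bullet> a \<Longrightarrow>
      \<exists>r :: nat \<Rightarrow> nat. strict_mono r \<and> (AE t in M. (\<lambda>k. p \<bullet> f (r k) t) \<longlonglongrightarrow> p \<bullet> F t)"
proof -
  have fi: "integrable M (f k)" for k
    by (rule Bochner_Integration.integrable_bound[OF g]) (use bd in \<open>auto elim!: eventually_mono intro: order_trans\<close>)
  have Fb: "AE t in M. norm (F t) \<le> g t"
    using bd max
  proof eventually_elim
    case (elim t)
    then show ?case using cluster_point_norm_le[of "\<lambda>k. f k t" "g t" "F t"] by simp
  qed
  then have Fi: "integrable M F"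
    by (intro Bochner_Integration.integrable_bound[OF g]) (auto elim!: eventually_mono intro: order_trans)
  define D where "D k t = p \<bullet> f k t - p \<bullet> F t" for k t
  have [measurable]: "D k \<in> borel_measurable M" for k unfolding D_def by measurable
  have Di: "integrable M (D k)" for k unfolding D_def using fi Fi by auto
  have Dint: "(LINT t|M. D k t) = p \<bullet> (LINT t|M. f k t) - (LINT t|M. p \<bullet> F t)" for k
    unfolding D_def using fi Fi by simp
  have "(\<lambda>k. \<integral>t. max 0 (D k t) \<partial>M) \<longlonglongrightarrow> (LINT t|M. 0)"
  proof (rule integral_dominated_convergence)
    show "integrable M (\<lambda>t. 2 * norm p * g t)" using g by simp
    show "AE t in M. (\<lambda>k. max 0 (D k t)) \<longlonglongrightarrow> 0"
      using bd max unfolding D_def by eventually_elim (rule tendsto_positive_part_cluster, blast+)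
    show "AE t in M. norm (max 0 (D k t)) \<le> 2 * norm p * g t" for k
      using bd Fb
    proof eventually_elim
      case (elim t)
      have "norm (max 0 (D k t)) \<le> \<bar>p \<bullet> f k t\<bar> + \<bar>p \<bullet> F t\<bar>" unfolding D_def by auto
      also have "\<dots> \<le> norm p * norm (f k t) + norm p * norm (F t)"
        by (intro add_mono Cauchy_Schwarz_ineq2)
      also have "\<dots> \<le> norm p * g t + norm p * g t"
        using elim by (intro add_mono mult_left_mono) auto
      finally show ?case by simp
    qed
  qed auto
  then have u: "(\<lambda>k. \<integral>t. max 0 (D k t) \<partial>M) \<longlonglongrightarrow> 0" by simp
  have Dlim: "(\<lambda>k. \<integral>t. D k t \<partial>M) \<longlonglongrightarrow> p \<bullet> a - (LINT t|M. p \<bullet> F t)"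
    unfolding Dint by (intro tendsto_intros a)
  have ui: "integrable M (\<lambda>t. max 0 (D k t))" for k using Di by auto
  have "(LINT t|M. D k t) \<le> (LINT t|M. max 0 (D k t))" for k
    by (intro integral_mono Di ui) auto
  then have "p \<bullet> a - (LINT t|M. p \<bullet> F t) \<le> 0" by (intro LIMSEQ_le[OF Dlim u]) auto
  then show le: "p \<bullet> a \<le> (LINT t|M. p \<bullet> F t)" by simp
  assume ge: "(LINT t|M. p \<bullet> F t) \<le> p \<bullet> a"
  have "(LINT t|M. norm (D k t)) = 2 * (LINT t|M. max 0 (D k t)) - (LINT t|M. D k t)" for k
  proof -
    have "(LINT t|M. norm (D k t)) = (LINT t|M. 2 * max 0 (D k t) - D k t)"
      by (rule Bochner_Integration.integral_cong) auto
    then show ?thesis using Di[of k] ui[of k] by simp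
  qed
  moreover have "(\<lambda>k. 2 * (LINT t|M. max 0 (D k t)) - (LINT t|M. D k t)) \<longlonglongrightarrow> 2 * 0 - (p \<bullet> a - (LINT t|M. p \<bullet> F t))"
    by (intro tendsto_intros u Dlim)
  ultimately have "(\<lambda>k. \<integral>t. norm (D k t) \<partial>M) \<longlonglongrightarrow> 0" using le ge by simp
  from tendsto_L1_AE_subseq[OF Di this] obtain r :: "nat \<Rightarrow> nat" where
    r: "strict_mono r" "AE t in M. (\<lambda>k. D (r k) t) \<longlonglongrightarrow> 0" by blast
  from r(2) have "AE t in M. (\<lambda>k. p \<bullet> f (r k) t) \<longlonglongrightarrow> p \<bullet> F t"
    unfolding D_def by eventually_elim (simp add: LIM_zero_iff)
  with r(1) show "\<exists>r :: nat \<Rightarrow> nat. strict_mono r \<and> (AE t in M. (\<lambda>k. p \<bullet> f (r k) t) \<longlonglongrightarrow> p \<bullet> F t)" by blast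
qed

text \<open>Induction on the dimension of \<open>V\<close>: in all directions orthogonal to \<open>V\<close> the sequence converges
  already. If \<open>a\<close> maximises some direction \<open>p\<close> in \<open>V\<close> over the integrals of cluster selections, then a
  subsequence converges in the direction \<open>p\<close> as well; otherwise \<open>a\<close> cannot be separated from this set
  of integrals, which is convex by Lyapunov's theorem.\<close>

lemma nonatomic_fatou_subspace:
  fixes f :: "nat \<Rightarrow> 't \<Rightarrow> 'b::euclidean_space"
  assumes M: "finite_measure M" "complete_measure M" "nonatomic M" and g: "integrable M g"
    and f: "\<And>k. f k \<in> borel_measurable M" and bd: "AE t in M. \<forall>k. norm (f k t) \<le> g t"
    and a: "(\<lambda>k. \<integral>t. f k t \<partial>M) \<longlonglongrightarrow> a"
    and V: "subspace V" and orth: "\<And>q. (\<forall>v\<in>V. q \<bullet> v = 0) \<Longrightarrow> AE t in M. convergent (\<lambda>k. f k t \<bullet> q)"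
  shows "\<exists>F. integrable M F \<and> (AE t in M. cluster_point (\<lambda>k. f k t) (F t)) \<and> (LINT t|M. F t) = a"
  using f bd a V orth
proof (induction "dim V" arbitrary: V f rule: less_induct)
  case less
  note f = less.prems(1) and bd = less.prems(2) and a = less.prems(3) and V = less.prems(4) and orth = less.prems(5)
  interpret finite_measure M by (rule M(1))
  define maxi where "maxi p F \<longleftrightarrow> F \<in> borel_measurable M \<and>
    (AE t in M. cluster_point (\<lambda>k. f k t) (F t) \<and> (\<forall>z. cluster_point (\<lambda>k. f k t) z \<longrightarrow> p \<bullet> z \<le> p \<bullet> F t))" for p F
  define sel where "sel F \<longleftrightarrow> F \<in> borel_measurable M \<and> (AE t in M. cluster_point (\<lambda>k. f k t) (F t))" for F
  have ex_maxi: "\<exists>F. maxi p F" for p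
    unfolding maxi_def by (rule cluster_point_selection[OF M(1,2) f bd])
  have maxi_sel: "sel F" if "maxi p F" for p F
    using that unfolding maxi_def sel_def by (auto elim!: eventually_mono)
  have selb: "AE t in M. norm (F t) \<le> g t" if "sel F" for F
  proof -
    have "AE t in M. cluster_point (\<lambda>k. f k t) (F t)" using that by (simp add: sel_def)
    then show ?thesis using bd
    proof eventually_elim
      case (elim t)
      then show ?case using cluster_point_norm_le[of "\<lambda>k. f k t" "g t" "F t"] by simp
    qed
  qed
  have seli: "integrable M F" if "sel F" for F
    using selb[OF that] that unfolding sel_def
    by (intro Bochner_Integration.integrable_bound[OF g]) (auto elim!: eventually_mono intro: order_trans)
  show ?case
  proof (cases "\<exists>p F. p \<in> V \<and> p \<noteq> 0 \<and> maxi p F \<and> (LINT t|M. p \<bullet> F t) \<le> p \<bullet> a")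
    case True
    then obtain p F where p: "p \<in> V" "p \<noteq> 0" and F: "maxi p F" and ge: "(LINT t|M. p \<bullet> F t) \<le> p \<bullet> a" by blast
    have F1: "F \<in> borel_measurable M" and F2: "AE t in M. cluster_point (\<lambda>k. f k t) (F t) \<and> (\<forall>z. cluster_point (\<lambda>k. f k t) z \<longrightarrow> p \<bullet> z \<le> p \<bullet> F t)"
      using F by (simp_all add: maxi_def)
    from integral_le_maximal_cluster(2)[OF f g bd F1 F2 a ge]
    obtain r :: "nat \<Rightarrow> nat" where r: "strict_mono r" "AE t in M. (\<lambda>k. p \<bullet> f (r k) t) \<longlonglongrightarrow> p \<bullet> F t" by blast
    define V' where "V' = {v \<in> V. p \<bullet> v = 0}"
    have V': "subspace V'" unfolding V'_def using V
      by (auto simp: subspace_def inner_add_right)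
    have "p \<notin> V'" "V' \<subseteq> V" using p by (auto simp: V'_def)
    then have "V' \<subset> V" using p by blast
    then have dim: "dim V' < dim V" using V V' by (intro dim_psubset) (simp add: span_eq_iff[THEN iffD2])
    have bd': "AE t in M. \<forall>k. norm (f (r k) t) \<le> g t" using bd by eventually_elim blast
    have a': "(\<lambda>k. \<integral>t. f (r k) t \<partial>M) \<longlonglongrightarrow> a" using LIMSEQ_subseq_LIMSEQ[OF a r(1)] by (simp add: o_def)
    have orth': "AE t in M. convergent (\<lambda>k. f (r k) t \<bullet> q)" if q: "\<forall>v\<in>V'. q \<bullet> v = 0" for q
    proof -
      \<comment> \<open>Subtracting this multiple of \<open>p\<close> makes \<open>q\<close>
        orthogonal to all of \<open>V\<close>, where convergence is known already; the direction
        \<open>p\<close> is supplied by the new subsequence.\<close>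
      define c where "c = (q \<bullet> p) / (p \<bullet> p)"
      have "(q - c *\<^sub>R p) \<bullet> v = 0" if v: "v \<in> V" for v
      proof -
        have "v - ((v \<bullet> p) / (p \<bullet> p)) *\<^sub>R p \<in> V'" unfolding V'_def
          using v p V by (auto simp: inner_diff_right inner_commute intro!: subspace_diff subspace_scale)
        then have "q \<bullet> (v - ((v \<bullet> p) / (p \<bullet> p)) *\<^sub>R p) = 0" using q by blast
        then show ?thesis by (simp add: c_def inner_diff_right inner_diff_left inner_commute)
      qed
      then have "AE t in M. convergent (\<lambda>k. f k t \<bullet> (q - c *\<^sub>R p))" by (intro orth ballI)
      then show ?thesis using r(2)
      proof eventually_elim
        case (elim t)
        have "convergent (\<lambda>k. f (r k) t \<bullet> (q - c *\<^sub>R p))"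
          using convergent_subseq_convergent[OF elim(1) r(1)] by (simp add: o_def)
        moreover have "convergent (\<lambda>k. p \<bullet> f (r k) t)" using elim(2) by (auto simp: convergent_def)
        ultimately have "convergent (\<lambda>k. f (r k) t \<bullet> (q - c *\<^sub>R p) + c * (p \<bullet> f (r k) t))"
          by (intro convergent_add convergent_mult convergent_const)
        then show ?case by (simp add: inner_diff_right inner_commute)
      qed
    qed
    from less.hyps[OF dim f bd' a' V' orth'] obtain H where
      H: "integrable M H" "AE t in M. cluster_point (\<lambda>k. f (r k) t) (H t)" "(LINT t|M. H t) = a" by blast
    have "AE t in M. cluster_point (\<lambda>k. f k t) (H t)"
      using H(2) by eventually_elim (rule cluster_point_subseq[OF r(1)])
    then show ?thesis using H by blast
  next
    case False
    \<comment> \<open>The orthogonal complement of \<open>V\<close> is added in order to force every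
      separating direction into \<open>V\<close>, the only place where the failed case distinction
      gives information.\<close>
    define W where "W = {(LINT t|M. F t) + w |F w. sel F \<and> (\<forall>v\<in>V. w \<bullet> v = 0)}"
    have WI: "(LINT t|M. F t) + w \<in> W" if "sel F" "\<forall>v\<in>V. w \<bullet> v = 0" for F w
      unfolding W_def using that by blast
    have "convex W"
      unfolding convex_alt
    proof (intro ballI allI impI)
      fix x y and u :: real assume x: "x \<in> W" and y: "y \<in> W" and u: "0 \<le> u \<and> u \<le> 1"
      obtain F w where F: "sel F" "\<forall>v\<in>V. w \<bullet> v = 0" and xF: "x = (LINT t|M. F t) + w" using x unfolding W_def by blast
      obtain H w' where H: "sel H" "\<forall>v\<in>V. w' \<bullet> v = 0" and yH: "y = (LINT t|M. H t) + w'" using y unfolding W_def by blast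
      have hi: "integrable M (\<lambda>t. H t - F t)" using seli F(1) H(1) by auto
      obtain S where S: "S \<in> sets M" "(LINT t:S|M. H t - F t) = u *\<^sub>R (LINT t|M. H t - F t)"
        using lyapunov_convexity[OF M(3) hi, of u] u by blast
      define K where "K t = (if t \<in> S then H t else F t)" for t
      have K: "sel K"
      proof -
        have "AE t in M. cluster_point (\<lambda>k. f k t) (F t)" "AE t in M. cluster_point (\<lambda>k. f k t) (H t)"
          using F(1) H(1) by (simp_all add: sel_def)
        then have "AE t in M. cluster_point (\<lambda>k. f k t) (K t)" by eventually_elim (simp add: K_def)
        moreover have "K \<in> borel_measurable M"
          using F(1) H(1) S(1) unfolding K_def sel_def by (intro measurable_If_set) auto
        ultimately show ?thesis by (simp add: sel_def)
      qed
      have "(LINT t|M. K t) = (LINT t|M. F t + indicator S t *\<^sub>R (H t - F t))"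
        by (rule Bochner_Integration.integral_cong) (auto simp: K_def)
      also have "\<dots> = (LINT t|M. F t) + (LINT t:S|M. H t - F t)"
        unfolding set_lebesgue_integral_def
        by (rule Bochner_Integration.integral_add[OF seli[OF F(1)] integrable_mult_indicator[OF S(1) hi]])
      also have "\<dots> = (LINT t|M. F t) + u *\<^sub>R ((LINT t|M. H t) - (LINT t|M. F t))"
        unfolding S(2) using seli[OF F(1)] seli[OF H(1)] by simp
      finally have "(1 - u) *\<^sub>R x + u *\<^sub>R y = (LINT t|M. K t) + ((1 - u) *\<^sub>R w + u *\<^sub>R w')"
        unfolding xF yH by (simp add: algebra_simps)
      moreover have "\<forall>v\<in>V. ((1 - u) *\<^sub>R w + u *\<^sub>R w') \<bullet> v = 0" using F(2) H(2) by (simp add: inner_add_left)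
      ultimately show "(1 - u) *\<^sub>R x + u *\<^sub>R y \<in> W" using WI[OF K] by simp
    qed
    have "a \<in> W"
    proof (rule ccontr)
      assume "a \<notin> W"
      then have "0 \<notin> (\<lambda>x. x - a) ` W" by auto
      moreover have "convex ((\<lambda>x. x - a) ` W)" using \<open>convex W\<close> by (rule convex_translation_subtract)
      ultimately obtain p where p: "p \<noteq> 0" "\<And>x. x \<in> W \<Longrightarrow> 0 \<le> p \<bullet> (x - a)"
        using separating_hyperplane_set_0[of "(\<lambda>x. x - a) ` W"] by blast
      obtain y z where yz: "y \<in> span V" "\<And>w. w \<in> span V \<Longrightarrow> orthogonal z w" "p = y + z"
        using orthogonal_subspace_decomp_exists[of V p] by metis
      have zV: "z \<bullet> v = 0" if "v \<in> V" for v using yz(2)[of v] that span_base by (auto simp: orthogonal_def)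
      obtain F0 where F0: "sel F0" using ex_maxi[of 0] maxi_sel by blast
      have "p \<bullet> z = z \<bullet> z"
        unfolding yz(3) inner_add_left using yz(2)[OF yz(1)] by (simp add: orthogonal_def inner_commute)
      \<comment> \<open>\<open>W\<close> is invariant under translation by multiples of
        \<open>z\<close>; a nonzero \<open>z\<close> would make the separating functional unbounded
        below on \<open>W\<close>.\<close>
      have "z = 0"
      proof (rule ccontr)
        assume "z \<noteq> 0"
        define c where "c = (\<bar>p \<bullet> ((LINT t|M. F0 t) - a)\<bar> + 1) / (z \<bullet> z)"
        have "\<forall>v\<in>V. (- c *\<^sub>R z) \<bullet> v = 0" using zV by simp
        from p(2)[OF WI[OF F0 this]] have "0 \<le> p \<bullet> ((LINT t|M. F0 t) - a) - c * (z \<bullet> z)"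
          using \<open>p \<bullet> z = z \<bullet> z\<close> by (simp add: inner_add_right inner_diff_right)
        moreover have "c * (z \<bullet> z) = \<bar>p \<bullet> ((LINT t|M. F0 t) - a)\<bar> + 1" using \<open>z \<noteq> 0\<close> by (simp add: c_def)
        ultimately show False by linarith
      qed
      then have "p \<in> V" using yz V by (simp add: span_eq_iff[THEN iffD2])
      \<comment> \<open>The weak separating inequality suffices for a contradiction, since the
        failed case distinction excludes equality as well; hence \<open>W\<close> need not be
        closed.\<close>
      obtain F where F: "maxi (- p) F" using ex_maxi by blast
      have Fs: "sel F" using F by (rule maxi_sel)
      from p(2)[OF WI[OF Fs, of 0]] have "p \<bullet> a \<le> p \<bullet> (LINT t|M. F t)" by (simp add: inner_diff_right)
      then have "(LINT t|M. - p \<bullet> F t) \<le> - p \<bullet> a" using seli[OF Fs] by simp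
      moreover have "- p \<in> V" "- p \<noteq> 0" using \<open>p \<in> V\<close> p(1) V by (auto intro: subspace_neg)
      ultimately show False using False F by blast
    qed
    then obtain F w where F: "sel F" and w: "\<forall>v\<in>V. w \<bullet> v = 0" and aF: "a = (LINT t|M. F t) + w"
      unfolding W_def by blast
    \<comment> \<open>In the direction \<open>w\<close> the whole sequence converges, necessarily to
      the value of its cluster point. The integrals therefore agree in this direction, so the
      surplus \<open>w\<close> is orthogonal to itself.\<close>
    have "(\<lambda>k. \<integral>t. f k t \<bullet> w \<partial>M) \<longlonglongrightarrow> (LINT t|M. F t \<bullet> w)"
    proof (rule integral_dominated_convergence)
      have "AE t in M. cluster_point (\<lambda>k. f k t) (F t)" using F by (simp add: sel_def)
      then show "AE t in M. (\<lambda>k. f k t \<bullet> w) \<longlonglongrightarrow> F t \<bullet> w" using orth[OF w]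
      proof eventually_elim
        case (elim t)
        then obtain l where l: "(\<lambda>k. f k t \<bullet> w) \<longlonglongrightarrow> l" by (auto simp: convergent_def)
        obtain r :: "nat \<Rightarrow> nat" where r: "strict_mono r" "(\<lambda>k. f (r k) t) \<longlonglongrightarrow> F t"
          using elim(1) unfolding cluster_point_def by blast
        have "(\<lambda>k. f (r k) t \<bullet> w) \<longlonglongrightarrow> F t \<bullet> w" by (intro tendsto_intros r(2))
        moreover have "(\<lambda>k. f (r k) t \<bullet> w) \<longlonglongrightarrow> l" using LIMSEQ_subseq_LIMSEQ[OF l r(1)] by (simp add: o_def)
        ultimately show ?case using l LIMSEQ_unique by blast
      qed
      show "AE t in M. norm (f k t \<bullet> w) \<le> g t * norm w" for k
        using bd
      proof eventually_elim
        case (elim t)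
        have "norm (f k t \<bullet> w) \<le> norm (f k t) * norm w" by (simp add: Cauchy_Schwarz_ineq2)
        also have "\<dots> \<le> g t * norm w" using elim by (intro mult_right_mono) auto
        finally show ?case .
      qed
      show "integrable M (\<lambda>t. g t * norm w)" using g by simp
      show "(\<lambda>t. F t \<bullet> w) \<in> borel_measurable M" using F unfolding sel_def by auto
      show "(\<lambda>t. f k t \<bullet> w) \<in> borel_measurable M" for k using f[of k] by auto
    qed
    moreover have "integrable M (f k)" for k
      by (rule Bochner_Integration.integrable_bound[OF g f]) (use bd in \<open>auto elim!: eventually_mono intro: order_trans\<close>)
    ultimately have "(\<lambda>k. (LINT t|M. f k t) \<bullet> w) \<longlonglongrightarrow> (LINT t|M. F t) \<bullet> w" using seli[OF F] by simp
    moreover have "(\<lambda>k. (LINT t|M. f k t) \<bullet> w) \<longlonglongrightarrow> a \<bullet> w" by (intro tendsto_intros a)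
    ultimately have "(LINT t|M. F t) \<bullet> w = a \<bullet> w" by (rule LIMSEQ_unique)
    then have "w = 0" unfolding aF by (simp add: inner_add_left)
    then show ?thesis using F seli[OF F] aF unfolding sel_def by (intro exI[of _ F]) auto
  qed
qed

section \<open>Combining the atomic and the nonatomic part\<close>

lemma complete_measure_restrict_space:
  assumes "complete_measure M" "S \<in> sets M"
  shows "complete_measure (restrict_space M S)"
proof
  interpret complete_measure M by fact
  fix A B assume "B \<subseteq> A" "A \<in> null_sets (restrict_space M S)"
  then have "A \<in> null_sets M" "A \<subseteq> S"
    using assms(2) by (simp_all add: null_sets_restrict_space)
  then show "B \<in> sets (restrict_space M S)"
    using complete[OF \<open>B \<subseteq> A\<close>] \<open>B \<subseteq> A\<close> assms(2) by (subst sets_restrict_space_iff) auto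
qed

text \<open>The decomposition is phrased with densities. These can fail to be complete, because
  every measurable set outside \<open>S\<close> becomes null; the measurable selections therefore
  take place on the subspace, and atoms have to be transferred.\<close>

lemma is_atom_restrict_space_iff:
  assumes S: "S \<in> sets M" and A: "A \<subseteq> S"
  shows "is_atom (restrict_space M S) A \<longleftrightarrow> is_atom (density M (indicator S)) A"
proof -
  have sub: "B \<in> sets (restrict_space M S) \<longleftrightarrow> B \<in> sets M" if "B \<subseteq> A" for B
    using S A that by (subst sets_restrict_space_iff) auto
  have em: "emeasure (restrict_space M S) B = emeasure (density M (indicator S)) B" if "B \<subseteq> A" "B \<in> sets M" for B
  proof -
    have "emeasure (restrict_space M S) B = emeasure M B"
      using S A that by (intro emeasure_restrict_space) auto
    moreover have "emeasure (density M (indicator S)) B = emeasure M (S \<inter> B)"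
      by (rule emeasure_restricted[OF S that(2)])
    moreover have "S \<inter> B = B" using A that by auto
    ultimately show ?thesis by simp
  qed
  show ?thesis
  proof (cases "A \<in> sets M")
    case True
    have "emeasure (restrict_space M S) (A - B) = emeasure (density M (indicator S)) (A - B)" if "B \<in> sets M" for B
      using em[of "A - B"] True that by auto
    then show ?thesis unfolding is_atom_def using sub em True by auto
  qed (use sub[of A] in \<open>auto simp: is_atom_def\<close>)
qed

text \<open>The subsequence is fixed on the atomic part first. There it converges almost everywhere
  and its integrals converge by domination, so along it the integrals over the nonatomic part have a
  limit as well.\<close>

theorem fatou_cluster_point:
  fixes f :: "nat \<Rightarrow> 't \<Rightarrow> 'b::euclidean_space"
  assumes M: "finite_measure M" "complete_measure M" and dec: "atomic_decomposition M Tpa Tna"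
    and g: "integrable M g" and f[measurable]: "\<And>k. f k \<in> borel_measurable M"
    and bd: "AE t in M. \<forall>k. norm (f k t) \<le> g t" and a: "(\<lambda>k. \<integral>t. f k t \<partial>M) \<longlonglongrightarrow> a"
  shows "\<exists>F. integrable M F \<and> (AE t in M. cluster_point (\<lambda>k. f k t) (F t)) \<and> (LINT t|M. F t) = a"
proof -
  interpret finite_measure M by fact
  have Ts[measurable]: "Tpa \<in> sets M" "Tna \<in> sets M" and disj: "Tpa \<inter> Tna = {}" and un: "Tpa \<union> Tna = space M"
    and pa: "purely_atomic (density M (indicator Tpa))" and na: "nonatomic (density M (indicator Tna))"
    using dec unfolding atomic_decomposition_def by auto
  define M1 where "M1 = restrict_space M Tpa"
  define M2 where "M2 = restrict_space M Tna"
  have Tsp: "Tpa \<inter> space M \<in> sets M" "Tna \<inter> space M \<in> sets M" by auto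
  interpret M1: finite_measure M1 unfolding M1_def by (intro finite_measure_restrict_space M Ts)
  have M2: "finite_measure M2" "complete_measure M2"
    unfolding M2_def using M Ts by (auto intro!: finite_measure_restrict_space complete_measure_restrict_space)
  have fi: "integrable M (f k)" for k
    by (rule Bochner_Integration.integrable_bound[OF g]) (use bd in \<open>auto elim!: eventually_mono intro: order_trans\<close>)
  have pa1: "purely_atomic M1"
    unfolding purely_atomic_def
  proof (intro ballI impI)
    fix B assume B: "B \<in> sets M1" "0 < emeasure M1 B"
    have Bs: "B \<in> sets M" "B \<subseteq> Tpa" using B(1) Ts unfolding M1_def by (auto simp: sets_restrict_space_iff)
    then have "emeasure (density M (indicator Tpa)) B = emeasure M (Tpa \<inter> B)" using Ts by (intro emeasure_restricted) auto
    also have "Tpa \<inter> B = B" using Bs by auto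
    also have "emeasure M B = emeasure M1 B" unfolding M1_def using Bs Ts by (intro emeasure_restrict_space[symmetric]) auto
    finally have "0 < emeasure (density M (indicator Tpa)) B" using B(2) by simp
    then obtain A where A: "is_atom (density M (indicator Tpa)) A" "A \<subseteq> B"
      using pa Bs(1) unfolding purely_atomic_def by auto
    then have "is_atom M1 A" unfolding M1_def using Bs Ts by (subst is_atom_restrict_space_iff) auto
    then show "\<exists>A. is_atom M1 A \<and> A \<subseteq> B" using A(2) by blast
  qed
  have na2: "nonatomic M2"
    unfolding nonatomic_def
  proof
    assume "\<exists>A. is_atom M2 A"
    then obtain A where A: "is_atom M2 A" by blast
    then have "A \<subseteq> Tna" using Ts unfolding is_atom_def M2_def by (auto simp: sets_restrict_space_iff)
    then show False using A na Ts unfolding M2_def nonatomic_def by (simp add: is_atom_restrict_space_iff)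
  qed
  have f1: "f k \<in> borel_measurable M1" "f k \<in> borel_measurable M2" for k
    unfolding M1_def M2_def by (auto intro: measurable_restrict_space1 f)
  have bd1: "AE t in M1. \<forall>k. norm (f k t) \<le> g t" and bd2: "AE t in M2. \<forall>k. norm (f k t) \<le> g t"
    unfolding M1_def M2_def using bd by (auto simp: AE_restrict_space_iff Tsp elim!: eventually_mono)
  have "AE t in M1. norm (f k t) \<le> g t" for k using bd1 by eventually_elim blast
  from M1.purely_atomic_convergent_subseq[OF pa1 f1(1) this]
  obtain r :: "nat \<Rightarrow> nat" where r0: "strict_mono r \<and> (AE t in M1. convergent (\<lambda>k. f (r k) t))"
    by (rule exE)
  note r = conjunct1[OF r0] conjunct2[OF r0]
  define F1 where "F1 t = lim (\<lambda>k. f (r k) t)" for t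
  have [measurable]: "F1 \<in> borel_measurable M" unfolding F1_def by measurable
  have "AE t in M. t \<in> Tpa \<longrightarrow> convergent (\<lambda>k. f (r k) t)"
    using r(2) unfolding M1_def by (simp add: AE_restrict_space_iff Tsp)
  then have F1: "AE t in M. t \<in> Tpa \<longrightarrow> (\<lambda>k. f (r k) t) \<longlonglongrightarrow> F1 t"
    unfolding F1_def by eventually_elim (simp add: convergent_LIMSEQ_iff)
  have gI: "integrable M (\<lambda>t. g t)" using g .
  have lim1: "(\<lambda>k. \<integral>t. indicator Tpa t *\<^sub>R f (r k) t \<partial>M) \<longlonglongrightarrow> (LINT t|M. indicator Tpa t *\<^sub>R F1 t)"
    and int1: "integrable M (\<lambda>t. indicator Tpa t *\<^sub>R F1 t)"
  proof -
    have 1: "AE t in M. (\<lambda>k. indicator Tpa t *\<^sub>R f (r k) t) \<longlonglongrightarrow> indicator Tpa t *\<^sub>R F1 t"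
      using F1 by eventually_elim (auto simp: indicator_def)
    have 2: "AE t in M. norm (indicator Tpa t *\<^sub>R f (r k) t) \<le> g t" for k
      using bd
    proof eventually_elim
      case (elim t)
      have "norm (indicator Tpa t *\<^sub>R f (r k) t) \<le> norm (f (r k) t)" by (simp add: indicator_def)
      then show ?case using elim order_trans by blast
    qed
    show "(\<lambda>k. \<integral>t. indicator Tpa t *\<^sub>R f (r k) t \<partial>M) \<longlonglongrightarrow> (LINT t|M. indicator Tpa t *\<^sub>R F1 t)"
      by (rule integral_dominated_convergence[OF _ _ gI 1 2]) auto
    show "integrable M (\<lambda>t. indicator Tpa t *\<^sub>R F1 t)"
      by (rule integrable_dominated_convergence[OF _ _ gI 1 2]) auto
  qed
  have split: "(LINT t|M. f k t) = (LINT t|M. indicator Tpa t *\<^sub>R f k t) + (LINT t|M2. f k t)" for k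
  proof -
    have "(LINT t|M. f k t) = (LINT t|M. indicator Tpa t *\<^sub>R f k t + indicator Tna t *\<^sub>R f k t)"
      using disj un by (intro Bochner_Integration.integral_cong) (auto simp: indicator_def)
    also have "\<dots> = (LINT t|M. indicator Tpa t *\<^sub>R f k t) + (LINT t|M. indicator Tna t *\<^sub>R f k t)"
      by (intro Bochner_Integration.integral_add integrable_mult_indicator fi) auto
    finally show ?thesis unfolding M2_def by (simp add: integral_restrict_space Tsp)
  qed
  have a2: "(\<lambda>k. \<integral>t. f (r k) t \<partial>M2) \<longlonglongrightarrow> a - (LINT t|M. indicator Tpa t *\<^sub>R F1 t)"
  proof -
    have "(\<lambda>k. \<integral>t. f (r k) t \<partial>M) \<longlonglongrightarrow> a" using LIMSEQ_subseq_LIMSEQ[OF a r(1)] by (simp add: o_def)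
    from tendsto_diff[OF this lim1] show ?thesis by (simp add: split)
  qed
  have bd2': "AE t in M2. \<forall>k. norm (f (r k) t) \<le> g t" using bd2 by eventually_elim blast
  have g2: "integrable M2 g" unfolding M2_def
    using integrable_mult_indicator[OF _ g, of Tna] by (simp add: integrable_restrict_space Tsp)
  have orth: "AE t in M2. convergent (\<lambda>k. f (r k) t \<bullet> q)" if "\<forall>v\<in>UNIV. q \<bullet> v = 0" for q
  proof -
    have "q = 0" using that by (metis UNIV_I inner_eq_zero_iff)
    then show ?thesis by (simp add: convergent_const)
  qed
  from nonatomic_fatou_subspace[OF M2 na2 g2 f1(2) bd2' a2 subspace_UNIV orth]
  obtain F2 where F2: "integrable M2 F2" "AE t in M2. cluster_point (\<lambda>k. f (r k) t) (F2 t)"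
    "(LINT t|M2. F2 t) = a - (LINT t|M. indicator Tpa t *\<^sub>R F1 t)" by blast
  have int2: "integrable M (\<lambda>t. indicator Tna t *\<^sub>R F2 t)"
    using F2(1) unfolding M2_def by (simp add: integrable_restrict_space Tsp)
  have AE2: "AE t in M. t \<in> Tna \<longrightarrow> cluster_point (\<lambda>k. f (r k) t) (F2 t)"
    using F2(2) unfolding M2_def by (simp add: AE_restrict_space_iff Tsp)
  define F where "F t = indicator Tpa t *\<^sub>R F1 t + indicator Tna t *\<^sub>R F2 t" for t
  have "integrable M F" unfolding F_def using int1 int2 by (rule Bochner_Integration.integrable_add)
  moreover have "(LINT t|M. F t) = a"
  proof -
    have "(LINT t|M. F t) = (LINT t|M. indicator Tpa t *\<^sub>R F1 t) + (LINT t|M. indicator Tna t *\<^sub>R F2 t)"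
      unfolding F_def using int1 int2 by (rule Bochner_Integration.integral_add)
    then show ?thesis using F2(3) unfolding M2_def by (simp add: integral_restrict_space Tsp)
  qed
  moreover have "AE t in M. cluster_point (\<lambda>k. f k t) (F t)"
    using F1 AE2 AE_space
  proof eventually_elim
    case (elim t)
    show ?case
    proof (cases "t \<in> Tpa")
      case True
      then have "F t = F1 t" using disj by (auto simp: F_def indicator_def)
      then show ?thesis unfolding cluster_point_def using True elim(1) r(1) by auto
    next
      case False
      then have "t \<in> Tna" using elim(3) un by auto
      then have "F t = F2 t" using False by (simp add: F_def)
      then show ?thesis using elim(2) \<open>t \<in> Tna\<close> cluster_point_subseq[OF r(1)] by simp
    qed
  qed
  ultimately show ?thesis by blast
qed

section \<open>Coderivatives of expected integrals\<close>

lemma regular_normal_cone_iff: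
  "zs \<in> regular_normal_cone \<Omega> z \<longleftrightarrow>
     z \<in> \<Omega> \<and> (\<forall>e>0. \<exists>d>0. \<forall>w\<in>\<Omega>. norm (w - z) < d \<longrightarrow> zs \<bullet> (w - z) \<le> e * norm (w - z))"
proof (cases "z \<in> \<Omega>")
  case True
  let ?q = "\<lambda>w. (zs \<bullet> (w - z)) / norm (w - z)"
  have "zs \<in> regular_normal_cone \<Omega> z \<longleftrightarrow> Limsup (at z within \<Omega>) (\<lambda>w. ereal (?q w)) \<le> 0"
    using True by (simp add: regular_normal_cone_def)
  also have "\<dots> \<longleftrightarrow> (\<forall>y>0. \<forall>\<^sub>F w in at z within \<Omega>. ereal (?q w) < y)"
    by (rule Limsup_le_iff)
  also have "\<dots> \<longleftrightarrow> (\<forall>e>0. \<forall>\<^sub>F w in at z within \<Omega>. ?q w \<le> e)"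
  proof (intro iffI allI impI)
    fix e :: real assume *: "\<forall>y>0. \<forall>\<^sub>F w in at z within \<Omega>. ereal (?q w) < y" and "e > 0"
    have "0 < ereal e" using \<open>e > 0\<close> by simp
    from *[rule_format, OF this] have "\<forall>\<^sub>F w in at z within \<Omega>. ereal (?q w) < ereal e" .
    then show "\<forall>\<^sub>F w in at z within \<Omega>. ?q w \<le> e" by eventually_elim simp
  next
    fix y :: ereal assume *: "\<forall>e>0. \<forall>\<^sub>F w in at z within \<Omega>. ?q w \<le> e" and "y > 0"
    then obtain e where e: "0 < ereal e" "ereal e < y" using ereal_dense2 by blast
    then have "\<forall>\<^sub>F w in at z within \<Omega>. ?q w \<le> e" using * by simp
    then show "\<forall>\<^sub>F w in at z within \<Omega>. ereal (?q w) < y"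
      by eventually_elim (use e(2) in \<open>metis ereal_less_eq(3) order_le_less_trans\<close>)
  qed
  also have "\<dots> \<longleftrightarrow> (\<forall>e>0. \<exists>d>0. \<forall>w\<in>\<Omega>. norm (w - z) < d \<longrightarrow> zs \<bullet> (w - z) \<le> e * norm (w - z))"
  proof -
    have "(w \<noteq> z \<and> dist w z < d \<longrightarrow> ?q w \<le> e) \<longleftrightarrow> (norm (w - z) < d \<longrightarrow> zs \<bullet> (w - z) \<le> e * norm (w - z))" for w d e
      by (cases "w = z") (auto simp: dist_norm pos_divide_le_eq)
    then show ?thesis unfolding eventually_at by (simp only:)
  qed
  finally show ?thesis using True by simp
qed (simp add: regular_normal_cone_def)

text \<open>Along \<open>- s *\<^sub>R g\<close> with small \<open>s\<close> the linear decrease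
  outweighs the quadratic term, whatever the size of \<open>C\<close>.\<close>

lemma first_order_zero:
  fixes g :: "'a::real_inner"
  assumes "d0 > 0" and "\<And>d. norm d \<le> d0 \<Longrightarrow> 0 \<le> g \<bullet> d + C * (d \<bullet> d)"
  shows "g = 0"
proof (rule ccontr)
  assume "g \<noteq> 0"
  define s where "s = min (d0 / norm g) (1 / (2 * (\<bar>C\<bar> + 1)))"
  have s: "s > 0" using \<open>g \<noteq> 0\<close> assms(1) by (simp add: s_def)
  have "s * norm g \<le> d0 / norm g * norm g" by (intro mult_right_mono) (auto simp: s_def)
  then have "norm (- s *\<^sub>R g) \<le> d0" using s \<open>g \<noteq> 0\<close> by simp
  from assms(2)[OF this] have "0 \<le> - s * (g \<bullet> g) + C * (s * s * (g \<bullet> g))" by simp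
  then have "0 \<le> s * (g \<bullet> g) * (C * s - 1)" by (simp add: algebra_simps)
  moreover have "s * (g \<bullet> g) > 0" using s \<open>g \<noteq> 0\<close> by simp
  ultimately have "C * s \<ge> 1" by (simp add: zero_le_mult_iff)
  moreover have "C * s \<le> (\<bar>C\<bar> + 1) * s" using s by (intro mult_right_mono) auto
  moreover have "(\<bar>C\<bar> + 1) * s \<le> (\<bar>C\<bar> + 1) * (1 / (2 * (\<bar>C\<bar> + 1)))"
    by (intro mult_left_mono) (auto simp: s_def)
  moreover have "(\<bar>C\<bar> + 1) * (1 / (2 * (\<bar>C\<bar> + 1))) = 1 / 2"
    by (simp add: field_simps)
  ultimately show False by linarith
qed

text \<open>A smooth penalty that is flat near the origin at scale \<open>a\<close> and has slope about \<open>K\<close> beyond.\<close>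

definition penalty :: "real \<Rightarrow> real \<Rightarrow> 'b::real_inner \<Rightarrow> real" where
  "penalty K a s = K * (sqrt (a\<^sup>2 + s \<bullet> s) - a)"

definition penalty_grad :: "real \<Rightarrow> real \<Rightarrow> 'b::real_inner \<Rightarrow> 'b" where
  "penalty_grad K a s = (K / sqrt (a\<^sup>2 + s \<bullet> s)) *\<^sub>R s"

lemma penalty_zero: "a \<ge> 0 \<Longrightarrow> penalty K a 0 = 0"
  by (simp add: penalty_def)

lemma penalty_lipschitz:
  fixes s :: "'b::real_inner"
  assumes "K \<ge> 0"
  shows "\<bar>penalty K a s - penalty K a s'\<bar> \<le> K * norm (s - s')"
proof -
  have n: "sqrt (a\<^sup>2 + x \<bullet> x) = norm (a, x)" for x :: 'b by (simp add: norm_Pair dot_square_norm)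
  have "\<bar>penalty K a s - penalty K a s'\<bar> = K * \<bar>norm (a, s) - norm (a, s')\<bar>"
    unfolding penalty_def n using assms by (simp add: abs_mult flip: right_diff_distrib)
  also have "\<dots> \<le> K * norm ((a, s) - (a, s'))"
    using assms by (intro mult_left_mono norm_triangle_ineq3)
  finally show ?thesis by (simp add: norm_Pair)
qed

text \<open>The factor \<open>3\<close> rounds up \<open>1 / (sqrt 2 - 1)\<close>; the critical
  ratio occurs at \<open>norm s = a\<close>, where the two regimes of the minimum meet.\<close>

lemma penalty_lower:
  fixes s :: "'b::real_inner"
  assumes "a > 0" "c \<ge> 0"
  shows "c * (norm s * min 1 (norm s / a)) \<le> penalty (3 * c) a s"
proof -
  define q where "q = norm s"
  have q0: "q \<ge> 0" by (simp add: q_def)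
  have "q * min 1 (q / a) / 3 \<le> sqrt (a\<^sup>2 + q\<^sup>2) - a"
  proof (cases "q \<ge> a")
    case True
    then have m: "min 1 (q / a) = 1" using assms(1) by simp
    have "a * q \<le> q * q" using True q0 by (intro mult_right_mono) auto
    moreover have "(a + q / 3)\<^sup>2 = a\<^sup>2 + 2 * (a * q) / 3 + q * q / 9" by (simp add: power2_eq_square algebra_simps)
    moreover have "q * q \<ge> 0" "q\<^sup>2 = q * q" by (simp_all add: power2_eq_square)
    ultimately have "(a + q / 3)\<^sup>2 \<le> a\<^sup>2 + q\<^sup>2" by linarith
    then have "a + q / 3 \<le> sqrt (a\<^sup>2 + q\<^sup>2)" by (rule real_le_rsqrt)
    then show ?thesis unfolding m by simp
  next
    case False
    then have m: "min 1 (q / a) = q / a" using assms(1) by simp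
    have "(q * (q / a))\<^sup>2 \<le> q\<^sup>2"
    proof (rule power_mono)
      have "q * (q / a) \<le> q * 1" using False assms(1) q0 by (intro mult_left_mono) auto
      then show "q * (q / a) \<le> q" by simp
    qed (use q0 assms(1) in auto)
    moreover have "(a + q * (q / a) / 3)\<^sup>2 = a\<^sup>2 + 2 * q\<^sup>2 / 3 + (q * (q / a))\<^sup>2 / 9"
      using assms(1) by (simp add: power2_eq_square field_simps)
    ultimately have "(a + q * (q / a) / 3)\<^sup>2 \<le> a\<^sup>2 + q\<^sup>2" using zero_le_power2[of q] by linarith
    then have "a + q * (q / a) / 3 \<le> sqrt (a\<^sup>2 + q\<^sup>2)" by (rule real_le_rsqrt)
    then show ?thesis unfolding m by simp
  qed
  then have "3 * c * (q * min 1 (q / a) / 3) \<le> 3 * c * (sqrt (a\<^sup>2 + q\<^sup>2) - a)"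
    using assms(2) by (intro mult_left_mono) auto
  then show ?thesis by (simp add: penalty_def q_def dot_square_norm)
qed

text \<open>The descent inequality for a gradient with Lipschitz modulus \<open>K / a\<close>,
  obtained from the tangent estimate of the concave square root. It provides the quadratic remainder
  from which regular normals are recognised.\<close>

lemma penalty_descent:
  fixes s :: "'b::real_inner"
  assumes "a > 0" "K \<ge> 0"
  shows "penalty K a s' - penalty K a s
    \<le> penalty_grad K a s \<bullet> (s' - s) + K / (2 * a) * ((s' - s) \<bullet> (s' - s))"
proof -
  define A where "A = a\<^sup>2 + s \<bullet> s"
  define B where "B = a\<^sup>2 + s' \<bullet> s'"
  have A: "A > 0" using assms(1) unfolding A_def by (simp add: add_pos_nonneg)
  have B: "B \<ge> 0" unfolding B_def by simp
  have sA: "sqrt A > 0" using A by simp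
  have aA: "a \<le> sqrt A" unfolding A_def by (rule real_le_rsqrt) simp
  have "0 \<le> (sqrt B - sqrt A)\<^sup>2" by simp
  also have "\<dots> = B + A - 2 * sqrt A * sqrt B" using A B by (simp add: power2_diff)
  finally have "2 * sqrt A * sqrt B \<le> B + A" by simp
  moreover have "2 * sqrt A * (sqrt B - sqrt A) = 2 * sqrt A * sqrt B - 2 * (sqrt A * sqrt A)" by (simp add: algebra_simps)
  moreover have "sqrt A * sqrt A = A" using A by simp
  ultimately have "2 * sqrt A * (sqrt B - sqrt A) \<le> B - A" by linarith
  then have "sqrt B - sqrt A \<le> (B - A) / (2 * sqrt A)" using sA by (simp add: pos_le_divide_eq mult.commute)
  also have "B - A = 2 * (s \<bullet> (s' - s)) + (s' - s) \<bullet> (s' - s)"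
    by (simp add: A_def B_def inner_diff_left inner_diff_right inner_commute)
  also have "(2 * (s \<bullet> (s' - s)) + (s' - s) \<bullet> (s' - s)) / (2 * sqrt A)
      = (s \<bullet> (s' - s)) / sqrt A + ((s' - s) \<bullet> (s' - s)) / (2 * sqrt A)"
    using sA by (simp add: field_simps)
  also have "((s' - s) \<bullet> (s' - s)) / (2 * sqrt A) \<le> ((s' - s) \<bullet> (s' - s)) / (2 * a)"
    using aA sA assms(1) by (intro divide_left_mono) (auto simp del: real_sqrt_gt_0_iff)
  finally have "K * (sqrt B - sqrt A) \<le> K * ((s \<bullet> (s' - s)) / sqrt A + ((s' - s) \<bullet> (s' - s)) / (2 * a))"
    using assms(2) by (intro mult_left_mono) auto
  moreover have "penalty K a s' - penalty K a s = K * (sqrt B - sqrt A)"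
    unfolding penalty_def A_def B_def by (simp add: algebra_simps)
  moreover have "penalty_grad K a s \<bullet> (s' - s) + K / (2 * a) * ((s' - s) \<bullet> (s' - s))
      = K * ((s \<bullet> (s' - s)) / sqrt A + ((s' - s) \<bullet> (s' - s)) / (2 * a))"
    unfolding penalty_grad_def A_def by (simp add: distrib_left)
  ultimately show ?thesis by simp
qed

lemma penalty_grad_norm:
  fixes s :: "'b::real_inner"
  assumes "a > 0" "K \<ge> 0"
  shows "norm (penalty_grad K a s) \<le> K * min 1 (norm s / a)"
proof -
  define A where "A = sqrt (a\<^sup>2 + s \<bullet> s)"
  have 1: "a \<le> A" unfolding A_def by (rule real_le_rsqrt) simp
  have 2: "norm s \<le> A" unfolding A_def by (rule real_le_rsqrt) (simp add: dot_square_norm)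
  have "norm s / A \<le> norm s / a" using 1 assms(1) by (intro divide_left_mono) auto
  moreover have "norm s / A \<le> 1" using 1 2 assms(1) by simp
  ultimately have "K * (norm s / A) \<le> K * min 1 (norm s / a)" using assms(2) by (intro mult_left_mono) auto
  moreover have "norm (penalty_grad K a s) = K * (norm s / A)"
    using assms 1 unfolding penalty_grad_def A_def[symmetric] by simp
  ultimately show ?thesis by simp
qed

text \<open>The selection \<open>w2\<close>, which agrees with \<open>w\<close> where \<open>w\<close> is \<open>a\<close>-close to \<open>v\<close>, stays close enough to \<open>v\<close>
  for the local regular normal inequality; on the rest the penalty outweighs the loss.\<close>

lemma penalized_lower_bound:
  fixes v w w1 w2 ys :: "'b::real_inner"
  assumes "e > 0" "d > 0" and a: "a = d / e" and "l \<ge> 0"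
    and w1: "norm (w1 - v) \<le> l * d"
    and w2: "w2 = (if norm (w - v) < a then w else w1)"
  shows "ys \<bullet> (w2 - v) + e * norm (w2 - v) + norm (w - v) * min 1 (norm (w - v) / a) / 2
      - d * (e / 2 + max 0 (norm ys * l - 1 / (2 * e)) + e * l)
    \<le> ys \<bullet> (w - v) + penalty (3 * (norm ys + 1)) a (w - v)"
proof -
  define q where "q = norm (w - v)"
  define Y where "Y = norm ys"
  have a0: "a > 0" using assms by simp
  have q0: "q \<ge> 0" "Y \<ge> 0" by (auto simp: q_def Y_def)
  have P: "(Y + 1) * (q * min 1 (q / a)) \<le> penalty (3 * (norm ys + 1)) a (w - v)"
    unfolding q_def Y_def by (rule penalty_lower[OF a0]) simp
  have md: "d * max 0 (Y * l - 1 / (2 * e)) \<ge> 0" "d * (e * l) \<ge> 0" "d * (e / 2) \<ge> 0" using assms by auto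
  have dist: "d * (e / 2 + max 0 (Y * l - 1 / (2 * e)) + e * l)
      = d * (e / 2) + d * max 0 (Y * l - 1 / (2 * e)) + d * (e * l)" by (simp add: algebra_simps)
  show ?thesis
  proof (cases "q < a")
    case True
    then have m: "min 1 (q / a) = q / a" and w2w: "w2 = w" using a0 w2 by (auto simp: q_def)
    \<comment> \<open>A weighted arithmetic-geometric inequality: half of the quadratic penalty
      \<open>q * (q / a)\<close> absorbs \<open>e * q\<close>, up to the error
      \<open>d * (e / 2)\<close>.\<close>
    have "0 \<le> (q - e * a)\<^sup>2" by simp
    then have "2 * (e * a) * q \<le> q\<^sup>2 + (e * a)\<^sup>2" by (simp add: power2_diff algebra_simps)
    then have "e * q \<le> q * (q / a) / 2 + (e * a) * (e / 2)" using a0 by (simp add: field_simps power2_eq_square)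
    moreover have "e * a = d" using a assms(1) by simp
    ultimately have "e * q \<le> q * (q / a) / 2 + d * (e / 2)" by (simp only:)
    moreover have "1 * (q * (q / a)) \<le> (Y + 1) * (q * (q / a))" using q0 a0 by (intro mult_right_mono) auto
    ultimately show ?thesis using P md unfolding w2w q_def[symmetric] m Y_def[symmetric] dist by linarith
  next
    case False
    then have m: "min 1 (q / a) = 1" and w2w: "w2 = w1" using a0 w2 by (auto simp: q_def)
    \<comment> \<open>After beating the linear form the penalty leaves a surplus \<open>q\<close>.
      One half is retained; the other is at least \<open>a / 2 = d / (2 * e)\<close>, which is the
      origin of the threshold \<open>1 / (2 * e)\<close>.\<close>
    have "- (Y * q) \<le> ys \<bullet> (w - v)"
      using Cauchy_Schwarz_ineq2[of ys "w - v"] by (simp add: q_def Y_def)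
    moreover have "ys \<bullet> (w1 - v) \<le> Y * norm (w1 - v)"
      using norm_cauchy_schwarz[of ys "w1 - v"] by (simp add: Y_def)
    moreover have "Y * norm (w1 - v) \<le> Y * (l * d)" using w1 q0 by (intro mult_left_mono) auto
    moreover have "e * norm (w1 - v) \<le> e * (l * d)" using w1 assms(1) by (intro mult_left_mono) auto
    moreover have "d * (Y * l - 1 / (2 * e)) \<le> d * max 0 (Y * l - 1 / (2 * e))" using assms(2) by (intro mult_left_mono) auto
    moreover have "d * (Y * l - 1 / (2 * e)) = Y * (l * d) - a / 2" unfolding a by (simp add: algebra_simps)
    moreover have "e * (l * d) = d * (e * l)" by simp
    moreover have "(Y + 1) * (q * 1) = Y * q + q" by (simp add: algebra_simps)
    ultimately show ?thesis using P md False unfolding w2w q_def[symmetric] m Y_def[symmetric] dist by linarith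
  qed
qed

lemma regular_normal_coneI_quadratic:
  assumes "z \<in> \<Omega>" "r > 0" "C > 0"
    and "\<And>w. w \<in> \<Omega> \<Longrightarrow> norm (w - z) < r \<Longrightarrow> zs \<bullet> (w - z) \<le> C * (norm (w - z))\<^sup>2"
  shows "zs \<in> regular_normal_cone \<Omega> z"
  unfolding regular_normal_cone_iff
proof (intro conjI allI impI)
  fix e :: real assume "e > 0"
  show "\<exists>d>0. \<forall>w\<in>\<Omega>. norm (w - z) < d \<longrightarrow> zs \<bullet> (w - z) \<le> e * norm (w - z)"
  proof (intro exI conjI ballI impI)
    show "min r (e / C) > 0" using assms \<open>e > 0\<close> by simp
    fix w assume w: "w \<in> \<Omega>" "norm (w - z) < min r (e / C)"
    then have "C * norm (w - z) \<le> e" using assms(3) by (simp add: pos_less_divide_eq mult.commute)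
    then have "C * norm (w - z) * norm (w - z) \<le> e * norm (w - z)" by (intro mult_right_mono) auto
    then show "zs \<bullet> (w - z) \<le> e * norm (w - z)"
      using assms(4)[OF w(1)] w(2) by (simp add: power2_eq_square)
  qed
qed (rule assms(1))

text \<open>The conditions on the values hold off a null set that does not depend on
  \<open>x\<close>, since the pointwise arguments vary \<open>x\<close> at a fixed
  \<open>t\<close>.\<close>

locale lipschitz_integrand =
  fixes M :: "'t measure" and \<Phi> :: "'t \<Rightarrow> 'a::euclidean_space \<Rightarrow> 'b::euclidean_space set"
    and xbar :: 'a and \<eta> :: real and l \<kappa> :: "'t \<Rightarrow> real"
  assumes finite_M: "finite_measure M" and complete_M: "complete_measure M" and \<eta>_pos: "\<eta> > 0"
    and graph: "{(t, x, y). t \<in> space M \<and> y \<in> \<Phi> t x} \<in> sets (M \<Otimes>\<^sub>M (borel :: ('a \<times> 'b) measure))"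
    and l_int: "integrable M l" and l_nonneg: "\<And>t. t \<in> space M \<Longrightarrow> 0 \<le> l t"
    and \<kappa>_int: "integrable M \<kappa>"
    and closed_graph: "AE t in M. closed (gph (\<Phi> t))"
    and bounded_values: "AE t in M. \<forall>x\<in>cball xbar \<eta>. \<Phi> t x \<noteq> {} \<and> \<Phi> t x \<subseteq> cball 0 (\<kappa> t)"
    and lipschitz_values: "AE t in M. \<forall>x\<in>cball xbar \<eta>. \<forall>x'\<in>cball xbar \<eta>. \<forall>y\<in>\<Phi> t x.
      \<exists>y'\<in>\<Phi> t x'. norm (y' - y) \<le> l t * norm (x - x')"
begin

definition selection :: "('t \<Rightarrow> 'a) \<Rightarrow> ('t \<Rightarrow> 'b) \<Rightarrow> bool" where
  "selection u w \<longleftrightarrow> u \<in> borel_measurable M \<and> w \<in> borel_measurable M \<and>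
     (AE t in M. u t \<in> cball xbar \<eta> \<and> w t \<in> \<Phi> t (u t))"

lemma selectionD:
  assumes "selection u w"
  shows "u \<in> borel_measurable M" "w \<in> borel_measurable M" "AE t in M. u t \<in> cball xbar \<eta> \<and> w t \<in> \<Phi> t (u t)"
  using assms by (simp_all add: selection_def)

lemma selection_norm_le:
  assumes "selection u w"
  shows "AE t in M. norm (w t) \<le> \<kappa> t"
  using selectionD(3)[OF assms] bounded_values
proof eventually_elim
  case (elim t)
  then have "w t \<in> cball 0 (\<kappa> t)" by blast
  then show ?case by simp
qed

lemma selection_integrable:
  assumes "selection u w"
  shows "integrable M w"
  using selection_norm_le[OF assms] selectionD(2)[OF assms]
  by (intro Bochner_Integration.integrable_bound[OF \<kappa>_int]) (auto elim!: eventually_mono intro: order_trans)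

lemma selection_expected_integral:
  assumes "selection (\<lambda>_. x) w"
  shows "(LINT t|M. w t) \<in> expected_integral M \<Phi> x"
  unfolding expected_integral_def aumann_integral_def
  using selection_integrable[OF assms] selectionD(3)[OF assms]
  by (intro CollectI exI[of _ w] conjI refl) (auto elim!: eventually_mono)

text \<open>Used with two constraint sets: a singleton gives the best selection at a prescribed
  point, the whole ball lets the base point vary with \<open>t\<close>.\<close>

lemma minimizing_selection:
  fixes c :: "'t \<times> 'a \<times> 'b \<Rightarrow> real"
  assumes C: "closed C" "C \<noteq> {}" "C \<subseteq> cball xbar \<eta>"
    and c: "c \<in> borel_measurable (M \<Otimes>\<^sub>M borel)" "\<And>t. continuous_on UNIV (\<lambda>p. c (t, p))"
  shows "\<exists>u w. selection u w \<and> (AE t in M. u t \<in> C \<and> (\<forall>u'\<in>C. \<forall>w'\<in>\<Phi> t u'. c (t, u t, w t) \<le> c (t, u', w')))"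
proof -
  have C': "closed (C \<times> (UNIV :: 'b set))" using C(1) by (intro closed_Times) auto
  define G where "G = {(t, x, y). t \<in> space M \<and> y \<in> \<Phi> t x} \<inter> space M \<times> (C \<times> UNIV)"
  have G: "G \<in> sets (M \<Otimes>\<^sub>M borel)" unfolding G_def using C' by (intro sets.Int graph pair_measureI) auto
  have Gt: "{p. (t, p) \<in> G} = gph (\<Phi> t) \<inter> C \<times> UNIV" if "t \<in> space M" for t
    using that by (auto simp: G_def gph_def)
  have 1: "AE t in M. compact {p. (t, p) \<in> G} \<and> {p. (t, p) \<in> G} \<noteq> {}"
    using closed_graph bounded_values AE_space
  proof eventually_elim
    case (elim t)
    have "gph (\<Phi> t) \<inter> C \<times> UNIV \<subseteq> cball xbar \<eta> \<times> cball 0 (\<kappa> t)"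
      using elim(2) C(3) by (fastforce simp: gph_def)
    then have "bounded (gph (\<Phi> t) \<inter> C \<times> UNIV)" by (rule bounded_subset[rotated]) (intro bounded_Times bounded_cball)
    moreover have "closed (gph (\<Phi> t) \<inter> C \<times> UNIV)" using elim(1) C' by (rule closed_Int)
    ultimately have "compact (gph (\<Phi> t) \<inter> C \<times> UNIV)" by (simp add: compact_eq_bounded_closed)
    moreover obtain x where "x \<in> C" using C(2) by blast
    then obtain y where "y \<in> \<Phi> t x" using elim(2) C(3) by blast
    then have "(x, y) \<in> gph (\<Phi> t) \<inter> C \<times> UNIV" using \<open>x \<in> C\<close> by (simp add: gph_def)
    ultimately show ?case unfolding Gt[OF elim(3)] by blast
  qed
  have 2: "AE t in M. continuous_on {p. (t, p) \<in> G} (\<lambda>p. c (t, p))"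
    by (intro AE_I2 continuous_on_subset[OF c(2)]) auto
  obtain f where f[measurable]: "f \<in> borel_measurable M"
    and fG: "AE t in M. (t, f t) \<in> G \<and> (\<forall>p. (t, p) \<in> G \<longrightarrow> c (t, f t) \<le> c (t, p))"
    by (rule measurable_argmin_AE[OF finite_M complete_M G 1 c(1) 2])
  define u where "u t = fst (f t)" for t
  define w where "w t = snd (f t)" for t
  have fuw: "f t = (u t, w t)" for t by (simp add: u_def w_def)
  have [measurable]: "u \<in> borel_measurable M" "w \<in> borel_measurable M"
    unfolding u_def w_def borel_prod[symmetric]
    using f by (auto simp flip: borel_prod intro!: measurable_compose[OF _ measurable_fst] measurable_compose[OF _ measurable_snd])
  have *: "AE t in M. u t \<in> C \<and> w t \<in> \<Phi> t (u t) \<and> (\<forall>u'\<in>C. \<forall>w'\<in>\<Phi> t u'. c (t, u t, w t) \<le> c (t, u', w'))"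
    using fG by eventually_elim (auto simp: fuw G_def)
  have "selection u w"
    unfolding selection_def using * C(3) by (auto elim!: eventually_mono)
  moreover have "AE t in M. u t \<in> C \<and> (\<forall>u'\<in>C. \<forall>w'\<in>\<Phi> t u'. c (t, u t, w t) \<le> c (t, u', w'))"
    using * by eventually_elim simp
  ultimately show ?thesis by blast
qed

text \<open>The Lipschitz property provides a suitable point for each \<open>t\<close>; minimising
  the distance to \<open>w t\<close> chooses such points measurably.\<close>

lemma near_selection:
  assumes uw: "selection u w" and x': "x' \<in> cball xbar \<eta>"
  shows "\<exists>w'. selection (\<lambda>_. x') w' \<and> (AE t in M. norm (w' t - w t) \<le> l t * norm (u t - x'))"
proof -
  note [measurable] = selectionD(1,2)[OF uw]
  have "(\<lambda>(t, x, y). norm (y - w t)) \<in> borel_measurable (M \<Otimes>\<^sub>M ((borel :: 'a measure) \<Otimes>\<^sub>M (borel :: 'b measure)))"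
    by measurable
  then have c: "(\<lambda>(t, x, y). norm (y - w t)) \<in> borel_measurable (M \<Otimes>\<^sub>M (borel :: ('a \<times> 'b) measure))"
    by (simp add: borel_prod)
  have cc: "continuous_on UNIV (\<lambda>p. case (t, p) of (t, x, y) \<Rightarrow> norm (y - w t))" for t
    by (auto simp: case_prod_beta intro!: continuous_intros)
  have C: "closed {x'}" "{x'} \<noteq> {}" "{x'} \<subseteq> cball xbar \<eta>" using x' by auto
  from minimizing_selection[OF C c cc] obtain u' w' where u'w': "selection u' w'" and
    min: "AE t in M. u' t \<in> {x'} \<and> (\<forall>z\<in>{x'}. \<forall>y\<in>\<Phi> t z. norm (w' t - w t) \<le> norm (y - w t))" by auto
  have "AE t in M. w' t \<in> \<Phi> t x' \<and> norm (w' t - w t) \<le> l t * norm (u t - x')"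
    using min lipschitz_values selectionD(3)[OF u'w'] selectionD(3)[OF uw]
  proof eventually_elim
    case (elim t)
    obtain y' where y': "y' \<in> \<Phi> t x'" "norm (y' - w t) \<le> l t * norm (u t - x')"
      using elim(2,4) x' by blast
    have "norm (w' t - w t) \<le> norm (y' - w t)" using elim(1) y'(1) by simp
    then show ?case using y'(2) elim(1,3) by auto
  qed
  then show ?thesis unfolding selection_def using selectionD(2)[OF u'w'] x'
    by (intro exI[of _ w']) (auto elim!: eventually_mono)
qed

end

section \<open>Decoupling a regular normal of the integral into pointwise normals\<close>

context lipschitz_integrand
begin

text \<open>Multiplied by \<open>d\<close>, this is the integrated error of
  \<open>penalized_lower_bound\<close> together with one further \<open>e\<close>, which pays for
  the term \<open>e * norm (x' - x)\<close> in the normal inequality.\<close>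

definition defect :: "real \<Rightarrow> real \<Rightarrow> real" where
  "defect Y e = e * (1 + measure M (space M) / 2 + (LINT t|M. l t)) + (LINT t|M. max 0 (Y * l t - 1 / (2 * e)))"

text \<open>The number \<open>4 * norm ys + 3\<close> is the Lipschitz constant of the linear form
  plus the penalty, that is \<open>norm ys\<close> plus the slope \<open>3 * (norm ys + 1)\<close>;
  the \<open>2\<close> before it comes from differentiating the squared distance. The
  \<open>6\<close> is the derivative of the quadratic term that keeps the minimiser in
  \<open>x'\<close> interior.\<close>

definition decoupled_normals ::
  "'a \<Rightarrow> 'a \<Rightarrow> 'b \<Rightarrow> real \<Rightarrow> ('t \<Rightarrow> 'a) \<Rightarrow> ('t \<Rightarrow> 'b) \<Rightarrow> ('t \<Rightarrow> 'a) \<Rightarrow> ('t \<Rightarrow> 'b) \<Rightarrow> bool" where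
  "decoupled_normals x xs ys e u w us ws \<longleftrightarrow>
    selection u w \<and> us \<in> borel_measurable M \<and> integrable M (\<lambda>t. ws t - ys) \<and>
    (AE t in M. norm (u t - x) \<le> e * (1 + l t)) \<and>
    (AE t in M. u t \<in> ball xbar \<eta> \<longrightarrow> (us t, - ws t) \<in> regular_normal_cone (gph (\<Phi> t)) (u t, w t)) \<and>
    (AE t in M. norm (us t) \<le> 2 * (4 * norm ys + 3) * l t) \<and>
    norm ((LINT t|M. us t) - xs) \<le> 6 * defect (norm ys) e \<and>
    (LINT t|M. norm (ws t - ys)) \<le>
      3 * (norm ys + 1) * (e * measure M (space M) + 4 * defect (norm ys) e + e\<^sup>2)"

text \<open>Keeping the optimal selections fixed while \<open>x'\<close> varies bounds the value
  function from above by an exact quadratic polynomial that touches it at the minimiser.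
  Stationarity thus follows without differentiating the value function.\<close>

lemma regular_normal_decoupling:
  assumes x: "x \<in> ball xbar \<eta>" and v: "selection (\<lambda>_. x) v" and e: "e > 0"
    and rn: "(xs, - ys) \<in> regular_normal_cone (gph (expected_integral M \<Phi>)) (x, \<integral>t. v t \<partial>M)"
  shows "\<exists>u w us ws. decoupled_normals x xs ys e u w us ws"
proof -
  interpret finite_measure M by (rule finite_M)
  define Y where "Y = norm ys"
  define K where "K = 3 * (Y + 1)"
  define K' where "K' = Y + K"
  define m where "m = measure M (space M)"
  define L where "L = (LINT t|M. l t)"
  define om where "om = defect Y e"
  have Y0: "Y \<ge> 0" and K3: "K \<ge> 3" and K'3: "K' \<ge> 3" and K0: "K \<ge> 0" by (auto simp: Y_def K_def K'_def)
  have m0: "m \<ge> 0" by (simp add: m_def)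
  have L0: "L \<ge> 0" unfolding L_def by (intro integral_nonneg_AE AE_I2 l_nonneg)
  have om_e: "om \<ge> e"
  proof -
    have "e * 1 \<le> e * (1 + m / 2 + L)" using e m0 L0 by (intro mult_left_mono) auto
    moreover have "0 \<le> (LINT t|M. max 0 (Y * l t - 1 / (2 * e)))" by (intro integral_nonneg_AE) auto
    ultimately show ?thesis unfolding om_def defect_def m_def[symmetric] L_def[symmetric] by linarith
  qed
  note [measurable] = borel_measurable_integrable[OF l_int] selectionD(2)[OF v]
  have vi: "integrable M v" by (rule selection_integrable[OF v])
  define y where "y = (LINT t|M. v t)"
  obtain d1 where d1: "d1 > 0" and rn1: "\<And>p. p \<in> gph (expected_integral M \<Phi>) \<Longrightarrow> norm (p - (x, y)) < d1 \<Longrightarrow>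
      (xs, - ys) \<bullet> (p - (x, y)) \<le> e * norm (p - (x, y))"
    using rn e unfolding regular_normal_cone_iff y_def by blast
  have R: "xs \<bullet> (x' - x) - ys \<bullet> ((LINT t|M. w' t) - y) \<le> e * (norm (x' - x) + norm ((LINT t|M. w' t) - y))"
    if w': "selection (\<lambda>_. x') w'" and lt: "norm (x' - x) + norm ((LINT t|M. w' t) - y) < d1" for x' w'
  proof -
    have "(x', \<integral>t. w' t \<partial>M) \<in> gph (expected_integral M \<Phi>)"
      using selection_expected_integral[OF w'] by (simp add: gph_def)
    moreover have le: "norm ((x', \<integral>t. w' t \<partial>M) - (x, y)) \<le> norm (x' - x) + norm ((LINT t|M. w' t) - y)"
      by (simp add: norm_Pair_le)
    ultimately have "(xs, - ys) \<bullet> ((x', \<integral>t. w' t \<partial>M) - (x, y)) \<le> e * norm ((x', \<integral>t. w' t \<partial>M) - (x, y))"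
      using lt by (intro rn1) auto
    also have "\<dots> \<le> e * (norm (x' - x) + norm ((LINT t|M. w' t) - y))"
      using e le by (intro mult_left_mono) auto
    finally show ?thesis by (simp add: inner_diff_right)
  qed
  \<comment> \<open>\<open>D * d\<close> bounds how far the competitors used below lie from
    \<open>(x, y)\<close>: \<open>d\<close> in the point \<open>x'\<close>, and
    \<open>a * m + L * d\<close> with \<open>a = d / e\<close> in the integral.\<close>
  define D where "D = 1 + m / e + L"
  have D0: "D > 0" using e m0 L0 by (simp add: D_def add_pos_nonneg)
  \<comment> \<open>The three bounds keep \<open>x'\<close> in the ball where the locale assumptions
    apply, allow \<open>d \<le> e\<close> in the estimate of \<open>u\<close>, and stay within the
    radius \<open>d1\<close> of the local inequality.\<close>
  define d where "d = min (min ((\<eta> - norm (x - xbar)) / 2) e) (d1 / (2 * D))"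
  have xn: "norm (x - xbar) < \<eta>" using x by (simp add: dist_norm norm_minus_commute)
  have d0: "d > 0" using xn e d1 D0 by (simp add: d_def)
  have de: "d \<le> e" and d\<eta>: "d \<le> (\<eta> - norm (x - xbar)) / 2" and dD: "d \<le> d1 / (2 * D)"
    unfolding d_def by linarith+
  have "D * d \<le> D * (d1 / (2 * D))" using D0 dD by (intro mult_left_mono) auto
  then have "D * d < d1" using D0 d1 by simp
  define a where "a = d / e"
  have a0: "a > 0" and ae: "a * e = d" using d0 e by (auto simp: a_def)
  have small: "d + (a * m + L * d) < d1" using \<open>D * d < d1\<close> by (simp add: D_def a_def algebra_simps)
  have cb: "x' \<in> cball xbar \<eta>" if "norm (x' - x) \<le> d" for x'
  proof -
    have "norm (x' - xbar) \<le> norm (x' - x) + norm (x - xbar)" using norm_triangle_ineq[of "x' - x" "x - xbar"] by simp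
    also have "\<dots> \<le> \<eta>" using that d\<eta> xn by (simp add: field_simps)
    finally show ?thesis by (simp add: dist_norm norm_minus_commute)
  qed
  have diam: "norm (z - z') \<le> 2 * \<eta>" if "z \<in> cball xbar \<eta>" "z' \<in> cball xbar \<eta>" for z z'
    using dist_triangle3[of z z' xbar] that by (simp add: dist_norm)
  have xcb: "x \<in> cball xbar \<eta>" using cb[of x] d0 by simp
  define pen :: "'b \<Rightarrow> real" where "pen s = penalty K a s" for s
  have pen_cont: "continuous_on UNIV pen" unfolding pen_def penalty_def by (intro continuous_intros)
  then have [measurable]: "pen \<in> borel_measurable borel" by (rule borel_measurable_continuous_onI)
  have pen0: "pen 0 = 0" using a0 by (simp add: pen_def penalty_zero)
  have pen_lip: "\<bar>pen s - pen s'\<bar> \<le> K * norm (s - s')" for s s' unfolding pen_def by (rule penalty_lipschitz[OF K0])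
  have pen_int: "integrable M (\<lambda>t. ys \<bullet> (w t - v t) + pen (w t - v t))" if w: "integrable M w" for w
  proof -
    note [measurable] = borel_measurable_integrable[OF w]
    have "integrable M (\<lambda>t. pen (w t - v t))"
    proof (rule Bochner_Integration.integrable_bound)
      show "integrable M (\<lambda>t. K * norm (w t - v t))" using w vi by auto
      show "AE t in M. norm (pen (w t - v t)) \<le> norm (K * norm (w t - v t))"
        using pen_lip[of _ 0] pen0 K0 by (auto simp: abs_mult)
    qed measurable
    then show ?thesis using w vi by (intro Bochner_Integration.integrable_add) auto
  qed
  define q where "q s = norm s * min 1 (norm s / a)" for s :: 'b
  have q0: "0 \<le> q s" "q s \<le> norm s" for s
  proof -
    have m: "0 \<le> min 1 (norm s / a)" "min 1 (norm s / a) \<le> 1" using a0 by auto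
    show "0 \<le> q s" unfolding q_def using m by simp
    show "q s \<le> norm s" unfolding q_def using mult_left_mono[OF m(2) norm_ge_zero[of s]] by simp
  qed
  have [measurable]: "q \<in> borel_measurable borel" unfolding q_def by measurable
  have q_int: "integrable M (\<lambda>t. q (w t - v t))" if w: "integrable M w" for w
  proof (rule Bochner_Integration.integrable_bound)
    note [measurable] = borel_measurable_integrable[OF w]
    show "integrable M (\<lambda>t. norm (w t - v t))" using w vi by auto
    show "(\<lambda>t. q (w t - v t)) \<in> borel_measurable M" by measurable
  qed (use q0 in auto)
  \<comment> \<open>This holds for every selection at \<open>x'\<close>, however far from
    \<open>v\<close>. The retained half of \<open>q\<close> is the coercivity that later controls
    the gradient of the penalty.\<close>
  have LB: "(LINT t|M. q (w' t - v t)) / 2 - d * om \<le> (LINT t|M. ys \<bullet> (w' t - v t) + pen (w' t - v t)) - xs \<bullet> (x' - x)"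
    if x': "norm (x' - x) \<le> d" and w': "selection (\<lambda>_. x') w'" for x' w'
  proof -
    obtain w1 where w1: "selection (\<lambda>_. x') w1" and w1v: "AE t in M. norm (w1 t - v t) \<le> l t * norm (x - x')"
      using near_selection[OF v cb[OF x']] by blast
    note [measurable] = selectionD(2)[OF w'] selectionD(2)[OF w1]
    have w'i: "integrable M w'" by (rule selection_integrable[OF w'])
    define w2 where "w2 t = (if norm (w' t - v t) < a then w' t else w1 t)" for t
    have w2: "selection (\<lambda>_. x') w2"
      unfolding selection_def
    proof (intro conjI)
      show "w2 \<in> borel_measurable M" unfolding w2_def by measurable
      show "AE t in M. x' \<in> cball xbar \<eta> \<and> w2 t \<in> \<Phi> t x'"
        using selectionD(3)[OF w'] selectionD(3)[OF w1] by eventually_elim (simp add: w2_def)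
    qed simp
    have w2i: "integrable M w2" by (rule selection_integrable[OF w2])
    have n2i: "integrable M (\<lambda>t. norm (w2 t - v t))" using w2i vi by auto
    have w1d: "AE t in M. norm (w1 t - v t) \<le> l t * d"
      using w1v AE_space
    proof eventually_elim
      case (elim t)
      have "l t * norm (x - x') \<le> l t * d"
        using x' l_nonneg[OF elim(2)] by (intro mult_left_mono) (auto simp: norm_minus_commute)
      then show ?case using elim(1) by linarith
    qed
    define err where "err t = e / 2 + max 0 (Y * l t - 1 / (2 * e)) + e * l t" for t
    have maxi: "integrable M (\<lambda>t. max 0 (Y * l t - 1 / (2 * e)))" using l_int by auto
    have erri: "integrable M err" unfolding err_def using maxi l_int by auto
    have errI: "(LINT t|M. err t) = om - e"
    proof -
      have "(LINT t|M. err t) = e / 2 * m + (LINT t|M. max 0 (Y * l t - 1 / (2 * e))) + e * L"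
        unfolding err_def m_def L_def using maxi l_int by simp
      then show ?thesis unfolding om_def defect_def m_def[symmetric] L_def[symmetric] by (simp add: algebra_simps)
    qed
    have pw: "AE t in M. ys \<bullet> (w2 t - v t) + e * norm (w2 t - v t) + q (w' t - v t) / 2 - d * err t
      \<le> ys \<bullet> (w' t - v t) + pen (w' t - v t)"
      using w1d AE_space
    proof eventually_elim
      case (elim t)
      from penalized_lower_bound[OF e d0 a_def l_nonneg[OF elim(2)] elim(1) w2_def[of t], of ys]
      show ?case unfolding pen_def K_def Y_def err_def q_def .
    qed
    have w2vi: "integrable M (\<lambda>t. ys \<bullet> (w2 t - v t))" using w2i vi by auto
    have i1: "integrable M (\<lambda>t. ys \<bullet> (w2 t - v t) + e * norm (w2 t - v t) + q (w' t - v t) / 2 - d * err t)"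
      using w2vi n2i q_int[OF w'i] erri by auto
    have "(LINT t|M. ys \<bullet> (w2 t - v t) + e * norm (w2 t - v t) + q (w' t - v t) / 2 - d * err t)
      \<le> (LINT t|M. ys \<bullet> (w' t - v t) + pen (w' t - v t))"
      by (rule integral_mono_AE[OF i1 pen_int[OF w'i] pw])
    moreover have "(LINT t|M. ys \<bullet> (w2 t - v t) + e * norm (w2 t - v t) + q (w' t - v t) / 2 - d * err t)
       = ys \<bullet> ((LINT t|M. w2 t) - y) + e * (LINT t|M. norm (w2 t - v t)) + (LINT t|M. q (w' t - v t)) / 2 - d * (om - e)"
    proof -
      have "(LINT t|M. ys \<bullet> (w2 t - v t)) = ys \<bullet> ((LINT t|M. w2 t) - y)"
        using w2i vi by (simp add: y_def)
      then show ?thesis using w2vi n2i q_int[OF w'i] erri errI by simp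
    qed
    moreover have nle: "norm ((LINT t|M. w2 t) - y) \<le> (LINT t|M. norm (w2 t - v t))"
    proof -
      have "(LINT t|M. w2 t) - y = (LINT t|M. w2 t - v t)" using w2i vi by (simp add: y_def)
      then show ?thesis by simp
    qed
    moreover have "(LINT t|M. norm (w2 t - v t)) \<le> a * m + L * d"
    proof -
      have "(LINT t|M. norm (w2 t - v t)) \<le> (LINT t|M. a + l t * d)"
      proof (rule integral_mono_AE[OF n2i])
        show "integrable M (\<lambda>t. a + l t * d)" using l_int by auto
        show "AE t in M. norm (w2 t - v t) \<le> a + l t * d"
          using w1d AE_space
        proof eventually_elim
          case (elim t)
          have "0 \<le> l t * d" using l_nonneg[OF elim(2)] d0 by simp
          then show ?case using elim(1) a0 unfolding w2_def by auto
        qed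
      qed
      also have "\<dots> = a * m + L * d" using l_int by (simp add: m_def L_def)
      finally show ?thesis .
    qed
    moreover have "xs \<bullet> (x' - x) - ys \<bullet> ((LINT t|M. w2 t) - y) \<le> e * (norm (x' - x) + norm ((LINT t|M. w2 t) - y))"
      using w2 by (rule R) (use calculation(3,4) small x' in linarith)
    moreover have "e * (norm (x' - x) + norm ((LINT t|M. w2 t) - y)) \<le> e * (d + (LINT t|M. norm (w2 t - v t)))"
      using e x' nle by (intro mult_left_mono add_mono) auto
    moreover have "e * (d + (LINT t|M. norm (w2 t - v t))) = d * e + e * (LINT t|M. norm (w2 t - v t))"
      "d * (om - e) = d * om - d * e" by (simp_all add: algebra_simps)
    ultimately show ?thesis by linarith
  qed
  \<comment> \<open>The price of moving an optimal selection back to \<open>x'\<close>. The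
    displacement is capped by the diameter \<open>2 * \<eta>\<close>, because the square of
    \<open>l\<close> need not be integrable; the cap supplies an integrable majorant as
    \<open>N\<close> grows.\<close>
  define tail where "tail N t = K' * (l t * min (2 * \<eta>) (K' * l t / N))" for N t
  have tail_le: "norm (tail N t) \<le> K' * (l t * (2 * \<eta>))" if t: "t \<in> space M" and N: "N > 0" for t N
  proof -
    have "0 \<le> K' * l t / N" using K'3 l_nonneg[OF t] N by simp
    then have "0 \<le> min (2 * \<eta>) (K' * l t / N)" using \<eta>_pos by simp
    then have "norm (tail N t) = tail N t" unfolding tail_def using K'3 l_nonneg[OF t] by simp
    also have "\<dots> \<le> K' * (l t * (2 * \<eta>))"
      unfolding tail_def using K'3 l_nonneg[OF t] by (intro mult_left_mono) auto
    finally show ?thesis .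
  qed
  have tail_bd_int: "integrable M (\<lambda>t. K' * (l t * (2 * \<eta>)))" using l_int by auto
  have tail_int: "integrable M (tail N)" if "N > 0" for N
  proof (rule Bochner_Integration.integrable_bound[OF tail_bd_int])
    show "tail N \<in> borel_measurable M" unfolding tail_def by measurable
    show "AE t in M. norm (tail N t) \<le> norm (K' * (l t * (2 * \<eta>)))"
      by (rule AE_I2, rule order_trans[OF tail_le[OF _ that]]) (simp_all add: abs_ge_self)
  qed
  have "(\<lambda>n. \<integral>t. tail (real (Suc n)) t \<partial>M) \<longlonglongrightarrow> (LINT t|M. 0)"
  proof (rule integral_dominated_convergence[OF _ _ tail_bd_int])
    show "AE t in M. (\<lambda>n. tail (real (Suc n)) t) \<longlonglongrightarrow> 0"
    proof (rule AE_I2)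
      fix t
      have "(\<lambda>n. K' * l t / real (Suc n)) \<longlonglongrightarrow> 0"
        by (rule LIMSEQ_Suc) (rule lim_const_over_n)
      then have "(\<lambda>n. K' * (l t * min (2 * \<eta>) (K' * l t / real (Suc n)))) \<longlonglongrightarrow> K' * (l t * min (2 * \<eta>) 0)"
        by (intro tendsto_intros)
      then show "(\<lambda>n. tail (real (Suc n)) t) \<longlonglongrightarrow> 0" unfolding tail_def using \<eta>_pos by simp
    qed
    show "AE t in M. norm (tail (real (Suc n)) t) \<le> K' * (l t * (2 * \<eta>))" for n
      by (rule AE_I2, rule tail_le) auto
  qed (auto simp: tail_def)
  then have "(\<lambda>n. \<integral>t. tail (real (Suc n)) t \<partial>M) \<longlonglongrightarrow> 0" by simp
  then have "\<forall>\<^sub>F n in sequentially. (LINT t|M. tail (real (Suc n)) t) < e * d"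
    using e d0 by (intro order_tendstoD(2)) auto
  moreover have "\<forall>\<^sub>F n in sequentially. real (Suc n) \<ge> K' / e"
    using eventually_ge_at_top[of "nat \<lceil>K' / e\<rceil>"] by eventually_elim linarith
  ultimately have "\<forall>\<^sub>F n in sequentially. (LINT t|M. tail (real (Suc n)) t) < e * d \<and> real (Suc n) \<ge> K' / e"
    by eventually_elim simp
  \<comment> \<open>The weight is chosen for two purposes: the tail becomes at most
    \<open>e * d\<close>, and the displacement \<open>K' * l t / N\<close> becomes at most
    \<open>e * l t\<close>.\<close>
  then obtain n :: nat where n: "(LINT t|M. tail (real (Suc n)) t) < e * d" "real (Suc n) \<ge> K' / e"
    using eventually_happens'[OF sequentially_bot] by blast
  define N where "N = real (Suc n)"
  have N0: "N > 0" and NK: "K' \<le> e * N" and tailN: "(LINT t|M. tail N t) \<le> e * d"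
    using n e unfolding N_def by (auto simp: pos_divide_le_eq mult.commute)
  define cost where "cost x' t u w = ys \<bullet> (w - v t) + pen (w - v t) + N * ((u - x') \<bullet> (u - x'))" for x' u :: 'a and t w
  define opt where "opt x' u w \<longleftrightarrow> selection u w \<and>
     (AE t in M. \<forall>u'\<in>cball xbar \<eta>. \<forall>w'\<in>\<Phi> t u'. cost x' t (u t) (w t) \<le> cost x' t u' w')" for x' u w
  have "\<exists>u w. opt x' u w" for x'
  proof -
    have "(\<lambda>(t, u, w). cost x' t u w) \<in> borel_measurable (M \<Otimes>\<^sub>M ((borel :: 'a measure) \<Otimes>\<^sub>M (borel :: 'b measure)))"
      unfolding cost_def by measurable
    then have c: "(\<lambda>(t, u, w). cost x' t u w) \<in> borel_measurable (M \<Otimes>\<^sub>M (borel :: ('a \<times> 'b) measure))"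
      by (simp add: borel_prod)
    have cc: "continuous_on UNIV (\<lambda>p. case (t, p) of (t, u, w) \<Rightarrow> cost x' t u w)" for t
      unfolding cost_def case_prod_beta
      by (intro continuous_intros continuous_on_compose2[OF pen_cont]) auto
    have C: "closed (cball xbar \<eta>)" "cball xbar \<eta> \<noteq> {}" "cball xbar \<eta> \<subseteq> cball xbar \<eta>" using \<eta>_pos by auto
    from minimizing_selection[OF C c cc] obtain u w where uw: "selection u w"
      "AE t in M. u t \<in> cball xbar \<eta> \<and> (\<forall>u'\<in>cball xbar \<eta>. \<forall>w'\<in>\<Phi> t u'. cost x' t (u t) (w t) \<le> cost x' t u' w')" by auto
    have "AE t in M. \<forall>u'\<in>cball xbar \<eta>. \<forall>w'\<in>\<Phi> t u'. cost x' t (u t) (w t) \<le> cost x' t u' w'"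
      using uw(2) by eventually_elim simp
    with uw(1) have "opt x' u w" by (simp add: opt_def)
    then show ?thesis by blast
  qed
  then obtain U W where opt: "\<And>x'. opt x' (U x') (W x')" by metis
  have UW: "selection (U x') (W x')"
    and UWmin: "AE t in M. \<forall>u'\<in>cball xbar \<eta>. \<forall>w'\<in>\<Phi> t u'. cost x' t (U x' t) (W x' t) \<le> cost x' t u' w'" for x'
    using opt[of x'] unfolding opt_def by simp_all
  have sq_int: "integrable M (\<lambda>t. (u t - x') \<bullet> (u t - x'))" if uw: "selection u w" for u w x'
  proof -
    note [measurable] = selectionD(1)[OF uw]
    show ?thesis
    proof (rule integrable_const_bound)
      show "AE t in M. norm ((u t - x') \<bullet> (u t - x')) \<le> (\<eta> + norm (xbar - x'))\<^sup>2"
        using selectionD(3)[OF uw]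
      proof eventually_elim
        case (elim t)
        have "norm (u t - x') \<le> \<eta> + norm (xbar - x')"
          using dist_triangle[of "u t" x' xbar] elim by (simp add: dist_norm norm_minus_commute)
        then have "(norm (u t - x'))\<^sup>2 \<le> (\<eta> + norm (xbar - x'))\<^sup>2" by (intro power_mono) auto
        then show ?case by (simp add: dot_square_norm)
      qed
    qed measurable
  qed
  have cost_int: "integrable M (\<lambda>t. cost x' t (u t) (w t))" if uw: "selection u w" for u w x'
    unfolding cost_def using pen_int[OF selection_integrable[OF uw]] sq_int[OF uw] by auto
  define J where "J x' u w = (LINT t|M. cost x' t (u t) (w t))" for x' u w
  have Jmin: "J x' (U x') (W x') \<le> J x' u w" if uw: "selection u w" for x' u w
    unfolding J_def
  proof (rule integral_mono_AE[OF cost_int[OF UW] cost_int[OF uw]])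
    show "AE t in M. cost x' t (U x' t) (W x' t) \<le> cost x' t (u t) (w t)"
      using UWmin selectionD(3)[OF uw] by eventually_elim blast
  qed
  have pen_diff: "ys \<bullet> (w1 - z) + pen (w1 - z) - K' * norm (w1 - w) \<le> ys \<bullet> (w - z) + pen (w - z)" for w w1 z
  proof -
    have "ys \<bullet> (w1 - z) - ys \<bullet> (w - z) = ys \<bullet> (w1 - w)" by (simp add: inner_diff_right)
    moreover have "ys \<bullet> (w1 - w) \<le> Y * norm (w1 - w)" unfolding Y_def by (rule norm_cauchy_schwarz)
    moreover have "pen (w1 - z) - pen (w - z) \<le> K * norm (w1 - w)" using pen_lip[of "w1 - z" "w - z"] by simp
    moreover have "K' * norm (w1 - w) = Y * norm (w1 - w) + K * norm (w1 - w)" by (simp add: K'_def algebra_simps)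
    ultimately show ?thesis by linarith
  qed
  \<comment> \<open>The minimiser is compared with a point of the graph above \<open>x'\<close>. The
    gain \<open>N * s * s\<close> is at most the loss \<open>K' * l t * s\<close>, and a factor
    \<open>s\<close> cancels.\<close>
  have U_near: "AE t in M. norm (U x' t - x') \<le> K' * l t / N" if x': "norm (x' - x) \<le> d" for x'
    using UWmin[of x'] lipschitz_values selectionD(3)[OF UW[of x']] AE_space
  proof eventually_elim
    case (elim t)
    define s where "s = norm (U x' t - x')"
    obtain w1 where w1: "w1 \<in> \<Phi> t x'" "norm (w1 - W x' t) \<le> l t * s"
      using elim(2,3) cb[OF x'] unfolding s_def by blast
    have "cost x' t (U x' t) (W x' t) \<le> cost x' t x' w1" using elim(1) w1(1) cb[OF x'] by blast
    then have "N * (s * s) \<le> K' * norm (w1 - W x' t)"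
      using pen_diff[where w = "W x' t" and ?w1.0 = w1 and z = "v t"]
      unfolding cost_def s_def by (simp add: dot_square_norm power2_eq_square)
    also have "\<dots> \<le> K' * (l t * s)" using w1(2) K'3 by (intro mult_left_mono) auto
    finally have "N * s * s \<le> K' * l t * s" by (simp add: mult.assoc)
    moreover have "s \<ge> 0" by (simp add: s_def)
    ultimately have "N * s \<le> K' * l t"
      using K'3 l_nonneg[OF elim(4)] by (cases "s = 0") (auto simp: mult_le_cancel_right)
    then show ?case using N0 by (simp add: s_def pos_le_divide_eq mult.commute)
  qed
  \<comment> \<open>One \<open>d * om\<close> is lost in the lower bound for selections at
    \<open>x'\<close>, another in the tail, whose integral is at most
    \<open>e * d \<le> d * om\<close>.\<close>
  have key: "\<exists>w1. selection (\<lambda>_. x') w1 \<and> (AE t in M. K' * norm (w1 t - W x' t) \<le> tail N t) \<and>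
      (LINT t|M. q (w1 t - v t)) / 2 - 2 * d * om \<le> J x' (U x') (W x') - xs \<bullet> (x' - x)"
    if x': "norm (x' - x) \<le> d" for x'
  proof -
    obtain w1 where w1: "selection (\<lambda>_. x') w1" and near: "AE t in M. norm (w1 t - W x' t) \<le> l t * norm (U x' t - x')"
      using near_selection[OF UW cb[OF x']] by blast
    have tl: "AE t in M. K' * norm (w1 t - W x' t) \<le> tail N t"
      using near U_near[OF x'] selectionD(3)[OF UW[of x']] AE_space
    proof eventually_elim
      case (elim t)
      have "norm (U x' t - x') \<le> min (2 * \<eta>) (K' * l t / N)"
        using elim(2,3) diam[OF _ cb[OF x']] by simp
      then have "l t * norm (U x' t - x') \<le> l t * min (2 * \<eta>) (K' * l t / N)"
        using l_nonneg[OF elim(4)] by (intro mult_left_mono) auto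
      then show ?case unfolding tail_def using elim(1) K'3 by (intro mult_left_mono) auto
    qed
    have "(LINT t|M. ys \<bullet> (w1 t - v t) + pen (w1 t - v t) - tail N t) \<le> J x' (U x') (W x')"
      unfolding J_def
    proof (rule integral_mono_AE[OF _ cost_int[OF UW]])
      show "integrable M (\<lambda>t. ys \<bullet> (w1 t - v t) + pen (w1 t - v t) - tail N t)"
        by (intro Bochner_Integration.integrable_diff pen_int[OF selection_integrable[OF w1]] tail_int N0)
      show "AE t in M. ys \<bullet> (w1 t - v t) + pen (w1 t - v t) - tail N t \<le> cost x' t (U x' t) (W x' t)"
        using tl
      proof eventually_elim
        case (elim t)
        have "0 \<le> N * ((U x' t - x') \<bullet> (U x' t - x'))" using N0 by simp
        then show ?case
          using elim pen_diff[where w = "W x' t" and ?w1.0 = "w1 t" and z = "v t"] unfolding cost_def by linarith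
      qed
    qed
    moreover have "(LINT t|M. ys \<bullet> (w1 t - v t) + pen (w1 t - v t) - tail N t)
      = (LINT t|M. ys \<bullet> (w1 t - v t) + pen (w1 t - v t)) - (LINT t|M. tail N t)"
      by (rule Bochner_Integration.integral_diff[OF pen_int[OF selection_integrable[OF w1]] tail_int[OF N0]])
    moreover have "e * d \<le> om * d" using om_e d0 by (intro mult_right_mono) auto
    ultimately have "(LINT t|M. q (w1 t - v t)) / 2 - 2 * d * om \<le> J x' (U x') (W x') - xs \<bullet> (x' - x)"
      using LB[OF x' w1] tailN by (simp add: algebra_simps)
    then show ?thesis using w1 tl by blast
  qed
  \<comment> \<open>At distance \<open>d\<close> the quadratic term equals \<open>3 * om * d\<close>
    and exceeds the possible deficit \<open>2 * d * om\<close>, while the value at \<open>x\<close>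
    is at most zero; so the minimiser is interior. The gradient of the term has norm at most
    \<open>6 * om\<close> on the ball.\<close>
  define \<Psi> where "\<Psi> x' = J x' (U x') (W x') - xs \<bullet> (x' - x) + 3 * om / d * ((x' - x) \<bullet> (x' - x))" for x'
  have om0: "om > 0" using om_e e by linarith
  have c0: "3 * om / d > 0" using om0 d0 by simp
  have \<Psi>x: "\<Psi> x \<le> 0"
  proof -
    have "J x (U x) (W x) \<le> J x (\<lambda>_. x) v" by (rule Jmin[OF v])
    also have "J x (\<lambda>_. x) v = 0" unfolding J_def cost_def using pen0 by simp
    finally show ?thesis by (simp add: \<Psi>_def)
  qed
  have J_shift: "J x' u w - J x'' u w = N * (2 * ((LINT t|M. x'' - u t) \<bullet> (x' - x'')) + m * ((x' - x'') \<bullet> (x' - x'')))"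
    if uw: "selection u w" for x' x'' u w
  proof -
    note [measurable] = selectionD(1)[OF uw]
    have ui: "integrable M (\<lambda>t. x'' - u t)"
    proof (rule integrable_const_bound)
      show "AE t in M. norm (x'' - u t) \<le> norm (x'' - xbar) + \<eta>"
        using selectionD(3)[OF uw]
      proof eventually_elim
        case (elim t)
        have "norm (x'' - u t) \<le> norm (x'' - xbar) + norm (xbar - u t)"
          using norm_triangle_ineq[of "x'' - xbar" "xbar - u t"] by simp
        then show ?case using elim by (simp add: dist_norm)
      qed
    qed measurable
    have "J x' u w - J x'' u w = (LINT t|M. cost x' t (u t) (w t) - cost x'' t (u t) (w t))"
      unfolding J_def by (rule Bochner_Integration.integral_diff[symmetric, OF cost_int[OF uw] cost_int[OF uw]])
    also have "\<dots> = (LINT t|M. N * (2 * ((x'' - u t) \<bullet> (x' - x'')) + (x' - x'') \<bullet> (x' - x'')))"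
      by (rule Bochner_Integration.integral_cong)
         (auto simp: cost_def inner_diff_left inner_diff_right inner_commute algebra_simps)
    also have "\<dots> = N * (2 * ((LINT t|M. x'' - u t) \<bullet> (x' - x'')) + m * ((x' - x'') \<bullet> (x' - x'')))"
      using ui by (simp add: m_def)
    finally show ?thesis .
  qed
  \<comment> \<open>The minimisers \<open>U x'\<close> need not depend continuously on
    \<open>x'\<close>. Inserting those of one parameter into the cost of the other still makes the
    value function Lipschitz.\<close>
  have \<Psi>_cont: "continuous_on (cball x d) \<Psi>"
  proof -
    define B where "B = N * (4 * \<eta> * m)"
    have B0: "B \<ge> 0" using N0 \<eta>_pos m0 by (simp add: B_def)
    have Jle: "J x' (U x') (W x') - J x'' (U x'') (W x'') \<le> B * norm (x' - x'')"
      if x': "norm (x' - x) \<le> d" and x'': "norm (x'' - x) \<le> d" for x' x''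
    proof -
      have "J x' (U x') (W x') - J x'' (U x'') (W x'') \<le> J x' (U x'') (W x'') - J x'' (U x'') (W x'')"
        using Jmin[OF UW[of x'']] by simp
      also have "\<dots> = (LINT t|M. cost x' t (U x'' t) (W x'' t) - cost x'' t (U x'' t) (W x'' t))"
        unfolding J_def by (rule Bochner_Integration.integral_diff[symmetric, OF cost_int[OF UW] cost_int[OF UW]])
      also have "\<dots> \<le> (LINT t|M. N * (4 * \<eta> * norm (x' - x'')))"
      proof (rule integral_mono_AE)
        show "integrable M (\<lambda>t. cost x' t (U x'' t) (W x'' t) - cost x'' t (U x'' t) (W x'' t))"
          by (intro Bochner_Integration.integrable_diff cost_int UW)
        show "AE t in M. cost x' t (U x'' t) (W x'' t) - cost x'' t (U x'' t) (W x'' t) \<le> N * (4 * \<eta> * norm (x' - x''))"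
          using selectionD(3)[OF UW[of x'']]
        proof eventually_elim
          case (elim t)
          have nb: "norm (U x'' t - z) \<le> 2 * \<eta>" if "norm (z - x) \<le> d" for z
            using elim diam[OF _ cb[OF that]] by blast
          define p where "p = U x'' t - x'"
          define r where "r = U x'' t - x''"
          have "p \<bullet> p - r \<bullet> r = (p + r) \<bullet> (p - r)"
            unfolding inner_diff_right inner_add_left by (simp add: inner_commute[of r p])
          also have "\<dots> \<le> norm (p + r) * norm (p - r)" by (rule norm_cauchy_schwarz)
          also have "norm (p - r) = norm (x' - x'')" by (simp add: p_def r_def norm_minus_commute)
          also have "norm (p + r) * norm (x' - x'') \<le> (4 * \<eta>) * norm (x' - x'')"
          proof (rule mult_right_mono)
            show "norm (p + r) \<le> 4 * \<eta>"
              using norm_triangle_ineq[of p r] nb[OF x'] nb[OF x''] unfolding p_def r_def by linarith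
          qed simp
          finally have "N * (p \<bullet> p - r \<bullet> r) \<le> N * (4 * \<eta> * norm (x' - x''))"
            using N0 by (intro mult_left_mono) auto
          then show ?case unfolding cost_def p_def r_def by (simp add: right_diff_distrib)
        qed
      qed simp
      also have "\<dots> = B * norm (x' - x'')" by (simp add: B_def m_def)
      finally show ?thesis .
    qed
    have "continuous_on (cball x d) (\<lambda>x'. J x' (U x') (W x'))"
      unfolding continuous_on_iff
    proof (intro ballI allI impI)
      fix x' r :: _ assume x': "x' \<in> cball x d" and r: "(0::real) < r"
      show "\<exists>dd>0. \<forall>x''\<in>cball x d. dist x'' x' < dd \<longrightarrow> dist (J x'' (U x'') (W x'')) (J x' (U x') (W x')) < r"
      proof (intro exI conjI ballI impI)
        show "r / (B + 1) > 0" using r B0 by simp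
        fix x'' assume x'': "x'' \<in> cball x d" and lt: "dist x'' x' < r / (B + 1)"
        have n': "norm (x' - x) \<le> d" "norm (x'' - x) \<le> d" using x' x'' by (auto simp: dist_norm norm_minus_commute)
        have "B * norm (x'' - x') \<le> (B + 1) * norm (x'' - x')" by (intro mult_right_mono) auto
        also have "\<dots> < r" using lt B0 by (simp add: dist_norm pos_less_divide_eq mult.commute)
        finally show "dist (J x'' (U x'') (W x'')) (J x' (U x') (W x')) < r"
          using Jle[OF n'] Jle[OF n'(2,1)] unfolding dist_real_def by (simp add: norm_minus_commute abs_less_iff)
      qed
    qed
    then show ?thesis unfolding \<Psi>_def by (intro continuous_intros) auto
  qed
  obtain xN where xN: "xN \<in> cball x d" and xNmin: "\<And>x'. x' \<in> cball x d \<Longrightarrow> \<Psi> xN \<le> \<Psi> x'"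
    using continuous_attains_inf[OF compact_cball _ \<Psi>_cont] d0 by (metis cball_eq_empty not_less_iff_gr_or_eq)
  have \<Psi>xN: "\<Psi> xN \<le> 0" using xNmin[of x] \<Psi>x d0 by simp
  have xNd: "norm (xN - x) \<le> d" using xN by (simp add: dist_norm norm_minus_commute)
  obtain w1 where w1: "selection (\<lambda>_. xN) w1" and w1t: "AE t in M. K' * norm (w1 t - W xN t) \<le> tail N t"
    and w1q: "(LINT t|M. q (w1 t - v t)) / 2 - 2 * d * om \<le> J xN (U xN) (W xN) - xs \<bullet> (xN - x)"
    using key[OF xNd] by blast
  have qI0: "0 \<le> (LINT t|M. q (w1 t - v t))" using q0 by (intro integral_nonneg_AE) auto
  have quad0: "0 \<le> 3 * om / d * ((xN - x) \<bullet> (xN - x))" using c0 by (intro mult_nonneg_nonneg) auto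
  have qI: "(LINT t|M. q (w1 t - v t)) \<le> 4 * d * om"
    using w1q \<Psi>xN quad0 unfolding \<Psi>_def by linarith
  have xNlt: "norm (xN - x) < d"
  proof (rule ccontr)
    assume "\<not> norm (xN - x) < d"
    then have "norm (xN - x) = d" using xNd by simp
    then have "3 * om / d * ((xN - x) \<bullet> (xN - x)) = 3 * om * d"
      using d0 by (simp add: dot_square_norm power2_eq_square)
    moreover have "om * d > 0" using om0 d0 by simp
    ultimately show False using w1q \<Psi>xN qI0 unfolding \<Psi>_def by (simp add: algebra_simps)
  qed
  define us where "us t = (2 * N) *\<^sub>R (xN - U xN t)" for t
  define ws where "ws t = ys + penalty_grad K a (W xN t - v t)" for t
  note [measurable] = selectionD(1,2)[OF UW[of xN]] selectionD(2)[OF w1]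
  have "(2 * N) *\<^sub>R (LINT t|M. xN - U xN t) - xs + (6 * om / d) *\<^sub>R (xN - x) = 0"
  proof (rule first_order_zero[where C = "N * m + 3 * om / d"])
    show "d - norm (xN - x) > 0" using xNlt by simp
    fix p :: 'a assume p: "norm p \<le> d - norm (xN - x)"
    define x' where "x' = xN + p"
    have "norm (x' - x) \<le> norm (xN - x) + norm p"
      unfolding x'_def using norm_triangle_ineq[of "xN - x" p] by (simp add: algebra_simps)
    then have "x' \<in> cball x d" using p by (simp add: dist_norm norm_minus_commute)
    then have "\<Psi> xN \<le> \<Psi> x'" by (rule xNmin)
    also have "\<Psi> x' \<le> J x' (U xN) (W xN) - xs \<bullet> (x' - x) + 3 * om / d * ((x' - x) \<bullet> (x' - x))"
      unfolding \<Psi>_def using Jmin[OF UW[of xN]] by simp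
    also have s1: "J x' (U xN) (W xN) = J xN (U xN) (W xN) + N * (2 * ((LINT t|M. xN - U xN t) \<bullet> p) + m * (p \<bullet> p))"
      using J_shift[OF UW[of xN], of x' xN] by (simp add: x'_def)
    also have s2: "xs \<bullet> (x' - x) = xs \<bullet> (xN - x) + xs \<bullet> p"
      by (simp add: x'_def inner_add_right inner_diff_right)
    finally have "0 \<le> N * (2 * ((LINT t|M. xN - U xN t) \<bullet> p) + m * (p \<bullet> p)) - xs \<bullet> p
        + 3 * om / d * ((x' - x) \<bullet> (x' - x) - (xN - x) \<bullet> (xN - x))"
      using right_diff_distrib[of "3 * om / d" "(x' - x) \<bullet> (x' - x)" "(xN - x) \<bullet> (xN - x)"]
      unfolding \<Psi>_def by linarith
    also have "(x' - x) \<bullet> (x' - x) - (xN - x) \<bullet> (xN - x) = 2 * ((xN - x) \<bullet> p) + p \<bullet> p"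
      unfolding x'_def by (simp add: algebra_simps inner_add_left inner_add_right inner_diff_left inner_diff_right inner_commute)
    finally show "0 \<le> ((2 * N) *\<^sub>R (LINT t|M. xN - U xN t) - xs + (6 * om / d) *\<^sub>R (xN - x)) \<bullet> p + (N * m + 3 * om / d) * (p \<bullet> p)"
      by (simp add: inner_add_left inner_diff_left algebra_simps)
  qed
  moreover have "(LINT t|M. us t) = (2 * N) *\<^sub>R (LINT t|M. xN - U xN t)" unfolding us_def by simp
  ultimately have usI: "(LINT t|M. us t) - xs = - ((6 * om / d) *\<^sub>R (xN - x))"
    by (simp add: algebra_simps eq_neg_iff_add_eq_0)
  have us_bound: "norm ((LINT t|M. us t) - xs) \<le> 6 * om"
  proof -
    have "norm ((LINT t|M. us t) - xs) = 6 * om / d * norm (xN - x)" unfolding usI using om0 d0 by simp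
    also have "\<dots> \<le> 6 * om / d * d" using xNd om0 d0 by (intro mult_left_mono) auto
    finally show ?thesis using d0 by simp
  qed
  have us_le: "AE t in M. norm (us t) \<le> 2 * (4 * Y + 3) * l t"
    using U_near[OF xNd]
  proof eventually_elim
    case (elim t)
    have "norm (us t) = 2 * (N * norm (U xN t - xN))" unfolding us_def using N0 by (simp add: norm_minus_commute)
    also have "N * norm (U xN t - xN) \<le> K' * l t" using elim N0 by (simp add: pos_le_divide_eq mult.commute)
    finally show ?case by (simp add: K'_def K_def algebra_simps)
  qed
  have u_near: "AE t in M. norm (U xN t - x) \<le> e * (1 + l t)"
    using U_near[OF xNd] AE_space
  proof eventually_elim
    case (elim t)
    have "K' * l t \<le> e * N * l t" using NK l_nonneg[OF elim(2)] by (rule mult_right_mono)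
    then have "K' * l t / N \<le> e * l t" using N0 by (simp add: pos_divide_le_eq mult_ac)
    moreover have "norm (U xN t - x) \<le> norm (U xN t - xN) + norm (xN - x)"
      using norm_triangle_ineq[of "U xN t - xN" "xN - x"] by simp
    ultimately have "norm (U xN t - x) \<le> e * l t + e" using elim(1) xNd de by linarith
    then show ?case by (simp add: algebra_simps)
  qed
  \<comment> \<open>At a base point in the open ball the constraint is inactive nearby, so
    minimality holds against all near points of the graph, and the cost exceeds its linearisation at
    most quadratically.\<close>
  have normals: "AE t in M. U xN t \<in> ball xbar \<eta> \<longrightarrow> (us t, - ws t) \<in> regular_normal_cone (gph (\<Phi> t)) (U xN t, W xN t)"
    using UWmin[of xN] selectionD(3)[OF UW[of xN]]
  proof eventually_elim
    case (elim t)
    show ?case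
    proof
      assume ball: "U xN t \<in> ball xbar \<eta>"
      show "(us t, - ws t) \<in> regular_normal_cone (gph (\<Phi> t)) (U xN t, W xN t)"
      proof (rule regular_normal_coneI_quadratic)
        show "(U xN t, W xN t) \<in> gph (\<Phi> t)" using elim(2) by (simp add: gph_def)
        show "\<eta> - dist xbar (U xN t) > 0" using ball by simp
        show "N + K / (2 * a) > 0" using N0 K3 a0 by (intro add_pos_pos) auto
        fix p assume p: "p \<in> gph (\<Phi> t)" "norm (p - (U xN t, W xN t)) < \<eta> - dist xbar (U xN t)"
        obtain u' w' where p_eq: "p = (u', w')" by (cases p)
        define du where "du = u' - U xN t"
        define dw where "dw = w' - W xN t"
        have pd: "p - (U xN t, W xN t) = (du, dw)" by (simp add: p_eq du_def dw_def)
        have "norm du \<le> norm (du, dw)" "norm dw \<le> norm (du, dw)"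
          using norm_fst_le[of du dw] norm_snd_le[of dw du] by auto
        then have sq: "du \<bullet> du \<le> (norm (du, dw))\<^sup>2" "dw \<bullet> dw \<le> (norm (du, dw))\<^sup>2"
          by (auto simp: dot_square_norm intro!: power_mono)
        have "dist xbar u' \<le> dist xbar (U xN t) + norm du"
          using dist_triangle[of xbar u' "U xN t"] by (simp add: du_def dist_norm norm_minus_commute)
        then have "u' \<in> cball xbar \<eta>" using p(2) \<open>norm du \<le> norm (du, dw)\<close> unfolding pd by simp
        moreover have "w' \<in> \<Phi> t u'" using p(1) by (simp add: p_eq gph_def)
        ultimately have le: "cost xN t (U xN t) (W xN t) \<le> cost xN t u' w'" using elim(1) by blast
        have "pen (w' - v t) - pen (W xN t - v t) \<le> penalty_grad K a (W xN t - v t) \<bullet> dw + K / (2 * a) * (dw \<bullet> dw)"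
          using penalty_descent[OF a0 K0, of "w' - v t" "W xN t - v t"] unfolding pen_def dw_def by simp
        moreover have "ys \<bullet> (w' - v t) - ys \<bullet> (W xN t - v t) = ys \<bullet> dw" by (simp add: dw_def inner_diff_right)
        moreover have "N * ((u' - xN) \<bullet> (u' - xN)) - N * ((U xN t - xN) \<bullet> (U xN t - xN)) = - (us t \<bullet> du) + N * (du \<bullet> du)"
          unfolding us_def du_def
          by (simp add: algebra_simps inner_add_left inner_add_right inner_diff_left inner_diff_right inner_commute)
        moreover have "ws t \<bullet> dw = ys \<bullet> dw + penalty_grad K a (W xN t - v t) \<bullet> dw" by (simp add: ws_def inner_add_left)
        ultimately have "us t \<bullet> du - ws t \<bullet> dw \<le> N * (du \<bullet> du) + K / (2 * a) * (dw \<bullet> dw)"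
          using le unfolding cost_def by linarith
        also have "\<dots> \<le> N * (norm (du, dw))\<^sup>2 + K / (2 * a) * (norm (du, dw))\<^sup>2"
          using sq N0 K0 a0 by (intro add_mono mult_left_mono) auto
        finally show "(us t, - ws t) \<bullet> (p - (U xN t, W xN t)) \<le> (N + K / (2 * a)) * (norm (p - (U xN t, W xN t)))\<^sup>2"
          unfolding pd by (simp add: distrib_right)
      qed
    qed
  qed
  have ws_pw: "AE t in M. norm (ws t - ys) \<le> K * (e + q (w1 t - v t) / d + tail N t / a)"
    using w1t
  proof eventually_elim
    case (elim t)
    define n1 where "n1 = norm (w1 t - v t)"
    define z where "z = min 1 (n1 / a)"
    have z0: "z \<ge> 0" "z \<le> n1 / a" using a0 by (auto simp: z_def n1_def)
    have qz: "q (w1 t - v t) = n1 * z" by (simp add: q_def n1_def z_def)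
    \<comment> \<open>If \<open>z\<close> exceeds \<open>e\<close>, then \<open>n1\<close> exceeds
      \<open>a * e = d\<close>. This turns the integral bound on \<open>q\<close> into a bound in
      mean for the gradient of the penalty.\<close>
    have "z \<le> e + n1 * z / d"
    proof (cases "z \<le> e")
      case True
      have "0 \<le> n1 * z / d" using z0 d0 by (simp add: n1_def)
      then show ?thesis using True by linarith
    next
      case False
      have "z * a \<le> n1" using z0(2) a0 by (simp add: pos_le_divide_eq)
      have "z * d = z * a * e" by (simp add: ae[symmetric] mult.assoc)
      also have "\<dots> \<le> n1 * e" using \<open>z * a \<le> n1\<close> e by (intro mult_right_mono) auto
      also have "\<dots> \<le> n1 * z" using False by (intro mult_left_mono) (auto simp: n1_def)
      finally have "z \<le> n1 * z / d" using d0 by (simp add: pos_le_divide_eq)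
      then show ?thesis using e by linarith
    qed
    moreover have "min 1 (norm (W xN t - v t) / a) \<le> z + tail N t / a"
    proof -
      have "1 * norm (w1 t - W xN t) \<le> K' * norm (w1 t - W xN t)" using K'3 by (intro mult_right_mono) auto
      then have nt: "norm (w1 t - W xN t) \<le> tail N t" using elim by linarith
      have "norm (W xN t - v t) \<le> norm (w1 t - v t) + norm (w1 t - W xN t)"
        using norm_triangle_ineq4[of "w1 t - v t" "w1 t - W xN t"] by simp
      then have "norm (W xN t - v t) \<le> n1 + tail N t" using nt by (simp add: n1_def)
      then have "norm (W xN t - v t) / a \<le> (n1 + tail N t) / a" using a0 by (intro divide_right_mono) auto
      then have "norm (W xN t - v t) / a \<le> n1 / a + tail N t / a" by (simp add: add_divide_distrib)
      moreover have "0 \<le> tail N t / a" using nt norm_ge_zero order_trans a0 by (intro divide_nonneg_pos) blast+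
      ultimately show ?thesis unfolding z_def by linarith
    qed
    ultimately have "min 1 (norm (W xN t - v t) / a) \<le> e + q (w1 t - v t) / d + tail N t / a" unfolding qz by linarith
    then have "K * min 1 (norm (W xN t - v t) / a) \<le> K * (e + q (w1 t - v t) / d + tail N t / a)"
      using K0 by (rule mult_left_mono)
    then show ?case using penalty_grad_norm[OF a0 K0, of "W xN t - v t"] unfolding ws_def by simp
  qed
  have rhs_int: "integrable M (\<lambda>t. K * (e + q (w1 t - v t) / d + tail N t / a))"
    using q_int[OF selection_integrable[OF w1]] tail_int[OF N0] by auto
  have ws_meas: "(\<lambda>t. ws t - ys) \<in> borel_measurable M"
    unfolding ws_def penalty_grad_def by measurable
  have ws_int: "integrable M (\<lambda>t. ws t - ys)"
    by (rule Bochner_Integration.integrable_bound[OF rhs_int ws_meas])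
       (use ws_pw in \<open>auto elim!: eventually_mono intro: order_trans\<close>)
  have ws_bound: "(LINT t|M. norm (ws t - ys)) \<le> K * (e * m + 4 * om + e\<^sup>2)"
  proof -
    have "(LINT t|M. norm (ws t - ys)) \<le> (LINT t|M. K * (e + q (w1 t - v t) / d + tail N t / a))"
      by (rule integral_mono_AE[OF integrable_norm[OF ws_int] rhs_int ws_pw])
    also have "\<dots> = K * (e * m + (LINT t|M. q (w1 t - v t)) / d + (LINT t|M. tail N t) / a)"
      using q_int[OF selection_integrable[OF w1]] tail_int[OF N0] by (simp add: m_def mult.commute)
    also have "\<dots> \<le> K * (e * m + 4 * om + e\<^sup>2)"
    proof (intro mult_left_mono add_mono order_refl K0)
      show "(LINT t|M. q (w1 t - v t)) / d \<le> 4 * om" using qI d0 by (simp add: pos_divide_le_eq mult_ac)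
      have "e * d = e\<^sup>2 * a" by (simp add: ae[symmetric] power2_eq_square mult_ac)
      then show "(LINT t|M. tail N t) / a \<le> e\<^sup>2" using tailN a0 by (simp add: pos_divide_le_eq)
    qed (use e in simp)
    finally show ?thesis .
  qed
  have "us \<in> borel_measurable M" unfolding us_def by measurable
  then show ?thesis
    using UW[of xN] ws_int u_near normals us_le us_bound ws_bound
    unfolding decoupled_normals_def K_def Y_def[symmetric] m_def[symmetric] om_def[symmetric]
    by (intro exI[of _ "U xN"] exI[of _ "W xN"] exI[of _ us] exI[of _ ws] conjI)
qed

end

section \<open>Passage to the limit\<close>

context lipschitz_integrand
begin

lemma defect_mono:
  assumes "Y \<le> Z"
  shows "defect Y e \<le> defect Z e"
  unfolding defect_def
proof (rule add_left_mono, rule integral_mono)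
  interpret finite_measure M by (rule finite_M)
  show "integrable M (\<lambda>t. max 0 (Y * l t - 1 / (2 * e)))" "integrable M (\<lambda>t. max 0 (Z * l t - 1 / (2 * e)))"
    using l_int by auto
  fix t assume "t \<in> space M"
  then have "Y * l t \<le> Z * l t" using assms l_nonneg by (intro mult_right_mono)
  then show "max 0 (Y * l t - 1 / (2 * e)) \<le> max 0 (Z * l t - 1 / (2 * e))" by auto
qed

text \<open>At each \<open>t\<close> the truncated term vanishes once \<open>1 / (2 * e)\<close>
  exceeds \<open>Y * l t\<close>; it is dominated by the absolute value of
  \<open>Y * l t\<close>.\<close>

lemma defect_tendsto_zero: "(\<lambda>k. defect Y (1 / real (Suc k))) \<longlonglongrightarrow> 0"
proof -
  interpret finite_measure M by (rule finite_M)
  note [measurable] = borel_measurable_integrable[OF l_int]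
  have e0: "(\<lambda>k. 1 / real (Suc k)) \<longlonglongrightarrow> 0" by (rule LIMSEQ_Suc) (rule lim_1_over_n)
  have "(\<lambda>k. \<integral>t. max 0 (Y * l t - 1 / (2 * (1 / real (Suc k)))) \<partial>M) \<longlonglongrightarrow> (LINT t|M. 0)"
  proof (rule integral_dominated_convergence)
    show "integrable M (\<lambda>t. norm (Y * l t))" using l_int by auto
    show "AE t in M. (\<lambda>k. max 0 (Y * l t - 1 / (2 * (1 / real (Suc k))))) \<longlonglongrightarrow> 0"
    proof (rule AE_I2)
      fix t
      obtain N :: nat where "2 * (Y * l t) < real N" using reals_Archimedean2 by blast
      then have "\<forall>k\<ge>N. max 0 (Y * l t - 1 / (2 * (1 / real (Suc k)))) = 0" by auto
      then show "(\<lambda>k. max 0 (Y * l t - 1 / (2 * (1 / real (Suc k))))) \<longlonglongrightarrow> 0"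
        by (intro tendsto_eventually) (auto simp: eventually_sequentially)
    qed
    show "AE t in M. norm (max 0 (Y * l t - 1 / (2 * (1 / real (Suc k))))) \<le> norm (Y * l t)" for k
    proof (rule AE_I2)
      fix t
      have "0 \<le> 1 / (2 * (1 / real (Suc k)))" by simp
      then show "norm (max 0 (Y * l t - 1 / (2 * (1 / real (Suc k))))) \<le> norm (Y * l t)"
        using abs_ge_self[of "Y * l t"] abs_ge_zero[of "Y * l t"] unfolding real_norm_def by linarith
    qed
  qed auto
  then have "(\<lambda>k. \<integral>t. max 0 (Y * l t - 1 / (2 * (1 / real (Suc k)))) \<partial>M) \<longlonglongrightarrow> 0" by simp
  from tendsto_add[OF tendsto_mult[OF e0 tendsto_const[of "1 + measure M (space M) / 2 + (LINT t|M. l t)"]] this]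
  show ?thesis unfolding defect_def by simp
qed

end

text \<open>The limit \<open>F\<close> of the normals is given, but the second components
  \<open>w\<close> of the base points converge only along a further subsequence. Their limit
  \<open>y\<close> is found, not prescribed, which is the source of the union over the values at
  \<open>xbar\<close>.\<close>

lemma cluster_point_coderivative:
  fixes G :: "'a::euclidean_space \<Rightarrow> 'b::euclidean_space set"
  assumes cl: "closed (gph G)" and u: "u \<longlonglongrightarrow> xbar" and ws: "ws \<longlonglongrightarrow> ys" and us: "cluster_point us F"
    and w: "\<And>k. w k \<in> G (u k)" "\<And>k. norm (w k) \<le> B"
    and rn: "\<forall>\<^sub>F k in sequentially. (us k, - ws k) \<in> regular_normal_cone (gph G) (u k, w k)"
  shows "\<exists>y\<in>G xbar. F \<in> coderivative G xbar y ys"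
proof -
  obtain r :: "nat \<Rightarrow> nat" where r: "strict_mono r" "(\<lambda>k. us (r k)) \<longlonglongrightarrow> F"
    using us unfolding cluster_point_def by blast
  obtain y where "cluster_point (\<lambda>k. w (r k)) y"
    using bounded_seq_cluster_point[of "\<lambda>k. w (r k)" B] w(2) by blast
  then obtain r' :: "nat \<Rightarrow> nat" where r': "strict_mono r'" "(\<lambda>k. w (r (r' k))) \<longlonglongrightarrow> y"
    unfolding cluster_point_def by blast
  obtain N where N: "\<And>k. k \<ge> N \<Longrightarrow> (us k, - ws k) \<in> regular_normal_cone (gph G) (u k, w k)"
    using rn unfolding eventually_sequentially by blast
  \<comment> \<open>The shift by \<open>N\<close> turns eventual membership into membership at every
    index, as the definition of the limiting normal cone demands.\<close>
  define s where "s k = r (r' (k + N))" for k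
  have sm: "strict_mono (\<lambda>k. r (r' k))" using strict_mono_o[OF r(1) r'(1)] by (simp add: o_def)
  have sN: "s k \<ge> N" for k using seq_suble[OF sm, of "k + N"] by (simp add: s_def)
  have lim: "(\<lambda>k. X (s k)) \<longlonglongrightarrow> L" if "(\<lambda>k. X (r (r' k))) \<longlonglongrightarrow> L" for X :: "nat \<Rightarrow> 'c::topological_space" and L
    unfolding s_def using that by (rule LIMSEQ_ignore_initial_segment)
  have sub: "(\<lambda>k. X (s k)) \<longlonglongrightarrow> L" if "X \<longlonglongrightarrow> L" for X :: "nat \<Rightarrow> 'c::topological_space" and L
    using LIMSEQ_subseq_LIMSEQ[OF that sm] by (intro lim) (simp add: o_def)
  have us_s: "(\<lambda>k. us (s k)) \<longlonglongrightarrow> F" using LIMSEQ_subseq_LIMSEQ[OF r(2) r'(1)] by (intro lim) (simp add: o_def)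
  have uw_s: "(\<lambda>k. (u (s k), w (s k))) \<longlonglongrightarrow> (xbar, y)" by (intro tendsto_Pair sub u lim r'(2))
  have "(xbar, y) \<in> gph G"
    by (rule closed_sequentially[OF cl _ uw_s]) (use w(1) in \<open>simp add: gph_def\<close>)
  moreover have "(F, - ys) \<in> limiting_normal_cone (gph G) (xbar, y)"
    unfolding limiting_normal_cone_def
  proof (intro CollectI exI conjI allI)
    show "(\<lambda>k. (u (s k), w (s k))) \<longlonglongrightarrow> (xbar, y)" by (rule uw_s)
    show "(\<lambda>k. (us (s k), - ws (s k))) \<longlonglongrightarrow> (F, - ys)" by (intro tendsto_Pair us_s tendsto_minus sub ws)
    show "(us (s k), - ws (s k)) \<in> regular_normal_cone (gph G) (u (s k), w (s k))" for k by (rule N[OF sN])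
  qed
  ultimately show ?thesis by (auto simp: gph_def coderivative_def)
qed

theorem (in lipschitz_integrand) coderivative_expected_integral_subset:
  assumes dec: "atomic_decomposition M Tpa Tna"
  shows "coderivative (expected_integral M \<Phi>) xbar ybar ystar
    \<subseteq> aumann_integral M (\<lambda>t. \<Union>y\<in>\<Phi> t xbar. coderivative (\<Phi> t) xbar y ystar)"
proof
  fix xs assume "xs \<in> coderivative (expected_integral M \<Phi>) xbar ybar ystar"
  then obtain p ps where p: "p \<longlonglongrightarrow> (xbar, ybar)" and ps: "ps \<longlonglongrightarrow> (xs, - ystar)"
    and rn: "\<And>k::nat. ps k \<in> regular_normal_cone (gph (expected_integral M \<Phi>)) (p k)"
    unfolding coderivative_def limiting_normal_cone_def by blast
  have "(\<lambda>k. fst (p k)) \<longlonglongrightarrow> xbar" using tendsto_fst[OF p] by simp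
  then have "\<forall>\<^sub>F k in sequentially. fst (p k) \<in> ball xbar \<eta>"
    by (rule topological_tendstoD) (use \<eta>_pos in auto)
  then obtain k0 where k0: "\<And>k. k \<ge> k0 \<Longrightarrow> fst (p k) \<in> ball xbar \<eta>"
    unfolding eventually_sequentially by blast
  define x where "x k = fst (p (k + k0))" for k
  define xk where "xk k = fst (ps (k + k0))" for k
  define yk where "yk k = - snd (ps (k + k0))" for k
  have x_lim: "x \<longlonglongrightarrow> xbar" unfolding x_def using \<open>(\<lambda>k. fst (p k)) \<longlonglongrightarrow> xbar\<close> by (rule LIMSEQ_ignore_initial_segment)
  have xk_lim: "xk \<longlonglongrightarrow> xs" unfolding xk_def
    using tendsto_fst[OF ps] by (intro LIMSEQ_ignore_initial_segment) simp
  have yk_lim: "yk \<longlonglongrightarrow> ystar" unfolding yk_def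
    using tendsto_minus[OF tendsto_snd[OF ps]] by (intro LIMSEQ_ignore_initial_segment[where f = "\<lambda>k. - snd (ps k)"]) simp
  have xb: "x k \<in> ball xbar \<eta>" for k unfolding x_def by (rule k0) simp
  \<comment> \<open>A common bound on the \<open>yk\<close> replaces defects and majorants that vary
    with \<open>k\<close> by one family of defects and one integrable majorant.\<close>
  obtain B where B: "\<And>k. norm (yk k) \<le> B"
    using convergent_imp_Bseq[OF convergentI[OF yk_lim]] unfolding Bseq_def by blast
  have B0: "B \<ge> 0" using B[of 0] norm_ge_zero order_trans by blast
  define e where "e k = 1 / real (Suc k)" for k :: nat
  have e0: "e k > 0" for k by (simp add: e_def)
  have e_lim: "e \<longlonglongrightarrow> 0" unfolding e_def by (rule LIMSEQ_Suc) (rule lim_1_over_n)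
  have d_lim: "(\<lambda>k. defect B (e k)) \<longlonglongrightarrow> 0" unfolding e_def by (rule defect_tendsto_zero)
  define m where "m = measure M (space M)"
  have "\<exists>u w us ws. decoupled_normals (x k) (xk k) (yk k) (e k) u w us ws" for k
  proof -
    have rnk: "(xk k, - yk k) \<in> regular_normal_cone (gph (expected_integral M \<Phi>)) (x k, snd (p (k + k0)))"
      using rn[of "k + k0"] by (simp add: xk_def yk_def x_def)
    then have "(x k, snd (p (k + k0))) \<in> gph (expected_integral M \<Phi>)"
      unfolding regular_normal_cone_iff by blast
    then obtain v where v: "integrable M v" "AE t in M. v t \<in> \<Phi> t (x k)" and pv: "snd (p (k + k0)) = (LINT t|M. v t)"
      unfolding gph_def expected_integral_def aumann_integral_def by blast
    have "x k \<in> cball xbar \<eta>" using xb[of k] by simp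
    then have sv: "selection (\<lambda>_. x k) v"
      unfolding selection_def using v by (auto elim!: eventually_mono)
    show ?thesis
      by (rule regular_normal_decoupling[OF xb sv e0 rnk[unfolded pv]])
  qed
  then obtain u w us ws where st: "\<And>k. decoupled_normals (x k) (xk k) (yk k) (e k) (u k) (w k) (us k) (ws k)" by metis
  have sel: "selection (u k) (w k)" and us_meas: "us k \<in> borel_measurable M"
    and ws_int: "integrable M (\<lambda>t. ws k t - yk k)"
    and u_near: "AE t in M. norm (u k t - x k) \<le> e k * (1 + l t)"
    and normals: "AE t in M. u k t \<in> ball xbar \<eta> \<longrightarrow> (us k t, - ws k t) \<in> regular_normal_cone (gph (\<Phi> t)) (u k t, w k t)"
    and us_le: "AE t in M. norm (us k t) \<le> 2 * (4 * norm (yk k) + 3) * l t"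
    and us_I: "norm ((LINT t|M. us k t) - xk k) \<le> 6 * defect (norm (yk k)) (e k)"
    and ws_I: "(LINT t|M. norm (ws k t - yk k)) \<le>
      3 * (norm (yk k) + 1) * (e k * m + 4 * defect (norm (yk k)) (e k) + (e k)\<^sup>2)" for k
    using st[of k] unfolding decoupled_normals_def m_def by - ((elim conjE, assumption)+)
  have us_lim: "(\<lambda>k. \<integral>t. us k t \<partial>M) \<longlonglongrightarrow> xs"
  proof -
    have "(\<lambda>k. (LINT t|M. us k t) - xk k) \<longlonglongrightarrow> 0"
    proof (rule Lim_null_comparison)
      show "\<forall>\<^sub>F k in sequentially. norm ((LINT t|M. us k t) - xk k) \<le> 6 * defect B (e k)"
      proof (intro always_eventually allI)
        fix k show "norm ((LINT t|M. us k t) - xk k) \<le> 6 * defect B (e k)"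
          using us_I[of k] defect_mono[OF B[of k], of "e k"] by linarith
      qed
      show "(\<lambda>k. 6 * defect B (e k)) \<longlonglongrightarrow> 0" using tendsto_mult_right_zero[OF d_lim] .
    qed
    from tendsto_add[OF this xk_lim] show ?thesis by simp
  qed
  have "(\<lambda>k. \<integral>t. norm (ws k t - yk k) \<partial>M) \<longlonglongrightarrow> 0"
  proof (rule Lim_null_comparison)
    show "\<forall>\<^sub>F k in sequentially. norm (LINT t|M. norm (ws k t - yk k))
        \<le> 3 * (B + 1) * (e k * m + 4 * defect B (e k) + (e k)\<^sup>2)"
    proof (intro always_eventually allI)
      fix k
      have dm: "defect (norm (yk k)) (e k) \<le> defect B (e k)" by (rule defect_mono[OF B])
      have "0 \<le> 6 * defect (norm (yk k)) (e k)" using us_I[of k] norm_ge_zero order_trans by blast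
      then have "0 \<le> e k * m + 4 * defect (norm (yk k)) (e k) + (e k)\<^sup>2" using e0[of k] by (simp add: m_def)
      then have "3 * (norm (yk k) + 1) * (e k * m + 4 * defect (norm (yk k)) (e k) + (e k)\<^sup>2)
        \<le> 3 * (B + 1) * (e k * m + 4 * defect B (e k) + (e k)\<^sup>2)"
        using B[of k] B0 dm by (intro mult_mono) auto
      then show "norm (LINT t|M. norm (ws k t - yk k)) \<le> 3 * (B + 1) * (e k * m + 4 * defect B (e k) + (e k)\<^sup>2)"
        using ws_I[of k] by simp
    qed
    have "(\<lambda>k. 3 * (B + 1) * (e k * m + 4 * defect B (e k) + (e k)\<^sup>2)) \<longlonglongrightarrow> 3 * (B + 1) * (0 * m + 4 * 0 + 0\<^sup>2)"
      by (intro tendsto_intros e_lim d_lim)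
    then show "(\<lambda>k. 3 * (B + 1) * (e k * m + 4 * defect B (e k) + (e k)\<^sup>2)) \<longlonglongrightarrow> 0" by simp
  qed
  \<comment> \<open>Almost everywhere convergence of \<open>ws\<close> is arranged before the Fatou
    lemma is applied: it persists along the subsequences, depending on \<open>t\<close>, that
    realise the cluster points of \<open>us\<close>.\<close>
  from tendsto_L1_AE_subseq[OF ws_int this] obtain r :: "nat \<Rightarrow> nat" where r: "strict_mono r"
    and ws_r: "AE t in M. (\<lambda>k. ws (r k) t - yk (r k)) \<longlonglongrightarrow> 0" by blast
  have r_lim: "(\<lambda>k. X (r k)) \<longlonglongrightarrow> L" if "X \<longlonglongrightarrow> L" for X :: "nat \<Rightarrow> 'c::topological_space" and L
    using LIMSEQ_subseq_LIMSEQ[OF that r] by (simp add: o_def)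
  have g_int: "integrable M (\<lambda>t. 2 * (4 * B + 3) * l t)" using l_int by simp
  have us_bd: "AE t in M. \<forall>k. norm (us (r k) t) \<le> 2 * (4 * B + 3) * l t"
    unfolding AE_all_countable
  proof
    fix k
    show "AE t in M. norm (us (r k) t) \<le> 2 * (4 * B + 3) * l t"
      using us_le[of "r k"] AE_space
    proof eventually_elim
      case (elim t)
      have "2 * (4 * norm (yk (r k)) + 3) * l t \<le> 2 * (4 * B + 3) * l t"
        using B[of "r k"] l_nonneg[OF elim(2)] by (intro mult_right_mono) auto
      then show ?case using elim(1) by linarith
    qed
  qed
  from fatou_cluster_point[OF finite_M complete_M dec g_int us_meas us_bd r_lim[OF us_lim]]
  obtain F where F: "integrable M F" "AE t in M. cluster_point (\<lambda>k. us (r k) t) (F t)" "(LINT t|M. F t) = xs" by blast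
  have 1: "AE t in M. \<forall>k. norm (u k t - x k) \<le> e k * (1 + l t)" using u_near by (simp add: AE_all_countable)
  have 2: "AE t in M. \<forall>k. u k t \<in> ball xbar \<eta> \<longrightarrow> (us k t, - ws k t) \<in> regular_normal_cone (gph (\<Phi> t)) (u k t, w k t)"
    using normals by (simp add: AE_all_countable)
  have 3: "AE t in M. \<forall>k. u k t \<in> cball xbar \<eta> \<and> w k t \<in> \<Phi> t (u k t)"
    unfolding AE_all_countable using selectionD(3)[OF sel] by blast
  have 4: "AE t in M. \<forall>k. norm (w k t) \<le> \<kappa> t"
    unfolding AE_all_countable using selection_norm_le[OF sel] by blast
  have "AE t in M. F t \<in> (\<Union>y\<in>\<Phi> t xbar. coderivative (\<Phi> t) xbar y ystar)"
    using F(2) ws_r closed_graph 1 2 3 4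
  proof eventually_elim
    case (elim t)
    have u_lim: "(\<lambda>k. u k t) \<longlonglongrightarrow> xbar"
    proof -
      have "(\<lambda>k. u k t - x k) \<longlonglongrightarrow> 0"
      proof (rule Lim_null_comparison)
        show "\<forall>\<^sub>F k in sequentially. norm (u k t - x k) \<le> e k * (1 + l t)"
          using elim(4) by (intro always_eventually)
        show "(\<lambda>k. e k * (1 + l t)) \<longlonglongrightarrow> 0" using tendsto_mult_left_zero[OF e_lim] .
      qed
      from tendsto_add[OF this x_lim] show ?thesis by simp
    qed
    then have ur_lim: "(\<lambda>k. u (r k) t) \<longlonglongrightarrow> xbar" by (rule r_lim)
    then have "\<forall>\<^sub>F k in sequentially. u (r k) t \<in> ball xbar \<eta>"
      by (rule topological_tendstoD) (use \<eta>_pos in auto)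
    then have nr: "\<forall>\<^sub>F k in sequentially. (us (r k) t, - ws (r k) t) \<in> regular_normal_cone (gph (\<Phi> t)) (u (r k) t, w (r k) t)"
      by eventually_elim (use elim(5) in blast)
    have ws_lim: "(\<lambda>k. ws (r k) t) \<longlonglongrightarrow> ystar" using tendsto_add[OF elim(2) r_lim[OF yk_lim]] by simp
    have wr: "\<And>k. w (r k) t \<in> \<Phi> t (u (r k) t)" "\<And>k. norm (w (r k) t) \<le> \<kappa> t" using elim(6,7) by blast+
    from cluster_point_coderivative[OF elim(3) ur_lim ws_lim elim(1) wr nr]
    show ?case by blast
  qed
  with F(1,3) show "xs \<in> aumann_integral M (\<lambda>t. \<Union>y\<in>\<Phi> t xbar. coderivative (\<Phi> t) xbar y ystar)"
    unfolding aumann_integral_def by blast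
qed

section \<open>Reduction of the stated hypotheses to the locale\<close>

theorem theorem5p5:
  fixes M :: "'t measure"
    and Tpa Tna :: "'t set"
    and \<Phi> :: "'t \<Rightarrow> real ^ 'n \<Rightarrow> (real ^ 'm) set"
    and xbar :: "real ^ 'n" and ybar ystar :: "real ^ 'm"
    and \<rho> :: real and \<kappa> :: "'t \<Rightarrow> real"
  assumes "finite_measure M" and "complete_measure M"
    and "atomic_decomposition M Tpa Tna"
    and "sv_normal_integrand M \<Phi>"
    and "xbar \<in> sv_dom (expected_integral M \<Phi>)"
    and "\<rho> > 0"
    and "integrable M \<kappa>" and "\<forall>t\<in>space M. \<kappa> t > 0"
    and "\<forall>x\<in>cball xbar \<rho>. AE t in M. t \<in> Tna \<longrightarrow> convex (\<Phi> t x)"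
    and "\<forall>x\<in>cball xbar \<rho>. AE t in M. \<Phi> t x \<subseteq> (*\<^sub>R) (\<kappa> t) ` cball 0 1"
    and "integrably_locally_Lipschitzian M \<Phi> xbar"
    and "ybar \<in> expected_integral M \<Phi> xbar"
  shows "coderivative (expected_integral M \<Phi>) xbar ybar ystar
           \<subseteq> aumann_integral M (\<lambda>t. \<Union>y\<in>\<Phi> t xbar. coderivative (\<Phi> t) xbar y ystar)"
proof -
  obtain \<eta> l That where \<eta>: "\<eta> > 0" and That: "That \<in> sets M" "emeasure M (space M - That) = 0"
    and l: "integrable M l" "\<forall>t\<in>space M. l t > 0"
    and lip: "\<forall>t\<in>That. \<forall>x\<in>cball xbar \<eta>. \<forall>x'\<in>cball xbar \<eta>.
      \<Phi> t x \<subseteq> \<Phi> t x' + (*\<^sub>R) (l t * norm (x - x')) ` cball 0 1"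
    using assms(11) unfolding integrably_locally_Lipschitzian_def by blast
  have "space M - That \<in> null_sets M" using That by (simp add: null_sets_def)
  then have "AE t in M. t \<notin> space M - That" by (rule AE_not_in)
  then have AE_That: "AE t in M. t \<in> That" using AE_space by eventually_elim blast
  have lip': "AE t in M. \<forall>x\<in>cball xbar \<eta>. \<forall>x'\<in>cball xbar \<eta>. \<forall>y\<in>\<Phi> t x. \<exists>y'\<in>\<Phi> t x'. norm (y' - y) \<le> l t * norm (x - x')"
    using AE_That AE_space
  proof (eventually_elim, intro ballI)
    fix t x x' y assume t: "t \<in> That" "t \<in> space M" and x: "x \<in> cball xbar \<eta>" "x' \<in> cball xbar \<eta>" and y: "y \<in> \<Phi> t x"
    have "y \<in> \<Phi> t x' + (*\<^sub>R) (l t * norm (x - x')) ` cball 0 1" using lip t(1) x y by blast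
    then obtain y' z where y': "y' \<in> \<Phi> t x'" and z: "z \<in> (*\<^sub>R) (l t * norm (x - x')) ` cball 0 1" and yz: "y = y' + z"
      by (rule set_plus_elim)
    obtain b :: "real ^ 'm" where b: "z = (l t * norm (x - x')) *\<^sub>R b" and "b \<in> cball 0 1" using z by (rule imageE)
    then have b1: "norm b \<le> 1" by simp
    have lt: "0 \<le> l t * norm (x - x')" using l(2) t(2) by (simp add: less_imp_le)
    have "norm (y' - y) = l t * norm (x - x') * norm b" unfolding yz b using lt by (simp add: abs_of_nonneg)
    also have "\<dots> \<le> l t * norm (x - x') * 1" using b1 lt by (rule mult_left_mono)
    finally show "\<exists>y'\<in>\<Phi> t x'. norm (y' - y) \<le> l t * norm (x - x')" using y' by auto
  qed
  have ne: "AE t in M. \<Phi> t xbar \<noteq> {}"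
  proof -
    obtain v where "AE t in M. v t \<in> \<Phi> t xbar"
      using assms(12) unfolding expected_integral_def aumann_integral_def by blast
    then show ?thesis by eventually_elim blast
  qed
  have bd: "AE t in M. \<Phi> t xbar \<subseteq> (*\<^sub>R) (\<kappa> t) ` cball 0 1" using assms(6,10) by simp
  \<comment> \<open>In the boundedness hypothesis the exceptional null set may depend on
    \<open>x\<close>. Transporting nonemptiness and the bound from \<open>xbar\<close> by the
    Lipschitz estimate gives one null set for the whole ball, at the price of enlarging
    \<open>\<kappa> t\<close> by \<open>l t * \<eta>\<close>.\<close>
  have bd': "AE t in M. \<forall>x\<in>cball xbar \<eta>. \<Phi> t x \<noteq> {} \<and> \<Phi> t x \<subseteq> cball 0 (\<kappa> t + l t * \<eta>)"
    using lip' ne bd AE_space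
  proof (eventually_elim, intro ballI conjI)
    fix t x assume lt: "\<forall>x\<in>cball xbar \<eta>. \<forall>x'\<in>cball xbar \<eta>. \<forall>y\<in>\<Phi> t x. \<exists>y'\<in>\<Phi> t x'. norm (y' - y) \<le> l t * norm (x - x')"
      and ne: "\<Phi> t xbar \<noteq> {}" and bd: "\<Phi> t xbar \<subseteq> (*\<^sub>R) (\<kappa> t) ` cball 0 1" and t: "t \<in> space M" and x: "x \<in> cball xbar \<eta>"
    have xb: "xbar \<in> cball xbar \<eta>" using \<eta> by simp
    show "\<Phi> t x \<noteq> {}" using lt ne x xb by blast
    show "\<Phi> t x \<subseteq> cball 0 (\<kappa> t + l t * \<eta>)"
    proof
      fix y assume "y \<in> \<Phi> t x"
      then obtain y' where y': "y' \<in> \<Phi> t xbar" "norm (y' - y) \<le> l t * norm (x - xbar)" using lt x xb by blast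
      have "y' \<in> (*\<^sub>R) (\<kappa> t) ` cball 0 1" using bd y'(1) by (rule subsetD)
      then obtain b :: "real ^ 'm" where b: "y' = \<kappa> t *\<^sub>R b" and "b \<in> cball 0 1" by (rule imageE)
      then have b1: "norm b \<le> 1" by simp
      have k: "\<kappa> t \<ge> 0" "l t \<ge> 0" using assms(8) l(2) t by (auto simp: less_imp_le)
      have "norm y' = \<kappa> t * norm b" unfolding b using k by simp
      also have "\<dots> \<le> \<kappa> t * 1" using b1 k(1) by (rule mult_left_mono)
      finally have "norm y' \<le> \<kappa> t" by simp
      moreover have "l t * norm (x - xbar) \<le> l t * \<eta>"
        using x k(2) by (intro mult_left_mono) (auto simp: dist_norm norm_minus_commute)
      moreover have "norm y \<le> norm y' + norm (y' - y)" using norm_triangle_ineq4[of y' "y' - y"] by simp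
      ultimately show "y \<in> cball 0 (\<kappa> t + l t * \<eta>)" using y'(2) by simp
    qed
  qed
  have "lipschitz_integrand M \<Phi> xbar \<eta> l (\<lambda>t. \<kappa> t + l t * \<eta>)"
  proof (rule lipschitz_integrand.intro)
    show "finite_measure M" "complete_measure M" by fact+
    show "\<eta> > 0" by fact
    show "integrable M l" by fact
    show "0 \<le> l t" if "t \<in> space M" for t using l(2) that by (simp add: less_imp_le)
    show "integrable M (\<lambda>t. \<kappa> t + l t * \<eta>)" using assms(7) l(1) by simp
    show "AE t in M. closed (gph (\<Phi> t))" using assms(4) by (intro AE_I2) (simp add: sv_normal_integrand_def)
    show "{(t, x, y). t \<in> space M \<and> y \<in> \<Phi> t x} \<in> sets (M \<Otimes>\<^sub>M (borel :: ((real ^ 'n) \<times> (real ^ 'm)) measure))"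
      using assms(4) by (simp add: sv_normal_integrand_def)
  qed (fact lip' bd')+
  then show ?thesis by (rule lipschitz_integrand.coderivative_expected_integral_subset[OF _ assms(3)])
qed

end
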